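(* Let $R=\bigoplus_{u\ge0}R_u$ be a standard graded finitely generated algebra over a field $R_0=k$ which is a domain of Krull dimension $d>0$, with homogeneous maximal ideal $\mathfrak{m}=\bigoplus_{u\ge1}R_u$, and let $I\subseteq R$ be a nonzero homogeneous ideal. Let $S=R[U]$, where $U$ is a variable with $\deg U=1$, and $\mathfrak{n}=\mathfrak{m}+(U)$. Suppose that there exists an integer $v_0>0$ such that $\mathcal{S}(I)^{\langle v_0\rangle}$ is a standard graded $R$-algebra. Let $\beta_{v_0}>0$ be an integer such that both $I^{v_0}$ and $\widetilde{I^{v_0}}$ are generated in degrees $\le\beta_{v_0}$. Then $$\varepsilon(I)=\lim_{v\to\infty}\frac{\lambda_R\left(H^0_{\mathfrak{m}}(R/I^v)\right)}{v^d/d!}=\frac{1}{v_0^d}\cdot\left[e_d\left(\mathfrak{n}\,\vert\,\langle(\widetilde{I^{v_0}}S)_{\beta_{v_0}}\rangle\right)-e_d\left(\mathfrak{n}\,\vert\,\langle(I^{v_0}S)_{\beta_{v_0}}\rangle\right)\right].$$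
   Context: $\lambda_R(N)$ denotes the length of a finite length $R$-module $N$. For a homogeneous ideal $I$, $\widetilde{I^n}=I^n\colon_R\mathfrak{m}^\infty$ is the saturation of $I^n$; $\mathcal{S}(I)=\bigoplus_{n\ge0}\widetilde{I^n}t^n$ is the saturated Rees algebra, and $\mathcal{S}(I)^{\langle v_0\rangle}=\bigoplus_{v\ge0}\widetilde{I^{vv_0}}$ is its $v_0$-th Veronese subalgebra, graded by $v$; it is a standard graded $R$-algebra when it is generated over its degree $0$ part $R$ by its degree $1$ part, i.e. $\widetilde{I^{vv_0}}=(\widetilde{I^{v_0}})^v$ for all $v\ge 0$. The $\varepsilon$-multiplicity is $\varepsilon(I)=\limsup_{n\to\infty}\frac{\lambda_R(H^0_{\mathfrak{m}}(R/I^n))}{n^d/d!}$ (the theorem includes that the limit exists). For a homogeneous ideal $K\subseteq S$ and an integer $\beta\ge0$, $\langle K_\beta\rangle$ is the ideal of $S$ generated by the homogeneous elements of $K$ of degree $\beta$. Mixed multiplicities: $S$ is a standard graded domain of dimension $d+1$; for a nonzero homogeneous ideal $\mathfrak{a}\subseteq S$ and all $u,v\gg0$, $\dim_k(\mathfrak{n}^u\mathfrak{a}^v/\mathfrak{n}^{u+1}\mathfrak{a}^v)$ equals a numerical polynomial $Q(u,v)$ of total degree $d$, and the integers $e_i(\mathfrak{n}\vert\mathfrak{a})$, $0\le i\le d$, are defined by $Q(u,v)=\sum_{i=0}^{d}\frac{e_i(\mathfrak{n}\vert\mathfrak{a})}{i!(d-i)!}u^{d-i}v^i+\text{lower degree terms}$.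 *)

theory Defs
  imports
    "HOL-Algebra.Algebra"
    "HOL-Library.Extended_Real"
    "HOL-Library.Liminf_Limsup"
begin

section \<open>Krull dimension and length\<close>

definition krull_dim :: "('a, 'b) ring_scheme \<Rightarrow> enat" where
  "krull_dim A = Sup {enat l | l. \<exists>P. (\<forall>i\<le>l. primeideal (P i) A) \<and> (\<forall>i<l. P i \<subset> P (Suc i))}"

definition module_length :: "('a, 'b) ring_scheme \<Rightarrow> ('a, 'c, 'm) module_scheme \<Rightarrow> enat" where
  "module_length A M =
     Sup {enat l | l. \<exists>N. (\<forall>i\<le>l. submodule (N i) A M) \<and> (\<forall>i<l. N i \<subset> N (Suc i))}"


section \<open>Graded rings\<close>

text \<open>The sum \<open>\<Sum>u. G u\<close> of a family of additive subgroups (every \<open>G u\<close> contains zero, so a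
  finite sum of homogeneous elements can be written as a sum over an initial segment).\<close>

definition graded_sum :: "('a, 'b) ring_scheme \<Rightarrow> (nat \<Rightarrow> 'a set) \<Rightarrow> 'a set" where
  "graded_sum A G = {finsum A f {..n} | f n. \<forall>u. f u \<in> G u}"

definition graded_ring :: "('a, 'b) ring_scheme \<Rightarrow> (nat \<Rightarrow> 'a set) \<Rightarrow> bool" where
  "graded_ring A G \<longleftrightarrow>
     ring A \<and>
     (\<forall>u. additive_subgroup (G u) A) \<and>
     (\<forall>u v. \<forall>x\<in>G u. \<forall>y\<in>G v. x \<otimes>\<^bsub>A\<^esub> y \<in> G (u + v)) \<and>
     carrier A = graded_sum A G \<and>
     (\<forall>f n. (\<forall>u. f u \<in> G u) \<longrightarrow> finsum A f {..n} = \<zero>\<^bsub>A\<^esub> \<longrightarrow> (\<forall>u\<le>n. f u = \<zero>\<^bsub>A\<^esub>))"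

text \<open>Generated as an algebra over the degree \<open>0\<close> part by the degree \<open>1\<close> part.\<close>

definition standard_graded :: "('a, 'b) ring_scheme \<Rightarrow> (nat \<Rightarrow> 'a set) \<Rightarrow> bool" where
  "standard_graded A G \<longleftrightarrow> graded_ring A G \<and> generate_ring A (G 0 \<union> G 1) = carrier A"

definition irrelevant :: "('a, 'b) ring_scheme \<Rightarrow> (nat \<Rightarrow> 'a set) \<Rightarrow> 'a set" where
  "irrelevant A G = graded_sum A (\<lambda>u. if u = 0 then {\<zero>\<^bsub>A\<^esub>} else G u)"

definition homogeneous_ideal ::
  "('a, 'b) ring_scheme \<Rightarrow> (nat \<Rightarrow> 'a set) \<Rightarrow> 'a set \<Rightarrow> bool" where
  "homogeneous_ideal A G K \<longleftrightarrow> ideal K A \<and> Idl\<^bsub>A\<^esub> (K \<inter> (\<Union>u. G u)) = K"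

definition generated_in_degrees_le ::
  "('a, 'b) ring_scheme \<Rightarrow> (nat \<Rightarrow> 'a set) \<Rightarrow> 'a set \<Rightarrow> nat \<Rightarrow> bool" where
  "generated_in_degrees_le A G K \<beta> \<longleftrightarrow> Idl\<^bsub>A\<^esub> (K \<inter> (\<Union>u\<le>\<beta>. G u)) = K"

definition degree_part_ideal ::
  "('a, 'b) ring_scheme \<Rightarrow> (nat \<Rightarrow> 'a set) \<Rightarrow> 'a set \<Rightarrow> nat \<Rightarrow> 'a set" where
  "degree_part_ideal A G K \<beta> = Idl\<^bsub>A\<^esub> (K \<inter> G \<beta>)"

definition veronese_grading :: "nat \<Rightarrow> (nat \<Rightarrow> 'a set) \<Rightarrow> nat \<Rightarrow> 'a set" where
  "veronese_grading v\<^sub>0 G v = G (v * v\<^sub>0)"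

definition veronese ::
  "nat \<Rightarrow> ('a, 'b) ring_scheme \<Rightarrow> (nat \<Rightarrow> 'a set) \<Rightarrow> ('a, 'b) ring_scheme" where
  "veronese v\<^sub>0 A G = A\<lparr>carrier := graded_sum A (veronese_grading v\<^sub>0 G)\<rparr>"


section \<open>Ideal powers and saturation\<close>

abbreviation ideal_power :: "('a, 'b) ring_scheme \<Rightarrow> 'a set \<Rightarrow> nat \<Rightarrow> 'a set" where
  "ideal_power A J n \<equiv> J [^]\<^bsub>ideals_set A\<^esub> n"

text \<open>\<open>J : \<mm>\<^sup>\<infinity>\<close>, the union of the colon ideals \<open>J : \<mm>\<^sup>j\<close>.\<close>

definition saturation :: "('a, 'b) ring_scheme \<Rightarrow> 'a set \<Rightarrow> 'a set \<Rightarrow> 'a set" where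
  "saturation A \<mm> J =
     {x \<in> carrier A. \<exists>j::nat. \<forall>y\<in>ideal_power A \<mm> j. x \<otimes>\<^bsub>A\<^esub> y \<in> J}"

text \<open>The saturated Rees algebra, as a graded subring of \<open>A[t]\<close>; its component of degree \<open>n\<close> is
  \<open>(I\<^sup>n : \<mm>\<^sup>\<infinity>) t\<^sup>n\<close>.\<close>

definition sat_rees_grading ::
  "('a, 'b) ring_scheme \<Rightarrow> 'a set \<Rightarrow> 'a set \<Rightarrow> nat \<Rightarrow> (nat \<Rightarrow> 'a) set" where
  "sat_rees_grading A \<mm> I n =
     (\<lambda>a. monom (UP A) a n) ` saturation A \<mm> (ideal_power A I n)"

definition sat_rees ::
  "('a, 'b) ring_scheme \<Rightarrow> 'a set \<Rightarrow> 'a set \<Rightarrow> ('a, nat \<Rightarrow> 'a) up_ring" where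
  "sat_rees A \<mm> I = (UP A)\<lparr>carrier := graded_sum (UP A) (sat_rees_grading A \<mm> I)\<rparr>"


section \<open>Local cohomology in degree zero and the epsilon multiplicity\<close>

definition quot_module ::
  "('a, 'b) ring_scheme \<Rightarrow> 'a set \<Rightarrow> ('a, 'a set) module" where
  "quot_module A J =
     \<lparr>carrier = a_rcosets\<^bsub>A\<^esub> J, monoid.mult = rcoset_mult A J, monoid.one = J +>\<^bsub>A\<^esub> \<one>\<^bsub>A\<^esub>,
      ring.zero = J, ring.add = set_add A,
      smult = (\<lambda>a C. (J +>\<^bsub>A\<^esub> a) \<otimes>\<^bsub>A Quot J\<^esub> C)\<rparr>"

definition local_cohomology_0 ::
  "('a, 'b) ring_scheme \<Rightarrow> 'a set \<Rightarrow> ('a, 'c, 'm) module_scheme \<Rightarrow> ('a, 'c, 'm) module_scheme" where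
  "local_cohomology_0 A \<mm> M =
     M\<lparr>carrier := {x \<in> carrier M. \<exists>j::nat. \<forall>a\<in>ideal_power A \<mm> j. a \<odot>\<^bsub>M\<^esub> x = \<zero>\<^bsub>M\<^esub>}\<rparr>"

text \<open>Here \<open>d\<close> is to be the Krull dimension of \<open>A\<close>. The quotient at \<open>n = 0\<close> is a dummy value.\<close>

definition epsilon_seq ::
  "('a, 'b) ring_scheme \<Rightarrow> 'a set \<Rightarrow> nat \<Rightarrow> 'a set \<Rightarrow> nat \<Rightarrow> ereal" where
  "epsilon_seq A \<mm> d I n =
     ereal_of_enat (module_length A (local_cohomology_0 A \<mm> (quot_module A (ideal_power A I n))))
       / ereal (real n ^ d / fact d)"

definition epsilon_multiplicity ::
  "('a, 'b) ring_scheme \<Rightarrow> 'a set \<Rightarrow> nat \<Rightarrow> 'a set \<Rightarrow> ereal" where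
  "epsilon_multiplicity A \<mm> d I = limsup (epsilon_seq A \<mm> d I)"


section \<open>The polynomial extension\<close>

text \<open>The grading of \<open>R[U]\<close> with \<open>deg U = 1\<close>.\<close>

definition poly_grading ::
  "('a, 'b) ring_scheme \<Rightarrow> (nat \<Rightarrow> 'a set) \<Rightarrow> nat \<Rightarrow> (nat \<Rightarrow> 'a) set" where
  "poly_grading A G n =
     {p \<in> carrier (UP A). (\<forall>i\<le>n. coeff (UP A) p i \<in> G (n - i)) \<and>
                          (\<forall>i>n. coeff (UP A) p i = \<zero>\<^bsub>A\<^esub>)}"

definition extended_ideal :: "('a, 'b) ring_scheme \<Rightarrow> 'a set \<Rightarrow> (nat \<Rightarrow> 'a) set" where
  "extended_ideal A J = Idl\<^bsub>UP A\<^esub> ((\<lambda>a. monom (UP A) a 0) ` J)"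

definition poly_max_ideal :: "('a, 'b) ring_scheme \<Rightarrow> 'a set \<Rightarrow> (nat \<Rightarrow> 'a) set" where
  "poly_max_ideal A \<mm> =
     extended_ideal A \<mm> <+>\<^bsub>UP A\<^esub> (Idl\<^bsub>UP A\<^esub> {monom (UP A) \<one>\<^bsub>A\<^esub> 1})"


section \<open>Mixed multiplicities\<close>

text \<open>For ideals \<open>J \<subseteq> K\<close> of a \<open>k\<close>-algebra \<open>A\<close> (\<open>k\<close> a subfield of \<open>A\<close>, \<open>J\<close> proper), the
  \<open>k\<close>-dimension of \<open>K/J\<close>: the quotient is viewed inside the ring \<open>A/J\<close>, over the image
  of \<open>k\<close> there.\<close>

definition quot_dim :: "('a, 'b) ring_scheme \<Rightarrow> 'a set \<Rightarrow> 'a set \<Rightarrow> 'a set \<Rightarrow> nat" where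
  "quot_dim A k K J =
     ring.dim (A Quot J) ((\<lambda>x. J +>\<^bsub>A\<^esub> x) ` k) ((\<lambda>x. J +>\<^bsub>A\<^esub> x) ` K)"

definition bigraded_hilbert ::
  "('a, 'b) ring_scheme \<Rightarrow> 'a set \<Rightarrow> 'a set \<Rightarrow> 'a set \<Rightarrow> nat \<Rightarrow> nat \<Rightarrow> nat" where
  "bigraded_hilbert A k \<nn> \<aa> u v =
     quot_dim A k (ideal_prod A (ideal_power A \<nn> u) (ideal_power A \<aa> v))
                  (ideal_prod A (ideal_power A \<nn> (u + 1)) (ideal_power A \<aa> v))"

text \<open>The multiplicity \<open>e\<^sub>j(\<nn>|\<aa>)\<close> for \<open>j \<le> d\<close>, where \<open>d + 1\<close> is to be the Krull dimension of \<open>A\<close>;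
  the double sum over \<open>c\<close> collects the terms of total degree less than \<open>d\<close>.\<close>

definition mixed_multiplicity ::
  "('a, 'b) ring_scheme \<Rightarrow> 'a set \<Rightarrow> nat \<Rightarrow> nat \<Rightarrow> 'a set \<Rightarrow> 'a set \<Rightarrow> int" where
  "mixed_multiplicity A k d j \<nn> \<aa> =
     (THE z. \<exists>(e :: nat \<Rightarrow> int) (c :: nat \<Rightarrow> nat \<Rightarrow> real) N. z = e j \<and>
        (\<forall>u\<ge>N. \<forall>v\<ge>N.
           real (bigraded_hilbert A k \<nn> \<aa> u v) =
             (\<Sum>i\<le>d. of_int (e i) / (fact i * fact (d - i)) * real u ^ (d - i) * real v ^ i) +
             (\<Sum>p<d. \<Sum>q<d - p. c p q * real u ^ p * real v ^ q)))"

end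

theory Submission
  imports Defs "HOL-Computational_Algebra.Polynomial" "HOL-Library.List_Lexorder"
begin

text \<open>
  Write \<open>F t\<close> for the sum of the components of \<open>R\<close> of degree at most \<open>t\<close>. If \<open>J\<close> is generated in
  degrees \<open>\<le> \<beta>\<close> and \<open>\<aa> = \<langle>(JS)\<^sub>\<beta>\<rangle>\<close>, then \<open>\<nn>\<^sup>u\<aa>\<^sup>v\<close> is generated by its forms of degree \<open>\<beta>v + u\<close>, and
  setting \<open>U = 1\<close> identifies these with \<open>B u v = J\<^sup>v \<inter> F (\<beta>v + u)\<close>. So the Hilbert function of the mixed
  multiplicities is \<open>dim (B u v)\<close>. The spaces \<open>B u v\<close> form a bigraded algebra generated by \<open>B 1 0\<close> and
  \<open>B 0 1\<close>; counting initial monomials shows that \<open>dim (B u v)\<close> is a polynomial for large \<open>u\<close> and \<open>v\<close>. Its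
  degree is at most \<open>d\<close>, because chains of primes bound the growth of \<open>dim (F t)\<close>, and therefore
  \<open>dim (B u v) / v\<^sup>d\<close> tends to \<open>e\<^sub>d(\<nn>|\<aa>) / d!\<close> for every large \<open>u\<close>.

  On the other side, the length of \<open>H\<^sup>0(R/I\<^sup>n)\<close> is the difference of the dimensions of the saturation of
  \<open>I\<^sup>n\<close> and of \<open>I\<^sup>n\<close>, both cut off at a large degree. Along a residue class \<open>n = v v\<^sub>0 + r\<close> these ideals form
  modules over the Rees algebras of the saturation of \<open>I\<^bsup>v\<^sub>0\<^esup>\<close>, by the Veronese hypothesis, and of \<open>I\<^bsup>v\<^sub>0\<^esup>\<close>, and
  these modules lie between shifts of the Rees algebras. Hence the leading coefficients do not depend on
  \<open>r\<close>, and subtracting the two limits gives the formula.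
\<close>

section \<open>Upsets of exponent vectors\<close>

text \<open>The obstacle is an interchange of limits. For a single power of \<open>I\<close> the
  length is a difference of two dimensions only in degrees beyond a bound that depends on the power,
  whereas a mixed multiplicity is read off at a fixed \<open>u\<close> while \<open>v\<close> grows.
  The bridge is that all these dimensions agree with polynomials in \<open>u\<close> from a
  threshold on that is independent of \<open>v\<close>: a polynomial that is constant for large
  \<open>u\<close> is constant. Hence the counting is done in bigraded algebras, through exponent
  vectors. Upward closed sets of exponents are finitely described by Dickson's lemma, which yields
  both the Hilbert polynomials and the ascending chain condition for ideals. Working with integer
  combinations of binomial coefficients makes the \<open>e_i\<close> integers at once. Replacing the
  forms of \<open>R[U]\<close> by a filtration of \<open>R\<close> keeps the linear algebra inside
  the domain \<open>R\<close>, where multiplication by a nonzero element is injective. This is how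
  modules are embedded into a Rees algebra and how they are squeezed between its shifts.\<close>

definition upset :: "nat \<Rightarrow> nat list set \<Rightarrow> bool" where
  "upset m L \<longleftrightarrow> (\<forall>\<alpha>\<in>L. length \<alpha> = m \<and> (\<forall>\<beta>. list_all2 (\<le>) \<alpha> \<beta> \<longrightarrow> \<beta> \<in> L))"

lemma nat_seq_mono_subseq:
  fixes g :: "nat \<Rightarrow> nat"
  obtains \<psi> :: "nat \<Rightarrow> nat" where "strict_mono \<psi>" "mono (g \<circ> \<psi>)"
proof -
  obtain \<psi> where \<psi>: "strict_mono \<psi>" "monoseq (\<lambda>n. g (\<psi> n))"
    using seq_monosub[of g] by blast
  show ?thesis
  proof (cases "mono (\<lambda>n. g (\<psi> n))")
    case True
    then show ?thesis using that[of \<psi>] \<psi> by (simp add: comp_def)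
  next
    case False
    with \<psi>(2) have "\<forall>m n. m \<le> n \<longrightarrow> g (\<psi> n) \<le> g (\<psi> m)"
      unfolding monoseq_def mono_def by blast
    then have dec: "g (\<psi> n) \<le> g (\<psi> m)" if "m \<le> n" for m n using that by blast
    \<comment> \<open>A nonincreasing sequence of naturals is constant from any place on where it
      attains its minimum \<open>k\<close>, and a constant tail is nondecreasing.\<close>
    define k where "k = (LEAST x. x \<in> range (\<lambda>n. g (\<psi> n)))"
    have "k \<in> range (\<lambda>n. g (\<psi> n))"
      unfolding k_def by (rule LeastI[of _ "g (\<psi> 0)"]) blast
    then obtain N where N: "k = g (\<psi> N)" by blast
    have "g (\<psi> n) = k" if "n \<ge> N" for n
    proof (rule antisym)
      show "g (\<psi> n) \<le> k" using dec[OF that] N by simp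
      show "k \<le> g (\<psi> n)" unfolding k_def by (rule Least_le) blast
    qed
    then have "mono (g \<circ> (\<lambda>n. \<psi> (n + N)))" by (simp add: mono_def)
    moreover have "strict_mono (\<lambda>n. \<psi> (n + N))"
      using \<psi>(1) by (simp add: strict_mono_def)
    ultimately show ?thesis by (rule that[rotated])
  qed
qed

text \<open>Dickson's lemma for a whole subsequence instead of one comparable pair: the induction on
  the length first thins out the sequence for the tails and then, inside that subsequence, for the
  heads.\<close>

lemma dickson:
  fixes f :: "nat \<Rightarrow> nat list"
  assumes "\<And>i. length (f i) = m"
  shows "\<exists>\<phi> :: nat \<Rightarrow> nat. strict_mono \<phi> \<and> (\<forall>i j. i \<le> j \<longrightarrow> list_all2 (\<le>) (f (\<phi> i)) (f (\<phi> j)))"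
  using assms
proof (induction m arbitrary: f)
  case 0
  then have "f i = []" for i by simp
  then show ?case by (intro exI[of _ id]) (simp add: strict_mono_def)
next
  case (Suc m)
  have "length (tl (f i)) = m" for i using Suc.prems[of i] by simp
  from Suc.IH[of "\<lambda>i. tl (f i)", OF this]
  obtain \<phi> :: "nat \<Rightarrow> nat" where \<phi>: "strict_mono \<phi>"
    "\<And>i j. i \<le> j \<Longrightarrow> list_all2 (\<le>) (tl (f (\<phi> i))) (tl (f (\<phi> j)))"
    by (elim exE conjE) simp
  obtain \<psi> :: "nat \<Rightarrow> nat" where \<psi>: "strict_mono \<psi>" "mono ((\<lambda>i. hd (f (\<phi> i))) \<circ> \<psi>)"
    by (rule nat_seq_mono_subseq[of "\<lambda>i. hd (f (\<phi> i))"])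
  have f: "f i = hd (f i) # tl (f i)" for i
    using Suc.prems[of i] by (cases "f i") auto
  have "list_all2 (\<le>) (f (\<phi> (\<psi> i))) (f (\<phi> (\<psi> j)))" if "i \<le> j" for i j
  proof -
    have "hd (f (\<phi> (\<psi> i))) \<le> hd (f (\<phi> (\<psi> j)))"
      using \<psi>(2) that by (simp add: mono_def)
    moreover have "\<psi> i \<le> \<psi> j" using \<psi>(1) that by (simp add: strict_mono_less_eq)
    ultimately have "list_all2 (\<le>) (hd (f (\<phi> (\<psi> i))) # tl (f (\<phi> (\<psi> i))))
        (hd (f (\<phi> (\<psi> j))) # tl (f (\<phi> (\<psi> j))))"
      using \<phi>(2) by simp
    then show ?thesis unfolding f[symmetric] .
  qed
  moreover have "strict_mono (\<phi> \<circ> \<psi>)" using \<phi>(1) \<psi>(1) by (rule strict_mono_o)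
  ultimately show ?case by (intro exI[of _ "\<phi> \<circ> \<psi>"]) (auto simp: comp_def)
qed

text \<open>The ascending chain condition for monomial ideals. Infinitely many exponents, each new
  at its stage, would by Dickson's lemma contain a comparable pair, and the earlier one forces the
  later one to be present too soon.\<close>

lemma upset_chain_stabilizes:
  assumes up: "\<And>n. upset m (L n)" and mono: "\<And>n. L n \<subseteq> L (Suc n)"
  shows "\<exists>N. \<forall>n\<ge>N. L n = L N"
proof (rule ccontr)
  assume "\<not> ?thesis"
  then have "\<forall>N. \<exists>n\<ge>N. L n \<noteq> L N" by blast
  have mono': "L i \<subseteq> L j" if "i \<le> j" for i j
    using mono that by (rule lift_Suc_mono_le)
  have "\<forall>N. \<exists>n \<alpha>. \<alpha> \<in> L n - L N"
  proof
    fix N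
    obtain n where "n \<ge> N" "L n \<noteq> L N" using \<open>\<forall>N. \<exists>n\<ge>N. L n \<noteq> L N\<close> by blast
    then show "\<exists>n \<alpha>. \<alpha> \<in> L n - L N" using mono'[of N n] by blast
  qed
  then obtain g a where ga: "\<And>N. a N \<in> L (g N) - L N" by metis
  \<comment> \<open>\<open>a N\<close> is absent at stage \<open>N\<close> and present at stage
    \<open>g N\<close>. Iterating \<open>g\<close> lines these witnesses up: \<open>a (s i)\<close>
    is absent at stage \<open>s i\<close> and present at all stages from \<open>s (Suc i)\<close>
    on.\<close>
  define s where "s = (\<lambda>i. (g ^^ i) 0)"
  have s: "a (s i) \<in> L (s (Suc i))" "a (s i) \<notin> L (s i)" for i
    using ga by (auto simp: s_def)
  have "s i \<le> s (Suc i)" for i using s[of i] mono'[of "s (Suc i)" "s i"] by (meson in_mono linear)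
  then have s_mono: "s i \<le> s j" if "i \<le> j" for i j using that by (rule lift_Suc_mono_le)
  have "length (a (s i)) = m" for i using s(1)[of i] up[of "s (Suc i)"] unfolding upset_def by blast
  from dickson[of "\<lambda>i. a (s i)" m, OF this] obtain \<phi> :: "nat \<Rightarrow> nat" where \<phi>: "strict_mono \<phi>" "\<And>i j. i \<le> j \<Longrightarrow> list_all2 (\<le>) (a (s (\<phi> i))) (a (s (\<phi> j)))"
    by (elim exE conjE) simp
  have "Suc (\<phi> 0) \<le> \<phi> 1" using \<phi>(1) by (simp add: Suc_leI strict_mono_less)
  then have "a (s (\<phi> 0)) \<in> L (s (\<phi> 1))"
    using s(1)[of "\<phi> 0"] mono'[OF s_mono] by blast
  then have "a (s (\<phi> 1)) \<in> L (s (\<phi> 1))"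
    using up[of "s (\<phi> 1)"] \<phi>(2)[of 0 1] unfolding upset_def by simp
  then show False using s(2) by blast
qed

section \<open>Counting functions\<close>

text \<open>The subgroup generated by \<open>B\<close>. The coefficients are integers because, in
  the binomial basis, they become the integers \<open>e_i\<close> of the mixed
  multiplicities.\<close>

inductive zspan :: "('b \<Rightarrow> int) set \<Rightarrow> ('b \<Rightarrow> int) \<Rightarrow> bool" for B where
  zero: "zspan B (\<lambda>_. 0)"
| add: "zspan B f \<Longrightarrow> x \<in> B \<Longrightarrow> zspan B (\<lambda>b. f b + c * x b)"

lemma zspan_add_smult:
  assumes "zspan B f" "zspan B g" shows "zspan B (\<lambda>b. f b + c * g b)"
  using assms(2,1)
proof (induction g rule: zspan.induct)
  case (add g x c')
  then have "zspan B (\<lambda>b. (f b + c * g b) + (c * c') * x b)" using zspan.add by blast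
  then show ?case by (simp add: algebra_simps)
qed simp

lemma zspan_base: "x \<in> B \<Longrightarrow> zspan B x"
  using zspan.add[OF zspan.zero, of x B 1] by simp

lemma zspan_plus: "zspan B f \<Longrightarrow> zspan B g \<Longrightarrow> zspan B (\<lambda>b. f b + g b)"
  using zspan_add_smult[of B f g 1] by simp

lemma zspan_diff: "zspan B f \<Longrightarrow> zspan B g \<Longrightarrow> zspan B (\<lambda>b. f b - g b)"
  using zspan_add_smult[of B f g "-1"] by simp

text \<open>A linear operator maps one span into another as soon as it does so on generators; fixing
  a variable, swapping the variables and partial summation are treated in this way below.\<close>

lemma zspan_linear:
  assumes "zspan B f" "T (\<lambda>_. 0) = (\<lambda>_. 0)"
    "\<And>f x c. T (\<lambda>b. f b + c * x b) = (\<lambda>b. T f b + c * T x b)"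
    "\<And>x. x \<in> B \<Longrightarrow> zspan Y (T x)"
  shows "zspan Y (T f)"
  using assms(1) by induction (simp_all add: assms zspan.zero zspan_add_smult)

section \<open>Polynomial functions in the binomial basis\<close>

abbreviation bin1 :: "(nat \<Rightarrow> int) set" where
  "bin1 \<equiv> range (\<lambda>p n. int (n choose p))"

abbreviation bin2 :: "(nat \<times> nat \<Rightarrow> int) set" where
  "bin2 \<equiv> range (\<lambda>(p, q) (u, v). int (u choose p) * int (v choose q))"

lemma bin1I: "zspan bin1 (\<lambda>n. int (n choose p))"
  by (intro zspan_base) auto

lemma bin2I: "zspan bin2 (\<lambda>(u, v). int (u choose p) * int (v choose q))"
  by (intro zspan_base) (auto intro: image_eqI[of _ _ "(p, q)"])

lemma bin2_mult_left:
  assumes "zspan bin1 g" shows "zspan bin2 (\<lambda>(u, v). g u * int (v choose q))"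
proof -
  have "zspan bin2 ((\<lambda>f (u, v). f u * int (v choose q)) g)"
    by (rule zspan_linear[OF assms]) (auto simp: fun_eq_iff algebra_simps bin2I)
  then show ?thesis by simp
qed

lemma bin2_of_bin1:
  assumes "zspan bin1 g" shows "zspan bin2 (\<lambda>(u, v). g u)"
  using bin2_mult_left[OF assms, of 0] by simp

lemma bin2_swap:
  assumes "zspan bin2 g" shows "zspan bin2 (\<lambda>(u, v). g (v, u))"
proof -
  have "zspan bin2 ((\<lambda>f (u, v). f (v, u)) g)"
  proof (rule zspan_linear[OF assms])
    fix x :: "nat \<times> nat \<Rightarrow> int" assume "x \<in> bin2"
    then obtain p q where "x = (\<lambda>(u, v). int (u choose p) * int (v choose q))" by auto
    then show "zspan bin2 (\<lambda>(u, v). x (v, u))" using bin2I[of q p] by (simp add: mult.commute)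
  qed auto
  then show ?thesis by simp
qed

text \<open>Pascal's rule solved for the predecessor. It needs \<open>u \<ge> 1\<close>, because
  \<open>u - 1\<close> is truncated at zero.\<close>

lemma bin1_pred: "\<exists>g. zspan bin1 g \<and> (\<forall>u\<ge>1. int ((u - 1) choose p) = g u)"
proof (induction p)
  case 0
  show ?case using bin1I[of 0] by (intro exI[of _ "\<lambda>n. int (n choose 0)"]) auto
next
  case (Suc p)
  then obtain g where g: "zspan bin1 g" "\<And>u. u \<ge> 1 \<Longrightarrow> int ((u - 1) choose p) = g u" by blast
  have "int ((u - 1) choose Suc p) = int (u choose Suc p) - g u" if "u \<ge> 1" for u
    using that g(2)[OF that, symmetric] by (cases u) auto
  then show ?case using zspan_diff[OF bin1I g(1)] by blast
qed

lemma bin2_pred: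
  assumes "zspan bin2 f" shows "\<exists>g. zspan bin2 g \<and> (\<forall>u\<ge>1. \<forall>v. f (u - 1, v) = g (u, v))"
  using assms
proof induction
  case zero
  show ?case by (intro exI[of _ "\<lambda>_. 0"]) (simp add: zspan.zero)
next
  case (add f x c)
  then obtain g where g: "zspan bin2 g" "\<And>u v. u \<ge> 1 \<Longrightarrow> f (u - 1, v) = g (u, v)" by blast
  obtain p q where x: "x = (\<lambda>(u, v). int (u choose p) * int (v choose q))" using add.hyps(2) by auto
  obtain h where h: "zspan bin1 h" "\<And>u. u \<ge> 1 \<Longrightarrow> int ((u - 1) choose p) = h u"
    using bin1_pred by blast
  show ?case
    using zspan_add_smult[OF g(1) bin2_mult_left[OF h(1)], of c q] g(2) h(2)
    by (intro exI[of _ "\<lambda>b. g b + c * (case b of (u, v) \<Rightarrow> h u * int (v choose q))"]) (auto simp: x)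
qed

text \<open>The hockey-stick identity, with \<open>Suc u choose Suc p\<close> already split by
  Pascal's rule into basis functions of \<open>u\<close>.\<close>

lemma sum_choose_upto: "(\<Sum>i\<le>u. int (i choose p)) = int (u choose Suc p) + int (u choose p)"
proof (induction u)
  case 0
  show ?case by (cases p) auto
qed simp

lemma bin1_sum:
  assumes "zspan bin1 f" shows "zspan bin1 (\<lambda>u. \<Sum>i\<le>u. f i)"
proof -
  have "zspan bin1 ((\<lambda>f u. \<Sum>i\<le>u. f i) f)"
    by (rule zspan_linear[OF assms])
       (auto simp: sum.distrib sum_distrib_left sum_choose_upto intro!: zspan_plus bin1I)
  then show ?thesis by simp
qed

lemma bin2_sum:
  assumes "zspan bin2 f" shows "zspan bin2 (\<lambda>(u, v). \<Sum>i\<le>u. f (i, v))"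
proof -
  have "zspan bin2 ((\<lambda>f (u, v). \<Sum>i\<le>u. f (i, v)) f)"
  proof (rule zspan_linear[OF assms])
    fix x :: "nat \<times> nat \<Rightarrow> int" assume "x \<in> bin2"
    then obtain p q where "x = (\<lambda>(u, v). int (u choose p) * int (v choose q))" by auto
    then have "(\<lambda>(u, v). \<Sum>i\<le>u. x (i, v)) =
        (\<lambda>(u, v). (int (u choose Suc p) + int (u choose p)) * int (v choose q))"
      by (auto simp: fun_eq_iff sum_choose_upto simp flip: sum_distrib_right)
    then show "zspan bin2 (\<lambda>(u, v). \<Sum>i\<le>u. x (i, v))"
      using bin2_mult_left[OF zspan_plus[OF bin1I bin1I]] by simp
  qed (auto simp: fun_eq_iff sum.distrib sum_distrib_left)
  then show ?thesis by simp
qed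

lemma bin2_fix:
  assumes "zspan bin2 f" shows "zspan bin1 (\<lambda>v. f (u, v))"
proof -
  have "zspan bin1 ((\<lambda>f v. f (u, v)) f)"
    by (rule zspan_linear[OF assms])
       (use zspan_add_smult[OF zspan.zero bin1I] in auto)
  then show ?thesis by simp
qed

definition ev_bin1 :: "(nat \<Rightarrow> int) \<Rightarrow> bool" where
  "ev_bin1 f \<longleftrightarrow> (\<exists>N g. zspan bin1 g \<and> (\<forall>n\<ge>N. f n = g n))"

lemma ev_bin1_add_smult: "ev_bin1 f \<Longrightarrow> ev_bin1 g \<Longrightarrow> ev_bin1 (\<lambda>n. f n + c * g n)"
  unfolding ev_bin1_def
proof (elim exE conjE)
  fix N N' f' g' assume "zspan bin1 f'" "\<forall>n\<ge>N. f n = f' n" "zspan bin1 g'" "\<forall>n\<ge>N'. g n = g' n"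
  then show "\<exists>N h. zspan bin1 h \<and> (\<forall>n\<ge>N. f n + c * g n = h n)"
    by (intro exI[of _ "max N N'"] exI[of _ "\<lambda>n. f' n + c * g' n"]) (auto intro: zspan_add_smult)
qed

lemma ev_bin1_eventually_zero: "(\<And>n. n \<ge> N \<Longrightarrow> f n = 0) \<Longrightarrow> ev_bin1 f"
  unfolding ev_bin1_def using zspan.zero by blast

lemma ev_bin1_sum: "(\<And>i. i \<in> A \<Longrightarrow> ev_bin1 (f i)) \<Longrightarrow> ev_bin1 (\<lambda>n. \<Sum>i\<in>A. f i n)"
proof (induction A rule: infinite_finite_induct)
  case (insert x F)
  then show ?case using ev_bin1_add_smult[of "f x" "\<lambda>n. \<Sum>i\<in>F. f i n" 1] by simp
qed (auto intro: ev_bin1_eventually_zero)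

lemma ev_bin1_pred:
  assumes "ev_bin1 f" shows "ev_bin1 (\<lambda>n. if n = 0 then 0 else f (n - 1))"
proof -
  obtain N g where g: "zspan bin1 g" "\<And>n. n \<ge> N \<Longrightarrow> f n = g n" using assms unfolding ev_bin1_def by blast
  obtain h where h: "zspan bin2 h" "\<And>u v. u \<ge> 1 \<Longrightarrow> (\<lambda>(u, v). g u) (u - 1, v) = h (u, v)"
    using bin2_pred[OF bin2_of_bin1[OF g(1)]] by blast
  have "zspan bin1 (\<lambda>u. h (u, 0))" using bin2_fix[OF bin2_swap[OF h(1)], of 0] by simp
  moreover have "(if n = 0 then 0 else f (n - 1)) = h (n, 0)" if "n \<ge> Suc N" for n
    using that g(2)[of "n - 1"] h(2)[of n 0] by auto
  ultimately show ?thesis unfolding ev_bin1_def by blast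
qed

text \<open>The values below \<open>N\<close> influence a partial sum beyond \<open>N\<close> only
  through a constant, so partial summation preserves eventual polynomiality.\<close>

lemma sum_upto_split:
  fixes f g :: "nat \<Rightarrow> int"
  assumes "\<And>i. i \<ge> N \<Longrightarrow> f i = g i" "u \<ge> N"
  shows "(\<Sum>i\<le>u. f i) = (\<Sum>i<N. f i - g i) + (\<Sum>i\<le>u. g i)"
proof -
  have "(\<Sum>i\<le>u. f i) - (\<Sum>i\<le>u. g i) = (\<Sum>i\<le>u. f i - g i)" by (simp add: sum_subtractf)
  also have "\<dots> = (\<Sum>i<N. f i - g i)"
    using assms by (intro sum.mono_neutral_right) auto
  finally show ?thesis by simp
qed

lemma ev_bin1_accumulate:
  assumes "ev_bin1 f" shows "ev_bin1 (\<lambda>n. \<Sum>i\<le>n. f i)"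
proof -
  obtain N g where g: "zspan bin1 g" "\<And>n. n \<ge> N \<Longrightarrow> f n = g n" using assms unfolding ev_bin1_def by blast
  have "(\<Sum>i\<le>n. f i) = (\<Sum>i\<le>n. g i) + (\<Sum>i<N. f i - g i) * int (n choose 0)" if "n \<ge> N" for n
    using sum_upto_split[of N f g n] g(2) that by simp
  moreover have "zspan bin1 (\<lambda>n. (\<Sum>i\<le>n. g i) + (\<Sum>i<N. f i - g i) * int (n choose 0))"
    by (intro zspan_add_smult bin1_sum g bin1I)
  ultimately show ?thesis unfolding ev_bin1_def by blast
qed

text \<open>The functions on \<open>\<nat>\<^sup>2\<close> whose generating function is a polynomial divided by powers of
  \<open>1 - x\<close> and \<open>1 - y\<close>.\<close>

inductive rat_gf :: "(nat \<times> nat \<Rightarrow> int) \<Rightarrow> bool" where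
  delta: "rat_gf (\<lambda>b. if b = (0, 0) then 1 else 0)"
| add_smult: "rat_gf f \<Longrightarrow> rat_gf g \<Longrightarrow> rat_gf (\<lambda>b. f b + c * g b)"
| swap: "rat_gf f \<Longrightarrow> rat_gf (\<lambda>(u, v). f (v, u))"
| shift: "rat_gf f \<Longrightarrow> rat_gf (\<lambda>(u, v). if u = 0 then 0 else f (u - 1, v))"
| accumulate: "rat_gf f \<Longrightarrow> rat_gf (\<lambda>(u, v). \<Sum>i\<le>u. f (i, v))"

definition ev_bin2 :: "(nat \<times> nat \<Rightarrow> int) \<Rightarrow> bool" where
  "ev_bin2 f \<longleftrightarrow> (\<exists>N g. zspan bin2 g \<and> (\<forall>u\<ge>N. \<forall>v\<ge>N. f (u, v) = g (u, v)))"

text \<open>The three claims must be proved together: partial sums in \<open>u\<close> involve the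
  finitely many rows below the threshold, which \<open>ev_bin2\<close> alone does not control, and
  \<open>swap\<close> exchanges rows with columns.\<close>

lemma rat_gf_ev_bin:
  assumes "rat_gf f"
  shows "ev_bin2 f \<and> (\<forall>u. ev_bin1 (\<lambda>v. f (u, v))) \<and> (\<forall>v. ev_bin1 (\<lambda>u. f (u, v)))"
  using assms
proof induction
  case delta
  have "ev_bin2 (\<lambda>b. if b = (0, 0) then 1 else 0)"
    unfolding ev_bin2_def by (intro exI[of _ 1] exI[of _ "\<lambda>_. 0"]) (auto intro: zspan.zero)
  then show ?case by (auto intro: ev_bin1_eventually_zero[of 1])
next
  case (add_smult f g c)
  obtain N f' where f': "zspan bin2 f'" "\<And>u v. u \<ge> N \<Longrightarrow> v \<ge> N \<Longrightarrow> f (u, v) = f' (u, v)"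
    using add_smult.IH(1) unfolding ev_bin2_def by blast
  obtain N' g' where g': "zspan bin2 g'" "\<And>u v. u \<ge> N' \<Longrightarrow> v \<ge> N' \<Longrightarrow> g (u, v) = g' (u, v)"
    using add_smult.IH(2) unfolding ev_bin2_def by blast
  have "ev_bin2 (\<lambda>b. f b + c * g b)"
    unfolding ev_bin2_def using f' g'
    by (intro exI[of _ "max N N'"] exI[of _ "\<lambda>b. f' b + c * g' b"]) (auto intro: zspan_add_smult)
  then show ?case using add_smult.IH by (auto intro: ev_bin1_add_smult)
next
  case (swap f)
  obtain N f' where f': "zspan bin2 f'" "\<And>u v. u \<ge> N \<Longrightarrow> v \<ge> N \<Longrightarrow> f (u, v) = f' (u, v)"
    using swap.IH unfolding ev_bin2_def by blast
  have "ev_bin2 (\<lambda>(u, v). f (v, u))"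
    unfolding ev_bin2_def using f' bin2_swap
    by (intro exI[of _ N] exI[of _ "\<lambda>(u, v). f' (v, u)"]) auto
  then show ?case using swap.IH by auto
next
  case (shift f)
  obtain N f' where f': "zspan bin2 f'" "\<And>u v. u \<ge> N \<Longrightarrow> v \<ge> N \<Longrightarrow> f (u, v) = f' (u, v)"
    using shift.IH unfolding ev_bin2_def by blast
  obtain g where g: "zspan bin2 g" "\<And>u v. u \<ge> 1 \<Longrightarrow> f' (u - 1, v) = g (u, v)"
    using bin2_pred[OF f'(1)] by blast
  have "f (u - 1, v) = g (u, v)" if "u \<ge> Suc N" "v \<ge> Suc N" for u v
    using f'(2)[of "u - 1" v] g(2)[of u v] that by auto
  then have "ev_bin2 (\<lambda>(u, v). if u = 0 then 0 else f (u - 1, v))"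
    unfolding ev_bin2_def using g(1) by (intro exI[of _ "Suc N"] exI[of _ g]) auto
  moreover have "ev_bin1 (\<lambda>v. if u = 0 then 0 else f (u - 1, v))" for u
    using shift.IH by (cases "u = 0") (auto intro: ev_bin1_eventually_zero)
  ultimately show ?case using shift.IH ev_bin1_pred by auto
next
  case (accumulate f)
  obtain N g where g: "zspan bin2 g" "\<And>u v. u \<ge> N \<Longrightarrow> v \<ge> N \<Longrightarrow> f (u, v) = g (u, v)"
    using accumulate.IH unfolding ev_bin2_def by blast
  have g1: "ev_bin1 (\<lambda>v. g (i, v))" for i
    using bin2_fix[OF g(1)] unfolding ev_bin1_def by blast
  \<comment> \<open>The error made on the rows \<open>i < N\<close> no longer depends on
    \<open>u\<close>; as a function of \<open>v\<close> it is eventually polynomial by the claim on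
    rows.\<close>
  have "ev_bin1 (\<lambda>v. \<Sum>i<N. f (i, v) + (-1) * g (i, v))"
    using accumulate.IH g1 by (intro ev_bin1_sum ev_bin1_add_smult) auto
  then obtain M h where h: "zspan bin1 h" "\<And>v. v \<ge> M \<Longrightarrow> (\<Sum>i<N. f (i, v) - g (i, v)) = h v"
    unfolding ev_bin1_def by auto
  have "zspan bin2 (\<lambda>b. (case b of (u, v) \<Rightarrow> h v) + (case b of (u, v) \<Rightarrow> \<Sum>i\<le>u. g (i, v)))"
    using bin2_swap[OF bin2_of_bin1[OF h(1)]] bin2_sum[OF g(1)] by (intro zspan_plus) auto
  moreover have "(\<Sum>i\<le>u. f (i, v)) = h v + (\<Sum>i\<le>u. g (i, v))" if "u \<ge> max M N" "v \<ge> max M N" for u v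
    using sum_upto_split[of N "\<lambda>i. f (i, v)" "\<lambda>i. g (i, v)" u] g(2) h(2) that by auto
  ultimately have "ev_bin2 (\<lambda>(u, v). \<Sum>i\<le>u. f (i, v))"
    unfolding ev_bin2_def
    by (intro exI[of _ "max M N"] exI[of _ "\<lambda>b. (case b of (u, v) \<Rightarrow> h v) + (case b of (u, v) \<Rightarrow> \<Sum>i\<le>u. g (i, v))"]) auto
  then show ?case using accumulate.IH by (auto intro: ev_bin1_accumulate ev_bin1_sum)
qed

section \<open>Counting exponent vectors outside an upset\<close>

fun udeg :: "bool list \<Rightarrow> nat list \<Rightarrow> nat" where
  "udeg (t # ts) (a # as) = (if t then 0 else a) + udeg ts as"
| "udeg _ _ = 0"

fun vdeg :: "bool list \<Rightarrow> nat list \<Rightarrow> nat" where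
  "vdeg (t # ts) (a # as) = (if t then a else 0) + vdeg ts as"
| "vdeg _ _ = 0"

text \<open>The entry \<open>False\<close> of \<open>ts\<close> marks a variable of bidegree (1,0),
  the entry \<open>True\<close> one of bidegree (0,1).\<close>

definition cell :: "bool list \<Rightarrow> nat \<times> nat \<Rightarrow> nat list set" where
  "cell ts b = {\<alpha>. length \<alpha> = length ts \<and> udeg ts \<alpha> = fst b \<and> vdeg ts \<alpha> = snd b}"

lemma cell_Nil: "cell [] b = (if b = (0, 0) then {[]} else {})"
  by (cases b) (auto simp: cell_def)

lemma cell_Cons:
  "cell (False # ts) (u, v) = (\<Union>j\<in>{..u}. Cons j ` cell ts (u - j, v))"
  "cell (True # ts) (u, v) = (\<Union>j\<in>{..v}. Cons j ` cell ts (u, v - j))"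
proof -
  show "cell (False # ts) (u, v) = (\<Union>j\<in>{..u}. Cons j ` cell ts (u - j, v))"
  proof (intro equalityI subsetI)
    fix \<alpha> assume "\<alpha> \<in> cell (False # ts) (u, v)"
    then show "\<alpha> \<in> (\<Union>j\<in>{..u}. Cons j ` cell ts (u - j, v))"
      by (cases \<alpha>) (auto simp: cell_def image_iff intro!: bexI[of _ "hd \<alpha>"])
  qed (auto simp: cell_def)
  show "cell (True # ts) (u, v) = (\<Union>j\<in>{..v}. Cons j ` cell ts (u, v - j))"
  proof (intro equalityI subsetI)
    fix \<alpha> assume "\<alpha> \<in> cell (True # ts) (u, v)"
    then show "\<alpha> \<in> (\<Union>j\<in>{..v}. Cons j ` cell ts (u, v - j))"
      by (cases \<alpha>) (auto simp: cell_def image_iff intro!: bexI[of _ "hd \<alpha>"])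
  qed (auto simp: cell_def)
qed

lemma finite_cell: "finite (cell ts b)"
proof (induction ts arbitrary: b)
  case (Cons t ts)
  then show ?case by (cases t; cases b) (auto simp: cell_Cons)
qed (simp add: cell_Nil)

lemma cell_swap: "cell (map Not ts) (u, v) = cell ts (v, u)"
proof -
  have "udeg (map Not ts) \<alpha> = vdeg ts \<alpha> \<and> vdeg (map Not ts) \<alpha> = udeg ts \<alpha>" for \<alpha>
    by (induction ts \<alpha> rule: udeg.induct) auto
  then show ?thesis by (auto simp: cell_def)
qed

lemma card_cell_Cons:
  "card (cell (False # ts) (u, v) - L) = (\<Sum>j\<le>u. card (cell ts (u - j, v) - {\<alpha>. j # \<alpha> \<in> L}))"
proof -
  have "cell (False # ts) (u, v) - L = (\<Union>j\<in>{..u}. Cons j ` (cell ts (u - j, v) - {\<alpha>. j # \<alpha> \<in> L}))"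
    by (auto simp: cell_Cons)
  also have "card \<dots> = (\<Sum>j\<le>u. card (Cons j ` (cell ts (u - j, v) - {\<alpha>. j # \<alpha> \<in> L})))"
    by (rule card_UN_disjoint) (auto simp: finite_cell)
  finally show ?thesis by (simp add: card_image)
qed

lemma rat_gf_shift_iter: "rat_gf f \<Longrightarrow> rat_gf (\<lambda>(u, v). if j \<le> u then f (u - j, v) else 0)"
proof (induction j)
  case 0
  then show ?case by (simp add: case_prod_unfold)
next
  case (Suc j)
  have "(\<lambda>(u, v). if Suc j \<le> u then f (u - Suc j, v) else 0) =
      (\<lambda>(u, v). if u = 0 then 0 else (\<lambda>(u, v). if j \<le> u then f (u - j, v) else 0) (u - 1, v))"
    by (auto simp: fun_eq_iff)
  then show ?case using rat_gf.shift[OF Suc.IH[OF Suc.prems]] by simp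
qed

lemma rat_gf_sum:
  assumes "\<And>i. i \<in> A \<Longrightarrow> rat_gf (f i)" shows "rat_gf (\<lambda>b. \<Sum>i\<in>A. f i b)"
proof -
  have "rat_gf (\<lambda>b. 0)" using rat_gf.add_smult[OF rat_gf.delta rat_gf.delta, of "-1"] by simp
  then show ?thesis using assms
  proof (induction A rule: infinite_finite_induct)
    case (insert x F)
    then show ?case using rat_gf.add_smult[of "f x" "\<lambda>b. \<Sum>i\<in>F. f i b" 1] by simp
  qed auto
qed

lemma upset_slice: "upset (Suc m) L \<Longrightarrow> upset m {\<alpha>. j # \<alpha> \<in> L}"
  unfolding upset_def by fastforce

lemma upset_slice_mono:
  assumes "upset (Suc m) L" shows "{\<alpha>. j # \<alpha> \<in> L} \<subseteq> {\<alpha>. Suc j # \<alpha> \<in> L}"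
proof
  fix \<alpha> assume "\<alpha> \<in> {\<alpha>. j # \<alpha> \<in> L}"
  moreover have "list_all2 (\<le>) (j # \<alpha>) (Suc j # \<alpha>)" by (simp add: list_all2_refl)
  ultimately show "\<alpha> \<in> {\<alpha>. Suc j # \<alpha> \<in> L}" using assms unfolding upset_def by blast
qed

text \<open>Slice by the exponent \<open>j\<close> of the first variable. The slices of
  \<open>L\<close> are increasing upsets in one variable less and are constant from some
  \<open>N\<close> on. The constant slice contributes a partial sum in \<open>u\<close>, which is
  division by \<open>1 - x\<close>, and each \<open>j < N\<close> contributes a shifted correction.
  The induction is on the length, because a leading \<open>True\<close> is handled by flipping all
  entries of \<open>ts\<close>.\<close>

lemma rat_gf_card_cell:
  assumes "upset (length ts) L" shows "rat_gf (\<lambda>b. int (card (cell ts b - L)))"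
  using assms
proof (induction ts arbitrary: L rule: length_induct)
  case (1 ts)
  show ?case
  proof (cases ts)
    case Nil
    show ?thesis
    proof (cases "[] \<in> L")
      case True
      then have "(\<lambda>b. int (card (cell ts b - L))) = (\<lambda>b. 0)"
        by (auto simp: Nil cell_Nil)
      then show ?thesis using rat_gf_sum[of "{}"] by simp
    next
      case False
      then have "(\<lambda>b. int (card (cell ts b - L))) = (\<lambda>b. if b = (0, 0) then 1 else 0)"
        by (auto simp: Nil cell_Nil fun_eq_iff Diff_triv)
      then show ?thesis using rat_gf.delta by simp
    qed
  next
    case (Cons t ts')
    have main: "rat_gf (\<lambda>b. int (card (cell (False # ts'') b - L)))" if ts'': "length ts'' = length ts'" for ts''
    proof -
      define c where "c = (\<lambda>j b. int (card (cell ts'' b - {\<alpha>. j # \<alpha> \<in> L})))"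
      have up: "upset (Suc (length ts')) L" using "1.prems" by (simp add: Cons)
      have c: "rat_gf (c j)" for j
        using "1.IH" upset_slice[OF up] ts'' unfolding c_def by (simp add: Cons)
      obtain N where N: "\<And>j. j \<ge> N \<Longrightarrow> {\<alpha>. j # \<alpha> \<in> L} = {\<alpha>. N # \<alpha> \<in> L}"
        using upset_chain_stabilizes[of "length ts'" "\<lambda>j. {\<alpha>. j # \<alpha> \<in> L}"]
          upset_slice[OF up] upset_slice_mono[OF up] by auto
      have cN: "c j b - c N b = 0" if "\<not> j < N" for j b
        using N[of j] that by (simp add: c_def)
      have "int (card (cell (False # ts'') (u, v) - L)) = (\<Sum>i\<le>u. c N (i, v)) +
          (\<Sum>j<N. if j \<le> u then c j (u - j, v) - c N (u - j, v) else 0)" for u v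
      proof -
        have "int (card (cell (False # ts'') (u, v) - L)) = (\<Sum>j\<le>u. c j (u - j, v))"
          by (simp add: card_cell_Cons c_def)
        also have "\<dots> = (\<Sum>j\<le>u. c N (u - j, v)) + (\<Sum>j\<le>u. c j (u - j, v) - c N (u - j, v))"
          by (simp add: sum_subtractf)
        also have "(\<Sum>j\<le>u. c N (u - j, v)) = (\<Sum>i\<le>u. c N (i, v))"
          by (rule sum.reindex_bij_witness[of _ "\<lambda>i. u - i" "\<lambda>i. u - i"]) auto
        also have "(\<Sum>j\<le>u. c j (u - j, v) - c N (u - j, v)) =
            (\<Sum>j\<in>{..<N} \<inter> {..u}. c j (u - j, v) - c N (u - j, v))"
          using cN by (intro sum.mono_neutral_right ballI) (blast | simp)+
        also have "\<dots> = (\<Sum>j<N. if j \<in> {..u} then c j (u - j, v) - c N (u - j, v) else 0)"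
          by (rule sum.inter_restrict) simp
        finally show ?thesis by simp
      qed
      then have eq: "(\<lambda>b. int (card (cell (False # ts'') b - L))) =
          (\<lambda>b. (case b of (u, v) \<Rightarrow> \<Sum>i\<le>u. c N (i, v)) + 1 *
            (\<Sum>j<N. case b of (u, v) \<Rightarrow> if j \<le> u then (\<lambda>b. c j b - c N b) (u - j, v) else 0))"
        by (auto simp: fun_eq_iff)
      have "rat_gf (\<lambda>b. c j b - c N b)" for j
        using rat_gf.add_smult[OF c[of j] c[of N], of "-1"] by simp
      then have "rat_gf (\<lambda>b. \<Sum>j<N. case b of (u, v) \<Rightarrow>
          if j \<le> u then (\<lambda>b. c j b - c N b) (u - j, v) else 0)"
        by (intro rat_gf_sum rat_gf_shift_iter)
      then show ?thesis unfolding eq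
        by (intro rat_gf.add_smult[OF rat_gf.accumulate[OF c[of N]]])
    qed
    show ?thesis
    proof (cases t)
      case False
      then show ?thesis using main by (simp add: Cons)
    next
      case True
      \<comment> \<open>Exchanging the two degrees turns a leading variable of bidegree (0,1) into
        one of bidegree (1,0).\<close>
      have "cell ts (u, v) = cell (False # map Not ts') (v, u)" for u v
        using cell_swap[of ts v u] True by (simp add: Cons)
      then have "(\<lambda>b. int (card (cell ts b - L))) =
          (\<lambda>(u, v). int (card (cell (False # map Not ts') (v, u) - L)))"
        by (auto simp: fun_eq_iff)
      then show ?thesis using rat_gf.swap[OF main[of "map Not ts'"]] by simp
    qed
  qed
qed

text \<open>Follows from the recursion
  \<open>(p + 1) * (n choose (p + 1)) = (n - p) * (n choose p)\<close>; of the lower coefficients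
  only the existence is used.\<close>

lemma choose_expand:
  "\<exists>g. \<forall>n. real (n choose p) = real n ^ p / fact p + (\<Sum>i<p. g i * real n ^ i)"
proof (induction p)
  case (Suc p)
  then obtain g where g: "\<And>n. real (n choose p) = real n ^ p / fact p + (\<Sum>i<p. g i * real n ^ i)"
    by blast
  define h where "h = (\<lambda>i. if i < p then g i else 1 / fact p)"
  have h: "real (n choose p) = (\<Sum>i<Suc p. h i * real n ^ i)" for n
    by (simp add: g h_def)
  \<comment> \<open>The coefficient of \<open>n ^ i\<close> in
    \<open>(n - p) * (n choose p)\<close>, divided by \<open>p + 1\<close>. For \<open>i = 0\<close>
    the factor \<open>n\<close> contributes nothing.\<close>
  define k where "k = (\<lambda>i. ((if i = 0 then 0 else h (i - 1)) - real p * h i) / real (Suc p))"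
  have "real (n choose Suc p) = real n ^ Suc p / fact (Suc p) + (\<Sum>i<Suc p. k i * real n ^ i)" for n
  proof -
    have "real (Suc p) * real (n choose Suc p) = (real n - real p) * real (n choose p)"
    proof (cases "p \<le> n")
      case True
      have "Suc p * (n choose Suc p) = (n - p) * (n choose p)"
        by (metis binomial_absorb_comp binomial_absorption mult.commute)
      then have "real (Suc p * (n choose Suc p)) = real ((n - p) * (n choose p))" by simp
      then show ?thesis using True by (simp only: of_nat_mult of_nat_diff)
    qed (simp add: binomial_eq_0)
    also have "\<dots> = (\<Sum>i<Suc p. h i * real n ^ Suc i) - (\<Sum>i<Suc p. real p * h i * real n ^ i)"
      unfolding h by (simp add: sum_distrib_left sum_subtractf[symmetric] algebra_simps del: sum.lessThan_Suc)
    also have "(\<Sum>i<Suc p. h i * real n ^ Suc i) =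
        (\<Sum>i<Suc (Suc p). (if i = 0 then 0 else h (i - 1)) * real n ^ i)"
      by (subst (2) sum.lessThan_Suc_shift) simp
    also have "\<dots> = h p * real n ^ Suc p + (\<Sum>i<Suc p. (if i = 0 then 0 else h (i - 1)) * real n ^ i)"
      by (subst sum.lessThan_Suc) simp
    finally have *: "real (Suc p) * real (n choose Suc p) =
        h p * real n ^ Suc p + (\<Sum>i<Suc p. (if i = 0 then 0 else h (i - 1)) * real n ^ i)
         - (\<Sum>i<Suc p. real p * h i * real n ^ i)" .
    have "real (Suc p) * (k i * x) = (if i = 0 then 0 else h (i - 1)) * x - real p * h i * x" for i x
      by (simp add: k_def field_simps)
    with * have "real (Suc p) * real (n choose Suc p) =
        h p * real n ^ Suc p + (\<Sum>i<Suc p. real (Suc p) * (k i * real n ^ i))"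
      by (simp only: sum_subtractf)
    then have "real (Suc p) * real (n choose Suc p) =
        real (Suc p) * (real n ^ Suc p / fact (Suc p) + (\<Sum>i<Suc p. k i * real n ^ i))"
      by (simp add: h_def sum_distrib_left[symmetric] distrib_left del: sum.lessThan_Suc)
    then show ?thesis
      by (metis mult_cancel_left of_nat_0_eq_iff nat.distinct(1))
  qed
  then show ?case by blast
qed simp

section \<open>Polynomials of bounded total degree\<close>

text \<open>The double sum that ends the definition of \<open>mixed_multiplicity\<close>, wrapped so
  that its closure under linear combinations can be expressed.\<close>

definition deg_lt :: "nat \<Rightarrow> (nat \<Rightarrow> nat \<Rightarrow> real) \<Rightarrow> bool" where
  "deg_lt d f \<longleftrightarrow> (\<exists>c. \<forall>u v. f u v = (\<Sum>p<d. \<Sum>q<d - p. c p q * real u ^ p * real v ^ q))"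

lemma deg_lt_zero: "deg_lt d (\<lambda>_ _. 0)"
  unfolding deg_lt_def by (intro exI[of _ "\<lambda>_ _. 0"]) simp

lemma deg_lt_add_smult:
  assumes "deg_lt d f" "deg_lt d g" shows "deg_lt d (\<lambda>u v. f u v + a * g u v)"
proof -
  obtain c c' where "\<And>u v. f u v = (\<Sum>p<d. \<Sum>q<d - p. c p q * real u ^ p * real v ^ q)"
    "\<And>u v. g u v = (\<Sum>p<d. \<Sum>q<d - p. c' p q * real u ^ p * real v ^ q)"
    using assms unfolding deg_lt_def by blast
  then show ?thesis unfolding deg_lt_def
    by (intro exI[of _ "\<lambda>p q. c p q + a * c' p q"])
       (simp add: sum.distrib sum_distrib_left algebra_simps)
qed

lemma deg_lt_add: "deg_lt d f \<Longrightarrow> deg_lt d g \<Longrightarrow> deg_lt d (\<lambda>u v. f u v + g u v)"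
  using deg_lt_add_smult[of d f g 1] by simp

lemma deg_lt_smult: "deg_lt d g \<Longrightarrow> deg_lt d (\<lambda>u v. a * g u v)"
  using deg_lt_add_smult[OF deg_lt_zero, of d g a] by simp

lemma deg_lt_sum: "(\<And>i. i \<in> A \<Longrightarrow> deg_lt d (f i)) \<Longrightarrow> deg_lt d (\<lambda>u v. \<Sum>i\<in>A. f i u v)"
  by (induction A rule: infinite_finite_induct) (simp_all add: deg_lt_zero deg_lt_add)

lemma deg_lt_monomial:
  assumes "p + q < d" shows "deg_lt d (\<lambda>u v. real u ^ p * real v ^ q)"
proof -
  have eq: "real u ^ p * real v ^ q = (\<Sum>p'<d. \<Sum>q'<d - p'.
      (if p' = p \<and> q' = q then 1 else 0) * real u ^ p' * real v ^ q')" for u v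
  proof -
    have "(\<Sum>p'<d. \<Sum>q'<d - p'. (if p' = p \<and> q' = q then 1 else 0) * real u ^ p' * real v ^ q')
        = (\<Sum>p'<d. if p' = p then \<Sum>q'<d - p. if q' = q then real u ^ p * real v ^ q else 0 else 0)"
      by (intro sum.cong) (auto simp del: sum.delta sum.delta' intro!: sum.cong)
    also have "\<dots> = real u ^ p * real v ^ q" using assms by auto
    finally show ?thesis by simp
  qed
  show ?thesis unfolding deg_lt_def
    by (intro exI[of _ "\<lambda>p' q'. if p' = p \<and> q' = q then 1 else 0"] allI eq)
qed

lemma deg_lt_choose_diff:
  assumes "p + q \<le> d"
  shows "deg_lt d (\<lambda>u v. real (u choose p) * real (v choose q) - real u ^ p * real v ^ q / (fact p * fact q))"
proof -
  obtain g where g: "\<And>n. real (n choose p) = real n ^ p / fact p + (\<Sum>i<p. g i * real n ^ i)"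
    using choose_expand by blast
  obtain h where h: "\<And>n. real (n choose q) = real n ^ q / fact q + (\<Sum>i<q. h i * real n ^ i)"
    using choose_expand by blast
  have "real (u choose p) * real (v choose q) - real u ^ p * real v ^ q / (fact p * fact q) =
      (\<Sum>i<q. (h i / fact p) * (real u ^ p * real v ^ i)) +
      ((\<Sum>i<p. (g i / fact q) * (real u ^ i * real v ^ q)) +
       (\<Sum>i<p. \<Sum>j<q. (g i * h j) * (real u ^ i * real v ^ j)))" for u v
  proof -
    have "real u ^ p / fact p * (\<Sum>i<q. h i * real v ^ i) = (\<Sum>i<q. (h i / fact p) * (real u ^ p * real v ^ i))"
      by (simp add: sum_distrib_left mult_ac)
    moreover have "(\<Sum>i<p. g i * real u ^ i) * (real v ^ q / fact q) = (\<Sum>i<p. (g i / fact q) * (real u ^ i * real v ^ q))"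
      by (simp only: sum_distrib_right) (simp add: mult_ac)
    moreover have "(\<Sum>i<p. g i * real u ^ i) * (\<Sum>i<q. h i * real v ^ i) = (\<Sum>i<p. \<Sum>j<q. (g i * h j) * (real u ^ i * real v ^ j))"
      by (simp only: sum_product) (simp add: mult_ac)
    moreover have "real u ^ p / fact p * (real v ^ q / fact q) = real u ^ p * real v ^ q / (fact p * fact q)"
      by simp
    ultimately show ?thesis unfolding g h distrib_left distrib_right by linarith
  qed
  moreover have "deg_lt d (\<lambda>u v. (\<Sum>i<q. (h i / fact p) * (real u ^ p * real v ^ i)) +
      ((\<Sum>i<p. (g i / fact q) * (real u ^ i * real v ^ q)) +
       (\<Sum>i<p. \<Sum>j<q. (g i * h j) * (real u ^ i * real v ^ j))))"
    using assms by (intro deg_lt_add deg_lt_sum deg_lt_smult deg_lt_monomial) auto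
  ultimately show ?thesis by simp
qed

lemma deg_lt_choose:
  assumes "p + q < d" shows "deg_lt d (\<lambda>u v. real (u choose p) * real (v choose q))"
  using deg_lt_add[OF deg_lt_choose_diff[of p q d] deg_lt_smult[OF deg_lt_monomial[OF assms], of "1 / (fact p * fact q)"]] assms
  by simp

lemma bin2_normal_form:
  assumes "zspan bin2 f"
  shows "\<exists>n c. \<forall>u v. f (u, v) = (\<Sum>p<n. \<Sum>q<n. c p q * int (u choose p) * int (v choose q))"
  using assms
proof induction
  case zero
  show ?case by (intro exI[of _ 0]) simp
next
  case (add f x a)
  obtain n c where c: "\<And>u v. f (u, v) = (\<Sum>p<n. \<Sum>q<n. c p q * int (u choose p) * int (v choose q))"
    using add.IH by blast
  obtain p q where x: "x = (\<lambda>(u, v). int (u choose p) * int (v choose q))" using add.hyps(2) by auto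
  define m where "m = max n (Suc (max p q))"
  define c' where "c' = (\<lambda>p' q'. (if p' < n \<and> q' < n then c p' q' else 0) + (if p' = p \<and> q' = q then a else 0))"
  have "f (u, v) + a * x (u, v) = (\<Sum>p<m. \<Sum>q<m. c' p q * int (u choose p) * int (v choose q))" for u v
  proof -
    have "(\<Sum>p'<m. \<Sum>q'<m. (if p' < n \<and> q' < n then c p' q' else 0) * int (u choose p') * int (v choose q'))
       = (\<Sum>p'<n. \<Sum>q'<m. (if p' < n \<and> q' < n then c p' q' else 0) * int (u choose p') * int (v choose q'))"
      by (rule sum.mono_neutral_right) (auto simp: m_def)
    also have "\<dots> = f (u, v)" unfolding c
      by (intro sum.cong sum.mono_neutral_cong_right) (auto simp: m_def)
    finally have 1: "(\<Sum>p'<m. \<Sum>q'<m. (if p' < n \<and> q' < n then c p' q' else 0) * int (u choose p') * int (v choose q')) = f (u, v)" .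
    have "(\<Sum>p'<m. \<Sum>q'<m. (if p' = p \<and> q' = q then a else 0) * int (u choose p') * int (v choose q'))
        = (\<Sum>p'<m. if p' = p then \<Sum>q'<m. if q' = q then a * int (u choose p) * int (v choose q) else 0 else 0)"
      by (intro sum.cong) (auto simp del: sum.delta sum.delta' intro!: sum.cong)
    also have "\<dots> = a * x (u, v)"
    proof -
      have "p < m" "q < m" by (auto simp: m_def)
      then show ?thesis by (simp add: x)
    qed
    finally show ?thesis using 1 by (simp add: c'_def distrib_right sum.distrib)
  qed
  then show ?case by blast
qed

text \<open>On the ray \<open>(s * u, s)\<close> a term of total degree \<open>k\<close> grows like
  \<open>s ^ k\<close>. If \<open>D\<close> bounds the total degree, division by
  \<open>s ^ D\<close> leaves in the limit the form of degree \<open>D\<close>, as a polynomial in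
  the slope \<open>u\<close>.\<close>

lemma sum_product_scaled_tendsto:
  fixes c :: "nat \<Rightarrow> nat \<Rightarrow> int"
  assumes D: "\<And>p q. p < n \<Longrightarrow> q < n \<Longrightarrow> D < p + q \<Longrightarrow> c p q = 0" and "D > 0"
  shows "(\<lambda>s. (\<Sum>p<n. \<Sum>q<n. real_of_int (c p q) * real (s * u choose p) * real (s choose q)) / real s ^ D)
    \<longlonglongrightarrow> (\<Sum>p<n. \<Sum>q<n. if p + q = D then real_of_int (c p q) * real u ^ p / (fact p * fact q) else 0)"
proof -
  have choose: "(\<lambda>s. real (s * w choose p) / real s ^ p) \<longlonglongrightarrow> real w ^ p / fact p" for w p
  proof -
    obtain g where g: "\<And>n. real (n choose p) = real n ^ p / fact p + (\<Sum>i<p. g i * real n ^ i)"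
      using choose_expand by blast
    have "(\<lambda>s. real w ^ p / fact p + (\<Sum>i<p. (g i * real w ^ i) * (1 / real s) ^ (p - i)))
        \<longlonglongrightarrow> real w ^ p / fact p + (\<Sum>i<p. (g i * real w ^ i) * 0 ^ (p - i))"
      by (intro tendsto_intros lim_1_over_n)
    moreover have "(\<Sum>i<p. (g i * real w ^ i) * 0 ^ (p - i)) = 0"
      by (rule sum.neutral) auto
    moreover have "\<forall>\<^sub>F s in sequentially.
      real w ^ p / fact p + (\<Sum>i<p. (g i * real w ^ i) * (1 / real s) ^ (p - i)) = real (s * w choose p) / real s ^ p"
    proof (rule eventually_sequentiallyI[of 1])
      fix s :: nat assume s: "1 \<le> s"
      have "(1 / real s) ^ (p - i) = real s ^ i / real s ^ p" if "i < p" for i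
        using s that by (simp add: power_diff power_one_over field_simps)
      then show "real w ^ p / fact p + (\<Sum>i<p. (g i * real w ^ i) * (1 / real s) ^ (p - i)) = real (s * w choose p) / real s ^ p"
        using s by (simp add: g add_divide_distrib sum_divide_distrib power_mult_distrib mult_ac)
    qed
    ultimately show ?thesis using Lim_transform_eventually by force
  qed
  have lim: "(\<lambda>s. real_of_int (c p q) * real (s * u choose p) * real (s choose q) / real s ^ D)
      \<longlonglongrightarrow> (if p + q = D then real_of_int (c p q) * real u ^ p / (fact p * fact q) else 0)"
    if pq: "p < n" "q < n" for p q
  proof (cases "D < p + q")
    case True
    then show ?thesis using D pq by simp
  next
    case False
    have "(\<lambda>s. real_of_int (c p q) * (real (s * u choose p) / real s ^ p) * (real (s * 1 choose q) / real s ^ q) * (1 / real s) ^ (D - (p + q)))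
        \<longlonglongrightarrow> real_of_int (c p q) * (real u ^ p / fact p) * (real 1 ^ q / fact q) * 0 ^ (D - (p + q))"
      by (intro tendsto_intros choose lim_1_over_n)
    moreover have "real_of_int (c p q) * (real u ^ p / fact p) * (real 1 ^ q / fact q) * 0 ^ (D - (p + q))
       = (if p + q = D then real_of_int (c p q) * real u ^ p / (fact p * fact q) else 0)"
      using False by (auto simp: power_0_left)
    moreover have "\<forall>\<^sub>F s in sequentially.
        real_of_int (c p q) * (real (s * u choose p) / real s ^ p) * (real (s * 1 choose q) / real s ^ q) * (1 / real s) ^ (D - (p + q))
        = real_of_int (c p q) * real (s * u choose p) * real (s choose q) / real s ^ D"
    proof (rule eventually_sequentiallyI[of 1])
      fix s :: nat assume s: "1 \<le> s"
      have "real s ^ D = real s ^ p * real s ^ q * real s ^ (D - (p + q))"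
        using False by (simp flip: power_add)
      then show "real_of_int (c p q) * (real (s * u choose p) / real s ^ p) * (real (s * 1 choose q) / real s ^ q) * (1 / real s) ^ (D - (p + q))
        = real_of_int (c p q) * real (s * u choose p) * real (s choose q) / real s ^ D"
        using s by (simp add: power_one_over)
    qed
    ultimately show ?thesis using Lim_transform_eventually by force
  qed
  have "(\<lambda>s. \<Sum>p<n. \<Sum>q<n. real_of_int (c p q) * real (s * u choose p) * real (s choose q) / real s ^ D)
    \<longlonglongrightarrow> (\<Sum>p<n. \<Sum>q<n. if p + q = D then real_of_int (c p q) * real u ^ p / (fact p * fact q) else 0)"
    by (intro tendsto_sum lim) auto
  then show ?thesis by (simp add: sum_divide_distrib)
qed

lemma poly_vanishing_coeffs:
  fixes b :: "nat \<Rightarrow> real"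
  assumes "\<And>u::nat. u \<ge> 1 \<Longrightarrow> (\<Sum>p<n. b p * real u ^ p) = 0" "p < n"
  shows "b p = 0"
proof -
  define P where "P = (\<Sum>p<n. Polynomial.monom (b p) p)"
  have "poly P (real u) = 0" if "u \<ge> 1" for u
    using assms(1)[OF that] by (simp add: P_def poly_sum poly_monom)
  then have "real ` {1..} \<subseteq> {x. poly P x = 0}" by auto
  moreover have "infinite (real ` {1..})"
    by (simp add: finite_image_iff infinite_Ici)
  ultimately have "P = 0" using poly_roots_finite finite_subset by blast
  then have "Polynomial.coeff P p = 0" by simp
  then show ?thesis using assms(2) by (simp add: P_def coeff_sum if_distrib sum.If_cases cong: if_cong)
qed

text \<open>Growth of order \<open>(u + v)\<^sup>d\<close> forces total degree at most \<open>d\<close>: restrict to the rays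
  \<open>(s u, s)\<close>.\<close>

lemma growth_bounds_total_degree:
  fixes c :: "nat \<Rightarrow> nat \<Rightarrow> int"
  assumes bound: "\<And>u v. u \<ge> N \<Longrightarrow> v \<ge> N \<Longrightarrow>
      \<bar>\<Sum>p<n. \<Sum>q<n. real_of_int (c p q) * real (u choose p) * real (v choose q)\<bar> \<le> C * (real u + real v + 1) ^ d"
    and "p < n" "q < n" "d < p + q"
  shows "c p q = 0"
proof (rule ccontr)
  assume nz: "c p q \<noteq> 0"
  define E where "E = {p + q | p q. p < n \<and> q < n \<and> c p q \<noteq> 0}"
  have "E \<subseteq> {..2 * n}" by (auto simp: E_def)
  then have fin: "finite E" by (rule finite_subset) simp
  \<comment> \<open>The largest total degree that occurs. It exceeds \<open>d\<close>, so the growth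
    bound forces its form to vanish on all rays, which contradicts the choice of
    \<open>D\<close>.\<close>
  define D where "D = Max E"
  have "p + q \<in> E" using nz assms by (auto simp: E_def)
  then have "p + q \<le> D" "D \<in> E" unfolding D_def using fin by (auto intro: Max_ge Max_in)
  then have D: "d < D" "D \<in> E" using assms(4) by auto
  have top: "c p q = 0" if "p < n" "q < n" "D < p + q" for p q
  proof (rule ccontr)
    assume "c p q \<noteq> 0"
    then have "p + q \<in> E" using that by (auto simp: E_def)
    then show False using that(3) Max_ge[OF fin] by (simp add: D_def leD)
  qed
  let ?G = "\<lambda>u v. \<Sum>p<n. \<Sum>q<n. real_of_int (c p q) * real (u choose p) * real (v choose q)"
  have zero: "(\<Sum>p<n. \<Sum>q<n. if p + q = D then real_of_int (c p q) * real u ^ p / (fact p * fact q) else 0) = 0"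
    if u: "u \<ge> 1" for u :: nat
  proof (rule LIMSEQ_unique)
    show "(\<lambda>s. ?G (s * u) s / real s ^ D) \<longlonglongrightarrow>
       (\<Sum>p<n. \<Sum>q<n. if p + q = D then real_of_int (c p q) * real u ^ p / (fact p * fact q) else 0)"
      using sum_product_scaled_tendsto[of n D c u] top D by simp
    have "(\<lambda>s. C * (real u + 1 + 1 / real s) ^ d * (1 / real s) ^ (D - d)) \<longlonglongrightarrow> C * (real u + 1 + 0) ^ d * 0 ^ (D - d)"
      by (intro tendsto_intros lim_1_over_n)
    then have lim0: "(\<lambda>s. C * (real u + 1 + 1 / real s) ^ d * (1 / real s) ^ (D - d)) \<longlonglongrightarrow> 0"
      using D by (simp add: power_0_left)
    show "(\<lambda>s. ?G (s * u) s / real s ^ D) \<longlonglongrightarrow> 0"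
    proof (rule tendsto_0_le[OF lim0, of _ 1, OF eventually_sequentiallyI])
      fix s :: nat assume s: "max 1 N \<le> s"
      then have "N \<le> s * u" using u by (metis max.bounded_iff le_trans mult.right_neutral mult_le_mono2)
      then have "\<bar>?G (s * u) s\<bar> \<le> C * (real (s * u) + real s + 1) ^ d"
        using bound[of "s * u" s] s by simp
      moreover have "C * (real (s * u) + real s + 1) ^ d / real s ^ D =
         C * (real u + 1 + 1 / real s) ^ d * (1 / real s) ^ (D - d)"
      proof -
        have "real s ^ D = real s ^ d * real s ^ (D - d)" using D by (simp flip: power_add)
        moreover have "real (s * u) + real s + 1 = real s * (real u + 1 + 1 / real s)"
          using s by (simp add: field_simps)
        ultimately show ?thesis using s by (simp add: power_mult_distrib power_one_over)
      qed
      ultimately show "norm (?G (s * u) s / real s ^ D) \<le> norm (C * (real u + 1 + 1 / real s) ^ d * (1 / real s) ^ (D - d)) * 1"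
        using divide_right_mono[of "\<bar>?G (s * u) s\<bar>" "C * (real (s * u) + real s + 1) ^ d" "real s ^ D"]
        by (simp add: abs_divide)
    qed
  qed
  \<comment> \<open>In the form of degree \<open>D\<close> the exponent \<open>p\<close> of
    \<open>u\<close> determines the exponent \<open>D - p\<close> of \<open>v\<close>, so a ray sees
    one coefficient for each \<open>p\<close>. The value 0 covers exponents outside the box.\<close>
  define b where "b = (\<lambda>p. if p \<le> D \<and> D - p < n then real_of_int (c p (D - p)) / (fact p * fact (D - p)) else 0)"
  have inner: "(\<Sum>q<n. if p + q = D then real_of_int (c p q) * real u ^ p / (fact p * fact q) else 0) = b p * real u ^ p" for p u
  proof (cases "p \<le> D \<and> D - p < n")
    case True
    have "(\<Sum>q<n. if p + q = D then real_of_int (c p q) * real u ^ p / (fact p * fact q) else 0)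
      = (\<Sum>q<n. if q = D - p then real_of_int (c p (D - p)) * real u ^ p / (fact p * fact (D - p)) else 0)"
      using True by (intro sum.cong) auto
    then show ?thesis using True by (simp add: b_def)
  next
    case False
    then have "\<not> p + q = D" if "q < n" for q using that by auto
    then show ?thesis using False by (auto simp: b_def intro!: sum.neutral)
  qed
  have "b p = 0" if "p < n" for p
    using poly_vanishing_coeffs[where n = n and b = b and p = p] zero that unfolding inner by blast
  moreover obtain p q where "p < n" "q < n" "c p q \<noteq> 0" "D = p + q" using D by (auto simp: E_def)
  ultimately show False by (force simp: b_def)
qed


text \<open>Syntactically the matrix of the definition of \<open>mixed_multiplicity\<close>, so that
  it can be folded there.\<close>

definition mixed_form :: "nat \<Rightarrow> (nat \<Rightarrow> nat \<Rightarrow> real) \<Rightarrow> (nat \<Rightarrow> int) \<Rightarrow> (nat \<Rightarrow> nat \<Rightarrow> real) \<Rightarrow> nat \<Rightarrow> bool" where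
  "mixed_form d f e c N \<longleftrightarrow> (\<forall>u\<ge>N. \<forall>v\<ge>N. f u v =
     (\<Sum>i\<le>d. of_int (e i) / (fact i * fact (d - i)) * real u ^ (d - i) * real v ^ i) +
     (\<Sum>p<d. \<Sum>q<d - p. c p q * real u ^ p * real v ^ q))"

text \<open>The product \<open>(u choose p) * (v choose q)\<close> has leading coefficient
  \<open>1 / (fact p * fact q)\<close>, which is the normalization of the \<open>e_i\<close>. So the
  \<open>e_i\<close> are the integer coefficients in the binomial basis at total degree
  \<open>d\<close>.\<close>

lemma ev_bin2_mixed_form:
  assumes "ev_bin2 f" and bound: "\<And>u v. real_of_int \<bar>f (u, v)\<bar> \<le> C * (real u + real v + 1) ^ d"
  shows "\<exists>e c N. mixed_form d (\<lambda>u v. real_of_int (f (u, v))) e c N"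
proof -
  obtain N g where g: "zspan bin2 g" "\<And>u v. u \<ge> N \<Longrightarrow> v \<ge> N \<Longrightarrow> f (u, v) = g (u, v)"
    using assms(1) unfolding ev_bin2_def by blast
  obtain n c where c: "\<And>u v. g (u, v) = (\<Sum>p<n. \<Sum>q<n. c p q * int (u choose p) * int (v choose q))"
    using bin2_normal_form[OF g(1)] by blast
  have gr: "real_of_int (g (u, v)) = (\<Sum>p<n. \<Sum>q<n. real_of_int (c p q) * real (u choose p) * real (v choose q))" for u v
    by (simp add: c)
  have czero: "c p q = 0" if "p < n" "q < n" "d < p + q" for p q
    proof (rule growth_bounds_total_degree[OF _ that])
    show "\<bar>\<Sum>p<n. \<Sum>q<n. real_of_int (c p q) * real (u choose p) * real (v choose q)\<bar>
        \<le> C * (real u + real v + 1) ^ d" if "u \<ge> N" "v \<ge> N" for u v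
      using bound[of u v] g(2)[OF that] by (simp add: gr)
  qed
  define e where "e = (\<lambda>i. if d - i < n \<and> i < n then c (d - i) i else 0)"
  \<comment> \<open>What is left of a basis term after its part of total degree \<open>d\<close> is
    removed. Terms of higher total degree have coefficient 0 by the growth bound, so every remainder
    has degree less than \<open>d\<close>.\<close>
  define r where "r = (\<lambda>p q u v. real_of_int (c p q) * real (u choose p) * real (v choose q)
      - (if p + q = d then real_of_int (c p q) / (fact p * fact q) * real u ^ p * real v ^ q else 0))"
  have "deg_lt d (\<lambda>u v. r p q u v)" if pq: "p < n" "q < n" for p q
  proof -
    consider "p + q < d" | "p + q = d" | "d < p + q" by linarith
    then show ?thesis
    proof cases
      case 1
      then show ?thesis using deg_lt_smult[OF deg_lt_choose[OF 1], of "real_of_int (c p q)"]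
        by (simp add: r_def mult_ac)
    next
      case 2
      then show ?thesis using deg_lt_smult[OF deg_lt_choose_diff[of p q d], of "real_of_int (c p q)"]
        by (simp add: r_def right_diff_distrib mult_ac)
    next
      case 3
      then show ?thesis using czero[OF pq] by (simp add: r_def deg_lt_zero)
    qed
  qed
  then have "deg_lt d (\<lambda>u v. \<Sum>p<n. \<Sum>q<n. r p q u v)"
    by (intro deg_lt_sum) auto
  then obtain b where b: "\<And>u v. (\<Sum>p<n. \<Sum>q<n. r p q u v) = (\<Sum>p<d. \<Sum>q<d - p. b p q * real u ^ p * real v ^ q)"
    unfolding deg_lt_def by blast
  have main: "(\<Sum>p<n. \<Sum>q<n. if p + q = d then real_of_int (c p q) / (fact p * fact q) * real u ^ p * real v ^ q else 0)
      = (\<Sum>i\<le>d. of_int (e i) / (fact i * fact (d - i)) * real u ^ (d - i) * real v ^ i)" for u v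
  proof -
    let ?t = "\<lambda>p q. real_of_int (c p q) / (fact p * fact q) * real u ^ p * real v ^ q"
    have "(\<Sum>p<n. \<Sum>q<n. if p + q = d then ?t p q else 0) = (\<Sum>(p, q)\<in>{..<n} \<times> {..<n}. if p + q = d then ?t p q else 0)"
      by (simp add: sum.cartesian_product)
    also have "\<dots> = (\<Sum>(p, q)\<in>{(p, q)\<in>{..<n} \<times> {..<n}. p + q = d}. ?t p q)"
      by (rule sum.mono_neutral_cong_right) (auto split: if_splits)
    also have "\<dots> = (\<Sum>i\<in>{i. i \<le> d \<and> d - i < n \<and> i < n}. ?t (d - i) i)"
      by (rule sum.reindex_bij_witness[of _ "\<lambda>i. (d - i, i)" snd]) auto
    also have "\<dots> = (\<Sum>i\<le>d. of_int (e i) / (fact i * fact (d - i)) * real u ^ (d - i) * real v ^ i)"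
      by (rule sum.mono_neutral_cong_left) (auto simp: e_def mult_ac)
    finally show ?thesis .
  qed
  have "real_of_int (g (u, v)) = (\<Sum>i\<le>d. of_int (e i) / (fact i * fact (d - i)) * real u ^ (d - i) * real v ^ i) +
     (\<Sum>p<d. \<Sum>q<d - p. b p q * real u ^ p * real v ^ q)" for u v
    unfolding main[symmetric] b[symmetric] gr by (simp add: r_def sum_subtractf)
  then have "mixed_form d (\<lambda>u v. real_of_int (f (u, v))) e b N"
    unfolding mixed_form_def using g(2) by simp
  then show ?thesis by blast
qed

text \<open>For fixed \<open>u\<close> only the summand \<open>i = d\<close> reaches
  \<open>v ^ d\<close>. Hence \<open>e d\<close> is determined by the function at any single large
  \<open>u\<close>, which also gives its uniqueness.\<close>

lemma mixed_form_limit: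
  assumes "mixed_form d f e c N" "u \<ge> N"
  shows "(\<lambda>v. f u v / real v ^ d) \<longlonglongrightarrow> of_int (e d) / fact d"
proof -
  have lim: "(\<lambda>v. real v ^ i / real v ^ d) \<longlonglongrightarrow> 0" if "i < d" for i
  proof -
    have "(\<lambda>v. (1 / real v) ^ (d - i)) \<longlonglongrightarrow> 0 ^ (d - i)"
      by (intro tendsto_intros lim_1_over_n)
    then have "(\<lambda>v. (1 / real v) ^ (d - i)) \<longlonglongrightarrow> 0"
      using that by (simp only: power_0_left) simp
    moreover have "\<forall>\<^sub>F v in sequentially. (1 / real v) ^ (d - i) = real v ^ i / real v ^ d"
      by (rule eventually_sequentiallyI[of 1]) (use that in \<open>simp add: power_diff power_one_over field_simps\<close>)
    ultimately show ?thesis by (rule Lim_transform_eventually)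
  qed
  let ?A = "\<lambda>v. (\<Sum>i<d. of_int (e i) / (fact i * fact (d - i)) * real u ^ (d - i) * (real v ^ i / real v ^ d))"
  let ?B = "\<lambda>v. (\<Sum>p<d. \<Sum>q<d - p. c p q * real u ^ p * (real v ^ q / real v ^ d))"
  have "?A \<longlonglongrightarrow> (\<Sum>i<d. of_int (e i) / (fact i * fact (d - i)) * real u ^ (d - i) * 0)"
    by (intro tendsto_sum tendsto_mult tendsto_const lim) auto
  moreover have "?B \<longlonglongrightarrow> (\<Sum>p<d. \<Sum>q<d - p. c p q * real u ^ p * 0)"
    by (intro tendsto_sum tendsto_mult tendsto_const lim) auto
  ultimately have "(\<lambda>v. of_int (e d) / fact d + (?A v + ?B v)) \<longlonglongrightarrow> of_int (e d) / fact d + (0 + 0)"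
    by (intro tendsto_add tendsto_const) simp_all
  moreover have "\<forall>\<^sub>F v in sequentially. of_int (e d) / fact d + (?A v + ?B v) = f u v / real v ^ d"
  proof (rule eventually_sequentiallyI[of "max 1 N"])
    fix v assume v: "max 1 N \<le> v"
    then have "f u v = of_int (e d) / fact d * real v ^ d +
      ((\<Sum>i<d. of_int (e i) / (fact i * fact (d - i)) * real u ^ (d - i) * real v ^ i) +
       (\<Sum>p<d. \<Sum>q<d - p. c p q * real u ^ p * real v ^ q))"
      using assms unfolding mixed_form_def by (simp add: lessThan_Suc_atMost[symmetric])
    then show "of_int (e d) / fact d + (?A v + ?B v) = f u v / real v ^ d"
      using v by (simp add: add_divide_distrib sum_divide_distrib)
  qed
  ultimately show ?thesis using Lim_transform_eventually by force
qed

text \<open>The same \<open>N\<close> serves for all \<open>v\<close>; this uniformity later allows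
  \<open>u\<close> to be chosen before \<open>v\<close> tends to infinity.\<close>

lemma ev_bin2_poly_fst:
  assumes "ev_bin2 f"
  shows "\<exists>N. \<forall>v\<ge>N. \<exists>P. \<forall>u\<ge>N. real_of_int (f (u, v)) = poly P (real u)"
proof -
  obtain N g where g: "zspan bin2 g" "\<And>u v. u \<ge> N \<Longrightarrow> v \<ge> N \<Longrightarrow> f (u, v) = g (u, v)"
    using assms unfolding ev_bin2_def by blast
  have ch: "\<exists>P. \<forall>u. real (u choose p) = poly P (real u)" for p
  proof -
    obtain h where h: "\<And>n. real (n choose p) = real n ^ p / fact p + (\<Sum>i<p. h i * real n ^ i)"
      using choose_expand by blast
    show ?thesis
      by (intro exI[of _ "Polynomial.monom (1 / fact p) p + (\<Sum>i<p. Polynomial.monom (h i) i)"])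
        (simp add: h poly_monom poly_sum)
  qed
  have "\<exists>P. \<forall>u. real_of_int (g (u, v)) = poly P (real u)" for v
    using g(1)
  proof induction
    case zero
    show ?case by (intro exI[of _ 0]) simp
  next
    case (add f x c)
    obtain p q where x: "x = (\<lambda>(u, v). int (u choose p) * int (v choose q))" using add.hyps(2) by auto
    obtain P P' where "\<And>u. real_of_int (f (u, v)) = poly P (real u)" "\<And>u. real (u choose p) = poly P' (real u)"
      using add.IH ch by blast
    then show ?case
      by (intro exI[of _ "P + smult (real_of_int c * real (v choose q)) P'"]) (simp add: x)
  qed
  then show ?thesis using g(2) by (intro exI[of _ N]) metis
qed

lemma poly_eventually_const:
  assumes "\<And>u. u \<ge> M \<Longrightarrow> poly P (real u) = c"
  shows "poly P x = c"
proof -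
  have "real ` {M..} \<subseteq> {x. poly (P - [:c:]) x = 0}" using assms by auto
  moreover have "infinite (real ` {M..})" by (simp add: finite_image_iff infinite_Ici)
  ultimately have "P - [:c:] = 0" using poly_roots_finite finite_subset by blast
  then show ?thesis by simp
qed

section \<open>Linear algebra over a subfield\<close>

text \<open>Stated for semilinear maps between two rings, because it serves two purposes:
  multiplication by an element inside \<open>R\<close>, and the passage from a subspace of
  \<open>R\<close> to a quotient of \<open>R[U]\<close>, where the field is replaced by its
  image.\<close>

lemma dimension_transfer:
  assumes A: "ring A" and B: "ring B" and K: "subfield K A"
    and dim: "ring.dimension A n K E"
    and closed: "\<And>x. x \<in> E \<Longrightarrow> \<psi> x \<in> carrier B"
    and add: "\<And>x y. x \<in> E \<Longrightarrow> y \<in> E \<Longrightarrow> \<psi> (x \<oplus>\<^bsub>A\<^esub> y) = \<psi> x \<oplus>\<^bsub>B\<^esub> \<psi> y"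
    and smult: "\<And>k x. k \<in> K \<Longrightarrow> x \<in> E \<Longrightarrow> \<psi> (k \<otimes>\<^bsub>A\<^esub> x) = \<eta> k \<otimes>\<^bsub>B\<^esub> \<psi> x"
    and inj: "inj_on \<psi> E"
  shows "ring.dimension B n (\<eta> ` K) (\<psi> ` E)"
proof -
  interpret A: ring A by fact
  interpret B: ring B by fact
  from dim K closed add smult inj show ?thesis
  proof (induction n K E rule: A.dimension.induct)
    case (zero_dim K)
    have "\<psi> \<zero>\<^bsub>A\<^esub> = \<psi> \<zero>\<^bsub>A\<^esub> \<oplus>\<^bsub>B\<^esub> \<psi> \<zero>\<^bsub>A\<^esub>" using zero_dim(3)[of "\<zero>\<^bsub>A\<^esub>" "\<zero>\<^bsub>A\<^esub>"] by simp
    then have "\<psi> \<zero>\<^bsub>A\<^esub> = \<zero>\<^bsub>B\<^esub>" using zero_dim(2) B.add.l_cancel_one' by auto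
    then show ?case by simp
  next
    case (Suc_dim v E n K)
    note Kp = subringE[OF subfieldE(1)[OF Suc_dim.prems(1)]]
    note Ep = A.space_subgroup_props[OF Suc_dim.prems(1) Suc_dim.hyps(3)]
    let ?E' = "A.line_extension K v E"
    have EE': "E \<subseteq> ?E'"
    proof
      fix e assume e: "e \<in> E"
      then have "e = \<zero>\<^bsub>A\<^esub> \<otimes>\<^bsub>A\<^esub> v \<oplus>\<^bsub>A\<^esub> e" using Ep(1) Suc_dim.hyps(1) by auto
      then show "e \<in> ?E'" unfolding A.line_extension_mem_iff using e Kp(2) by blast
    qed
    have kv: "k \<otimes>\<^bsub>A\<^esub> v \<in> ?E'" if "k \<in> K" for k
    proof -
      have "k \<otimes>\<^bsub>A\<^esub> v = k \<otimes>\<^bsub>A\<^esub> v \<oplus>\<^bsub>A\<^esub> \<zero>\<^bsub>A\<^esub>" using that Kp(1) Suc_dim.hyps(1) by auto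
      then show ?thesis unfolding A.line_extension_mem_iff using that Ep(2) by blast
    qed
    have v: "v \<in> ?E'" using kv[OF Kp(3)] Suc_dim.hyps(1) by simp
    have IH: "B.dimension n (\<eta> ` K) (\<psi> ` E)"
    proof (rule Suc_dim.IH[OF Suc_dim.prems(1)])
      show "\<psi> x \<in> carrier B" if "x \<in> E" for x
        using that EE' Suc_dim.prems(2) by blast
      show "\<psi> (x \<oplus>\<^bsub>A\<^esub> y) = \<psi> x \<oplus>\<^bsub>B\<^esub> \<psi> y" if "x \<in> E" "y \<in> E" for x y
        using that EE' Suc_dim.prems(3) by blast
      show "\<psi> (k \<otimes>\<^bsub>A\<^esub> x) = \<eta> k \<otimes>\<^bsub>B\<^esub> \<psi> x" if "k \<in> K" "x \<in> E" for k x
        using that EE' Suc_dim.prems(4) by blast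
    qed (rule inj_on_subset[OF Suc_dim.prems(5) EE'])
    have "\<psi> v \<notin> \<psi> ` E"
    proof
      assume "\<psi> v \<in> \<psi> ` E"
      then obtain e where "e \<in> E" "\<psi> v = \<psi> e" by blast
      then show False using Suc_dim.prems(5) v EE' Suc_dim.hyps(2) by (metis inj_onD subsetD)
    qed
    moreover have "\<psi> v \<in> carrier B" using Suc_dim.prems(2) v by blast
    moreover have "\<psi> ` ?E' = B.line_extension (\<eta> ` K) (\<psi> v) (\<psi> ` E)"
    proof -
      have "\<psi> (k \<otimes>\<^bsub>A\<^esub> v \<oplus>\<^bsub>A\<^esub> e) = \<eta> k \<otimes>\<^bsub>B\<^esub> \<psi> v \<oplus>\<^bsub>B\<^esub> \<psi> e" if "k \<in> K" "e \<in> E" for k e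
        using Suc_dim.prems(3)[OF kv[OF that(1)]] Suc_dim.prems(4)[OF that(1) v] that EE' by auto
      note eq = this
      show ?thesis
      proof (intro equalityI subsetI)
        fix y assume "y \<in> \<psi> ` ?E'"
        then obtain k e where "k \<in> K" "e \<in> E" "y = \<psi> (k \<otimes>\<^bsub>A\<^esub> v \<oplus>\<^bsub>A\<^esub> e)"
          by (auto simp: A.line_extension_mem_iff)
        then show "y \<in> B.line_extension (\<eta> ` K) (\<psi> v) (\<psi> ` E)"
          unfolding B.line_extension_mem_iff using eq by blast
      next
        fix y assume "y \<in> B.line_extension (\<eta> ` K) (\<psi> v) (\<psi> ` E)"
        then obtain k e where *: "k \<in> K" "e \<in> E" "y = \<eta> k \<otimes>\<^bsub>B\<^esub> \<psi> v \<oplus>\<^bsub>B\<^esub> \<psi> e"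
          by (auto simp: B.line_extension_mem_iff)
        then have "k \<otimes>\<^bsub>A\<^esub> v \<oplus>\<^bsub>A\<^esub> e \<in> ?E'" unfolding A.line_extension_mem_iff by blast
        then show "y \<in> \<psi> ` ?E'" using eq[OF *(1,2)] *(3) by (metis imageI)
      qed
    qed
    ultimately show ?case using B.Suc_dim[OF _ _ IH] by simp
  qed
qed

locale domain_over_field = "domain" R for R (structure) +
  fixes K assumes subfield: "subfield K R"
begin

lemmas K_props = subringE[OF subfieldE(1)[OF subfield]]

lemma K_carrier: "k \<in> K \<Longrightarrow> k \<in> carrier R" using K_props(1) by blast

abbreviation subspace :: "'a set \<Rightarrow> bool" where
  "subspace V \<equiv> subalgebra K V R"

abbreviation dm :: "'a set \<Rightarrow> nat" where
  "dm V \<equiv> (dim over K) V"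

lemma subspaceI:
  assumes "V \<subseteq> carrier R" "\<zero> \<in> V" "\<And>x y. x \<in> V \<Longrightarrow> y \<in> V \<Longrightarrow> x \<oplus> y \<in> V"
    "\<And>k x. k \<in> K \<Longrightarrow> x \<in> V \<Longrightarrow> k \<otimes> x \<in> V"
  shows "subspace V"
proof (intro subalgebra.intro subalgebra_axioms.intro add.subgroupI)
  fix x assume "x \<in> V"
  then have "(\<ominus> \<one>) \<otimes> x \<in> V" "x \<in> carrier R" using assms K_props by auto
  then show "\<ominus> x \<in> V" by (simp add: l_minus)
qed (use assms in auto)

lemma subspaceD:
  assumes "subspace V"
  shows "V \<subseteq> carrier R" "\<zero> \<in> V" "\<And>x y. x \<in> V \<Longrightarrow> y \<in> V \<Longrightarrow> x \<oplus> y \<in> V"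
    "\<And>k x. k \<in> K \<Longrightarrow> x \<in> V \<Longrightarrow> k \<otimes> x \<in> V" "\<And>x. x \<in> V \<Longrightarrow> \<ominus> x \<in> V"
    "\<And>x y. x \<in> V \<Longrightarrow> y \<in> V \<Longrightarrow> x \<ominus> y \<in> V"
proof -
  interpret subalgebra K V R by fact
  show *: "V \<subseteq> carrier R" "\<zero> \<in> V" "\<And>x y. x \<in> V \<Longrightarrow> y \<in> V \<Longrightarrow> x \<oplus> y \<in> V"
    "\<And>k x. k \<in> K \<Longrightarrow> x \<in> V \<Longrightarrow> k \<otimes> x \<in> V" "\<And>x. x \<in> V \<Longrightarrow> \<ominus> x \<in> V"
    using subset one_closed m_closed smult_closed m_inv_closed by (auto simp: a_inv_def)
  then show "\<And>x y. x \<in> V \<Longrightarrow> y \<in> V \<Longrightarrow> x \<ominus> y \<in> V" by (simp add: a_minus_def)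
qed

text \<open>Spans of sets instead of lists, generated inductively, so that unions and images of sets
  can be inserted directly.\<close>

inductive_set spn :: "'a set \<Rightarrow> 'a set" for A where
  zero: "\<zero> \<in> spn A"
| add: "k \<in> K \<Longrightarrow> x \<in> A \<Longrightarrow> s \<in> spn A \<Longrightarrow> k \<otimes> x \<oplus> s \<in> spn A"

lemma spn_carrier: "A \<subseteq> carrier R \<Longrightarrow> spn A \<subseteq> carrier R"
proof
  fix s assume "s \<in> spn A" "A \<subseteq> carrier R"
  then show "s \<in> carrier R" by induction (auto dest: K_carrier)
qed

lemma spn_min:
  assumes "subspace V" "A \<subseteq> V" shows "spn A \<subseteq> V"
proof
  fix s assume "s \<in> spn A"
  then show "s \<in> V" by induction (use assms subspaceD[OF assms(1)] in auto)
qed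

lemma spn_subspace:
  assumes A: "A \<subseteq> carrier R" shows "subspace (spn A)"
proof (rule subspaceI)
  note c = spn_carrier[OF A, THEN subsetD]
  fix x y assume "x \<in> spn A" "y \<in> spn A"
  then show "x \<oplus> y \<in> spn A"
  proof induction
    case (add k x s)
    then have "k \<otimes> x \<oplus> s \<oplus> y = k \<otimes> x \<oplus> (s \<oplus> y)"
      using A c K_carrier by (intro a_assoc) auto
    then show ?case using add spn.add by auto
  qed (use c in auto)
next
  note c = spn_carrier[OF A, THEN subsetD]
  fix k x assume k: "k \<in> K" and "x \<in> spn A"
  from this(2) show "k \<otimes> x \<in> spn A"
  proof induction
    case zero
    then show ?case using k K_carrier by (simp add: spn.zero)
  next
    case (add k' x s)
    then have "k \<otimes> (k' \<otimes> x \<oplus> s) = (k \<otimes> k') \<otimes> x \<oplus> k \<otimes> s"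
      using A c[of s] k K_carrier by (subst r_distr) (auto simp: m_assoc subset_iff)
    then show ?case using add spn.add[of "k \<otimes> k'"] k K_props by auto
  qed
qed (use spn_carrier A spn.zero in auto)

lemma spn_base: "A \<subseteq> carrier R \<Longrightarrow> x \<in> A \<Longrightarrow> x \<in> spn A"
  using spn.add[OF K_props(3) _ spn.zero, of x A] by auto

lemma spn_mono: "A \<subseteq> B \<Longrightarrow> spn A \<subseteq> spn B"
proof
  fix s assume "s \<in> spn A" "A \<subseteq> B"
  then show "s \<in> spn B" by induction (auto intro: spn.intros)
qed

lemma spn_of_subspace: "subspace V \<Longrightarrow> spn V = V"
  using spn_min[of V V] spn_base[of V] subspaceD(1) by blast

lemma spn_empty: "spn {} = {\<zero>}"
  using spn_min[of "{\<zero>}" "{}"] spn.zero subspaceI[of "{\<zero>}"] K_carrier by auto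

lemma spn_insert:
  assumes "A \<subseteq> carrier R" "x \<in> carrier R"
  shows "spn (insert x A) = line_extension K x (spn A)"
proof
  note V = subspaceD[OF spn_subspace[OF assms(1)]]
  show "spn (insert x A) \<subseteq> line_extension K x (spn A)"
  proof
    fix s assume "s \<in> spn (insert x A)"
    then show "s \<in> line_extension K x (spn A)"
    proof induction
      case zero
      have "\<zero> = \<zero> \<otimes> x \<oplus> \<zero>" using assms by simp
      then show ?case unfolding line_extension_mem_iff using K_props(2) spn.zero by blast
    next
      case (add k y s)
      then obtain k' t where s: "k' \<in> K" "t \<in> spn A" "s = k' \<otimes> x \<oplus> t"
        unfolding line_extension_mem_iff by blast
      have t: "t \<in> carrier R" using s V(1) by blast
      show ?case
      proof (cases "y = x")
        case True
        then have "k \<otimes> y \<oplus> s = (k \<oplus> k') \<otimes> x \<oplus> t"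
          using add s t assms K_carrier by (simp add: l_distr a_assoc)
        then show ?thesis unfolding line_extension_mem_iff using add s K_props(7) by blast
      next
        case False
        then have y: "y \<in> A" "y \<in> carrier R" using add assms by auto
        then have "k \<otimes> y \<oplus> s = k' \<otimes> x \<oplus> (k \<otimes> y \<oplus> t)"
          using add s t assms K_carrier by (simp add: a_lcomm)
        then show ?thesis unfolding line_extension_mem_iff using add s y spn.add by blast
      qed
    qed
  qed
  show "line_extension K x (spn A) \<subseteq> spn (insert x A)"
  proof
    fix s assume "s \<in> line_extension K x (spn A)"
    then obtain k t where "k \<in> K" "t \<in> spn A" "s = k \<otimes> x \<oplus> t"
      unfolding line_extension_mem_iff by blast
    then show "s \<in> spn (insert x A)"
      using spn_mono[of A "insert x A"] by (auto intro: spn.add)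
  qed
qed

lemma spn_mult:
  assumes "A \<subseteq> carrier R" "c \<in> carrier R" "x \<in> spn A"
  shows "c \<otimes> x \<in> spn ((\<lambda>a. c \<otimes> a) ` A)"
  using assms(3)
proof induction
  case zero
  then show ?case using assms by (simp add: spn.zero)
next
  case (add k x s)
  have "x \<in> carrier R" "s \<in> carrier R" "k \<in> carrier R"
    using add assms spn_carrier[OF assms(1)] K_carrier by auto
  then have "c \<otimes> (k \<otimes> x \<oplus> s) = k \<otimes> (c \<otimes> x) \<oplus> c \<otimes> s"
    using assms by (simp add: r_distr m_lcomm)
  then show ?case using add spn.add by auto
qed

lemma dim_unique: "dimension n K V \<Longrightarrow> dm V = n"
  using dimI[OF subfield] .

lemma spn_finite_dimension:
  assumes "finite A" "A \<subseteq> carrier R" shows "finite_dimension K (spn A)"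
  using assms
proof (induction A rule: finite_induct)
  case empty
  show ?case unfolding spn_empty by (rule finite_dimensionI[OF zero_dim])
next
  case (insert x A)
  then obtain n where n: "dimension n K (spn A)" by auto
  show ?case
  proof (cases "x \<in> spn A")
    case True
    have "spn (insert x A) \<subseteq> spn A"
      using insert True by (intro spn_min spn_subspace) (auto intro: spn_base)
    then have "spn (insert x A) = spn A" using spn_mono[of A "insert x A"] by blast
    then show ?thesis using n finite_dimensionI by simp
  next
    case False
    then show ?thesis
      using Suc_dim[OF _ False n] insert by (auto simp: spn_insert intro: finite_dimensionI)
  qed
qed

lemma subspace_finite_dimension:
  assumes "finite_dimension K F" "subspace E" "E \<subseteq> F" shows "finite_dimension K E"
  using subalbegra_incl_imp_finite_dimension[OF subfield] assms by blast

lemma dm_mono: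
  assumes "finite_dimension K F" "subspace E" "E \<subseteq> F"
  shows "dm E \<le> dm F" "dm E = dm F \<Longrightarrow> E = F"
proof -
  have dF: "dimension (dm F) K F" using finite_dimensionE[OF subfield assms(1)] .
  have dE: "dimension (dm E) K E"
    using finite_dimensionE[OF subfield] subspace_finite_dimension[OF assms] .
  obtain Us where Us: "local.independent K Us" "length Us = dm E" "Span K Us = E" "set Us \<subseteq> carrier R"
    using exists_base[OF subfield dE] by blast
  have "set Us \<subseteq> F" using Span_base_incl[OF subfield Us(4)] Us(3) assms(3) by blast
  then show "dm E \<le> dm F" "dm E = dm F \<Longrightarrow> E = F"
    using independent_length_le_dimension[OF subfield dF Us(1)]
      independent_length_eq_dimension[OF subfield dF Us(1)] Us by auto
qed

lemma finite_spanning_set: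
  assumes "finite_dimension K E"
  shows "\<exists>Us. set Us \<subseteq> E \<and> spn (set Us) = E"
proof -
  obtain Us where Us: "Span K Us = E" "set Us \<subseteq> carrier R"
    using exists_base[OF subfield finite_dimensionE[OF subfield assms]] by blast
  have incl: "set Us \<subseteq> E" using Span_base_incl[OF subfield Us(2)] Us(1) by blast
  have E: "subspace E" using finite_dimension_imp_subalgebra[OF subfield assms] .
  have "Span K Us \<subseteq> spn (set Us)"
    using subalgebra_Span_incl[OF subfield spn_subspace[OF Us(2)]] spn_base[OF Us(2)] by blast
  then show ?thesis using Us incl spn_min[OF E incl] by blast
qed

text \<open>In a domain multiplication by a nonzero element is an injective linear map; this is how
  the dimensions of different ideals are compared later.\<close>

lemma dm_mult:
  assumes E: "finite_dimension K E" and a: "a \<in> carrier R" "a \<noteq> \<zero>"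
  shows "finite_dimension K ((\<lambda>x. a \<otimes> x) ` E)" "dm ((\<lambda>x. a \<otimes> x) ` E) = dm E"
proof -
  have c: "E \<subseteq> carrier R" using finite_dimension_imp_subalgebra[OF subfield E] subspaceD(1) by blast
  have "dimension (dm E) (id ` K) ((\<lambda>x. a \<otimes> x) ` E)"
  proof (rule dimension_transfer[OF ring_axioms ring_axioms subfield finite_dimensionE[OF subfield E]])
    show "inj_on (\<lambda>x. a \<otimes> x) E" using c a by (auto simp: inj_on_def m_lcancel subset_iff)
  qed (use c a K_carrier in \<open>auto simp: r_distr m_lcomm subset_iff\<close>)
  then have "dimension (dm E) K ((\<lambda>x. a \<otimes> x) ` E)" by simp
  then show "finite_dimension K ((\<lambda>x. a \<otimes> x) ` E)" "dm ((\<lambda>x. a \<otimes> x) ` E) = dm E"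
    using finite_dimensionI dim_unique by blast+
qed

section \<open>Initial monomials\<close>

fun mon :: "'a list \<Rightarrow> nat list \<Rightarrow> 'a" where
  "mon (y # ys) (a # as) = y [^] a \<otimes> mon ys as"
| "mon _ _ = \<one>"

lemma mon_carrier: "set ys \<subseteq> carrier R \<Longrightarrow> mon ys \<alpha> \<in> carrier R"
  by (induction ys \<alpha> rule: mon.induct) auto

lemma mon_add:
  "set ys \<subseteq> carrier R \<Longrightarrow> length \<alpha> = length ys \<Longrightarrow> length \<beta> = length ys \<Longrightarrow>
   mon ys (map2 (+) \<alpha> \<beta>) = mon ys \<beta> \<otimes> mon ys \<alpha>"
proof (induction ys arbitrary: \<alpha> \<beta>)
  case (Cons y ys)
  then obtain a as b bs where ab: "\<alpha> = a # as" "\<beta> = b # bs" by (metis length_Suc_conv)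
  then show ?case using Cons mon_carrier[of ys]
    by (simp add: nat_pow_mult[symmetric] m_ac)
qed simp

end

lemma deg_add:
  "length \<alpha> = length ts \<Longrightarrow> length \<beta> = length ts \<Longrightarrow>
   udeg ts (map2 (+) \<alpha> \<beta>) = udeg ts \<alpha> + udeg ts \<beta> \<and> vdeg ts (map2 (+) \<alpha> \<beta>) = vdeg ts \<alpha> + vdeg ts \<beta>"
proof (induction ts arbitrary: \<alpha> \<beta>)
  case (Cons t ts)
  then obtain a as b bs where ab: "\<alpha> = a # as" "\<beta> = b # bs" by (metis length_Suc_conv)
  then show ?case using Cons by simp
qed simp

text \<open>On vectors of equal length the lexicographic order is translation invariant. This is the
  property of a monomial order that makes the initial exponents upward closed.\<close>

lemma lex_add_less:
  fixes \<alpha> \<beta> \<delta> :: "nat list"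
  shows "length \<alpha> = n \<Longrightarrow> length \<beta> = n \<Longrightarrow> length \<delta> = n \<Longrightarrow> \<beta> < \<alpha> \<Longrightarrow> map2 (+) \<beta> \<delta> < map2 (+) \<alpha> \<delta>"
proof (induction n arbitrary: \<alpha> \<beta> \<delta>)
  case (Suc n)
  then obtain a as b bs c cs where "\<alpha> = a # as" "\<beta> = b # bs" "\<delta> = c # cs" by (metis length_Suc_conv)
  then show ?case using Suc by auto
qed simp

lemma le_imp_map2_add:
  fixes \<alpha> \<beta> :: "nat list"
  shows "list_all2 (\<le>) \<alpha> \<beta> \<Longrightarrow> \<exists>\<delta>. length \<delta> = length \<alpha> \<and> \<beta> = map2 (+) \<alpha> \<delta>"
proof (induction rule: list_all2_induct)
  case (Cons x xs y ys)
  then obtain \<delta> where "length \<delta> = length xs" "ys = map2 (+) xs \<delta>" by blast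
  then show ?case using Cons by (intro exI[of _ "(y - x) # \<delta>"]) simp
qed simp

text \<open>The elements \<open>ys\<close> play the role of variables and \<open>ts\<close> records
  their bidegrees. They may satisfy relations, which are accounted for by initial exponents.\<close>

locale bigraded_span = domain_over_field +
  fixes ys :: "'a list" and ts :: "bool list"
  assumes ys_carrier: "set ys \<subseteq> carrier R" and length_ts: "length ts = length ys"
begin

definition low :: "(nat \<times> nat \<Rightarrow> 'a set) \<Rightarrow> nat list \<Rightarrow> 'a set" where
  "low Q \<alpha> = spn (Q (udeg ts \<alpha>, vdeg ts \<alpha>) \<union>
     mon ys ` {\<beta> \<in> cell ts (udeg ts \<alpha>, vdeg ts \<alpha>). \<beta> < \<alpha>})"

text \<open>In the polynomial ring on variables for \<open>ys\<close> these are the leading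
  exponents of the preimage of \<open>Q\<close>: modulo \<open>Q\<close> the monomial reduces to
  smaller ones of the same bidegree. For \<open>Q = 0\<close> they form the initial ideal of the
  relations between the \<open>ys\<close>.\<close>

definition initial :: "(nat \<times> nat \<Rightarrow> 'a set) \<Rightarrow> nat list set" where
  "initial Q = {\<alpha>. length \<alpha> = length ys \<and> mon ys \<alpha> \<in> low Q \<alpha>}"

definition monspan :: "nat \<times> nat \<Rightarrow> 'a set" where
  "monspan w = spn (mon ys ` cell ts w)"

definition bigraded_submodule :: "(nat \<times> nat \<Rightarrow> 'a set) \<Rightarrow> bool" where
  "bigraded_submodule Q \<longleftrightarrow> (\<forall>w. subspace (Q w) \<and> Q w \<subseteq> monspan w) \<and>
     (\<forall>\<delta> u v x. length \<delta> = length ys \<longrightarrow> x \<in> Q (u, v) \<longrightarrow>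
        mon ys \<delta> \<otimes> x \<in> Q (u + udeg ts \<delta>, v + vdeg ts \<delta>))"

lemma initial_mono: "(\<And>w. Q w \<subseteq> Q' w) \<Longrightarrow> initial Q \<subseteq> initial Q'"
  unfolding initial_def low_def using spn_mono by (blast dest: Un_mono)

text \<open>A reduction of \<open>mon ys \<alpha>\<close> to smaller monomials stays one after
  multiplication by a monomial, since the order is translation invariant and \<open>Q\<close> is a
  submodule.\<close>

lemma upset_initial:
  assumes "bigraded_submodule Q" shows "upset (length ys) (initial Q)"
  unfolding upset_def
proof (intro ballI conjI allI impI)
  fix \<alpha> \<beta> assume \<alpha>: "\<alpha> \<in> initial Q" and le: "list_all2 (\<le>) \<alpha> \<beta>"
  have l: "length \<alpha> = length ys" using \<alpha> by (simp add: initial_def)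
  obtain \<delta> where \<delta>: "length \<delta> = length \<alpha>" "\<beta> = map2 (+) \<alpha> \<delta>" using le_imp_map2_add[OF le] by blast
  let ?w = "(udeg ts \<alpha>, vdeg ts \<alpha>)"
  let ?A = "Q ?w \<union> mon ys ` {\<beta> \<in> cell ts ?w. \<beta> < \<alpha>}"
  let ?B = "Q (udeg ts \<beta>, vdeg ts \<beta>) \<union> mon ys ` {\<gamma> \<in> cell ts (udeg ts \<beta>, vdeg ts \<beta>). \<gamma> < \<beta>}"
  have Qc: "Q w \<subseteq> carrier R" for w
    using assms subspaceD(1) unfolding bigraded_submodule_def by blast
  have Ac: "?A \<subseteq> carrier R" using Qc mon_carrier[OF ys_carrier] by auto
  have deg: "udeg ts \<beta> = udeg ts \<alpha> + udeg ts \<delta>" "vdeg ts \<beta> = vdeg ts \<alpha> + vdeg ts \<delta>"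
    using deg_add[of \<alpha> ts \<delta>] l \<delta> length_ts by auto
  have "mon ys \<beta> = mon ys \<delta> \<otimes> mon ys \<alpha>" using mon_add[OF ys_carrier] \<delta> l by simp
  also have "\<dots> \<in> spn ((\<lambda>a. mon ys \<delta> \<otimes> a) ` ?A)"
    using spn_mult[OF Ac mon_carrier[OF ys_carrier]] \<alpha> by (simp add: initial_def low_def)
  also have "\<dots> \<subseteq> spn ?B"
  proof (rule spn_mono, rule image_subsetI)
    fix a assume "a \<in> ?A"
    then consider "a \<in> Q ?w" | \<gamma> where "\<gamma> \<in> cell ts ?w" "\<gamma> < \<alpha>" "a = mon ys \<gamma>" by blast
    then show "mon ys \<delta> \<otimes> a \<in> ?B"
    proof cases
      case 1
      then have "mon ys \<delta> \<otimes> a \<in> Q (udeg ts \<beta>, vdeg ts \<beta>)"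
        using assms \<delta> l unfolding bigraded_submodule_def deg by simp
      then show ?thesis by blast
    next
      case 2
      have lg: "length \<gamma> = length ys" using 2 length_ts by (simp add: cell_def)
      have "mon ys \<delta> \<otimes> a = mon ys (map2 (+) \<gamma> \<delta>)" using mon_add[OF ys_carrier] 2 lg \<delta> l by simp
      moreover have "map2 (+) \<gamma> \<delta> < \<beta>" using lex_add_less[OF l lg _ 2(2)] \<delta> l by simp
      moreover have "map2 (+) \<gamma> \<delta> \<in> cell ts (udeg ts \<beta>, vdeg ts \<beta>)"
        using deg_add[of \<gamma> ts \<delta>] lg \<delta>(1) l length_ts 2(1) by (simp add: cell_def deg)
      ultimately show ?thesis by blast
    qed
  qed
  finally show "\<beta> \<in> initial Q" using \<delta> l by (simp add: initial_def low_def)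
qed (simp add: initial_def)

lemma monspan_finite_dimension: "finite_dimension K (monspan w)"
  unfolding monspan_def using finite_cell mon_carrier[OF ys_carrier]
  by (intro spn_finite_dimension) auto

text \<open>Macaulay's count: start from \<open>Q w\<close> and adjoin the monomials of the cell in
  increasing order. The dimension grows by one exactly when the new monomial is not initial.\<close>

lemma dm_monspan:
  assumes "bigraded_submodule Q"
  shows "dm (monspan w) = dm (Q w) + card (cell ts w - initial Q)"
proof -
  have Q: "subspace (Q w)" "Q w \<subseteq> monspan w" using assms unfolding bigraded_submodule_def by blast+
  note Qc = subspaceD(1)[OF Q(1)]
  have "dimension (dm (Q w)) K (Q w)"
    using finite_dimensionE[OF subfield subspace_finite_dimension[OF monspan_finite_dimension Q]] .
  \<comment> \<open>Only initial segments \<open>A\<close> of the cell are considered, so that the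
    monomials already adjoined are precisely those below the next one, as in
    \<open>low\<close>.\<close>
  have main: "\<lbrakk>finite A; A \<subseteq> cell ts w; \<forall>a\<in>A. \<forall>b\<in>cell ts w. b < a \<longrightarrow> b \<in> A\<rbrakk> \<Longrightarrow>
      dimension (dm (Q w) + card (A - initial Q)) K (spn (Q w \<union> mon ys ` A))" for A
  proof (induction A rule: finite_linorder_max_induct)
    case empty
    then show ?case using \<open>dimension (dm (Q w)) K (Q w)\<close> spn_of_subspace[OF Q(1)] by simp
  next
    case (insert b A)
    have A: "A = {\<beta> \<in> cell ts w. \<beta> < b}"
      using insert.prems insert.hyps(2) by fastforce
    have down: "\<forall>a\<in>A. \<forall>b\<in>cell ts w. b < a \<longrightarrow> b \<in> A" unfolding A by auto
    have IH: "dimension (dm (Q w) + card (A - initial Q)) K (spn (Q w \<union> mon ys ` A))"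
      using insert.IH insert.prems down by blast
    have w: "w = (udeg ts b, vdeg ts b)" "length b = length ys"
      using insert.prems length_ts by (auto simp: cell_def)
    have iff: "b \<in> initial Q \<longleftrightarrow> mon ys b \<in> spn (Q w \<union> mon ys ` A)"
      using w(2) unfolding initial_def low_def A w(1) by simp
    have Ac: "Q w \<union> mon ys ` A \<subseteq> carrier R" using Qc mon_carrier[OF ys_carrier] by auto
    have ins: "Q w \<union> mon ys ` insert b A = insert (mon ys b) (Q w \<union> mon ys ` A)" by auto
    show ?case
    proof (cases "b \<in> initial Q")
      case True
      have "spn (Q w \<union> mon ys ` insert b A) = spn (Q w \<union> mon ys ` A)"
      proof
        show "spn (Q w \<union> mon ys ` insert b A) \<subseteq> spn (Q w \<union> mon ys ` A)"
          unfolding ins using True iff spn_base[OF Ac] by (intro spn_min spn_subspace[OF Ac]) auto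
      qed (rule spn_mono, auto)
      then show ?thesis using IH True by simp
    next
      case False
      have "card (insert b A - initial Q) = Suc (card (A - initial Q))"
        using False insert.hyps by (subst insert_Diff_if) auto
      then show ?thesis
        using Suc_dim[OF mon_carrier[OF ys_carrier] _ IH] False iff
        unfolding ins spn_insert[OF Ac mon_carrier[OF ys_carrier]] by simp
    qed
  qed
  have "spn (Q w \<union> mon ys ` cell ts w) = monspan w"
  proof
    have c: "mon ys ` cell ts w \<subseteq> carrier R" using mon_carrier[OF ys_carrier] by auto
    show "spn (Q w \<union> mon ys ` cell ts w) \<subseteq> monspan w"
      using Q(2) spn_base[OF c] unfolding monspan_def by (intro spn_min spn_subspace c) auto
    show "monspan w \<subseteq> spn (Q w \<union> mon ys ` cell ts w)" unfolding monspan_def by (rule spn_mono) simp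
  qed
  then show ?thesis using dim_unique[OF main[OF finite_cell[of ts w]]] by auto
qed

text \<open>The case \<open>Q = 0\<close> counts the whole space, so \<open>dm (Q w)\<close> is a
  difference of two counts of exponents outside upsets.\<close>

lemma ev_bin2_dm:
  assumes "bigraded_submodule Q" shows "ev_bin2 (\<lambda>w. int (dm (Q w)))"
proof -
  have gf: "rat_gf (\<lambda>w. int (card (cell ts w - initial Q)))" if "bigraded_submodule Q" for Q
    using rat_gf_card_cell[of ts "initial Q"] upset_initial[OF that] length_ts by simp
  have zero: "bigraded_submodule (\<lambda>_. {\<zero>})"
    unfolding bigraded_submodule_def monspan_def
    using subspaceI[of "{\<zero>}"] K_carrier mon_carrier[OF ys_carrier] spn.zero by auto
  have "dm {\<zero>} = 0" using dim_unique zero_dim by blast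
  then have "int (dm (Q w)) = int (card (cell ts w - initial (\<lambda>_. {\<zero>}))) + (-1) * int (card (cell ts w - initial Q))" for w
    using dm_monspan[OF zero, of w] dm_monspan[OF assms, of w] by simp
  then have "rat_gf (\<lambda>w. int (dm (Q w)))"
    using rat_gf.add_smult[OF gf[OF zero] gf[OF assms], of "-1"] by simp
  then show ?thesis using rat_gf_ev_bin by blast
qed

text \<open>A noetherian property obtained without finite generating sets: the initial exponents
  stabilize by Dickson's lemma, and nested submodules with the same initial exponents have the same
  dimension in every bidegree.\<close>

lemma bigraded_chain_stabilizes:
  assumes sub: "\<And>n. bigraded_submodule (Q n)" and mono: "\<And>n w. Q n w \<subseteq> Q (Suc n) w"
  shows "\<exists>N. \<forall>n\<ge>N. \<forall>w. Q n w = Q N w"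
proof -
  obtain N where N: "\<And>n. n \<ge> N \<Longrightarrow> initial (Q n) = initial (Q N)"
    using upset_chain_stabilizes[of "length ys" "\<lambda>n. initial (Q n)"] upset_initial[OF sub]
      initial_mono[of "Q n" "Q (Suc n)" for n, OF mono] by blast
  have "Q n w = Q N w" if n: "n \<ge> N" for n w
  proof -
    have "Q N w \<subseteq> Q n w" by (rule lift_Suc_mono_le[of "\<lambda>n. Q n w"]) (use mono n in auto)
    moreover have "dm (Q N w) = dm (Q n w)"
      using dm_monspan[OF sub, of w n] dm_monspan[OF sub, of w N] N[OF n] by simp
    moreover have "subspace (Q N w)" "finite_dimension K (Q n w)"
      using sub subspace_finite_dimension[OF monspan_finite_dimension]
      unfolding bigraded_submodule_def by blast+
    ultimately show ?thesis using dm_mono(2)[of "Q n w" "Q N w"] by blast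
  qed
  then show ?thesis by blast
qed

end

section \<open>Standard graded domains\<close>

locale std_graded_domain = "domain" R for R (structure) +
  fixes G :: "nat \<Rightarrow> 'a set"
  assumes graded: "graded_ring R G"
    and generated: "generate_ring R (G 0 \<union> G 1) = carrier R"
    and subfield_G0: "subfield (G 0) R"
    and finitely_generated: "\<exists>F. finite F \<and> F \<subseteq> carrier R \<and> generate_ring R (G 0 \<union> F) = carrier R"

sublocale std_graded_domain \<subseteq> domain_over_field R "G 0"
  by (intro domain_over_field.intro domain_over_field_axioms.intro subfield_G0) unfold_locales

context std_graded_domain
begin

lemmas graded_conjuncts = graded[unfolded graded_ring_def, THEN conjunct2]

lemma G_subgroup: "additive_subgroup (G u) R"
  using graded_conjuncts[THEN conjunct1] by simp

lemma G_carrier: "x \<in> G u \<Longrightarrow> x \<in> carrier R"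
  using additive_subgroup.a_Hcarr[OF G_subgroup] .

lemma G_zero: "\<zero> \<in> G u"
  using additive_subgroup.zero_closed[OF G_subgroup] .

lemma G_add: "x \<in> G u \<Longrightarrow> y \<in> G u \<Longrightarrow> x \<oplus> y \<in> G u"
  using additive_subgroup.a_closed[OF G_subgroup] .

lemma G_mult: "x \<in> G u \<Longrightarrow> y \<in> G v \<Longrightarrow> x \<otimes> y \<in> G (u + v)"
  using graded_conjuncts[THEN conjunct2, THEN conjunct1] by simp

lemma G_smult: "k \<in> G 0 \<Longrightarrow> x \<in> G u \<Longrightarrow> k \<otimes> x \<in> G u"
  using G_mult[of k 0 x u] by simp

lemma G_one: "\<one> \<in> G 0" by (rule K_props(3))

lemma G_subspace: "subspace (G u)"
  using G_carrier[of _ u] G_smult[of _ _ u] by (intro subspaceI G_zero G_add) auto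

section \<open>Homogeneous components\<close>

lemma finsum_in:
  fixes n :: nat
  assumes "V \<subseteq> carrier R" "\<zero> \<in> V" "\<And>x y. x \<in> V \<Longrightarrow> y \<in> V \<Longrightarrow> x \<oplus> y \<in> V"
    "\<And>i. i \<le> n \<Longrightarrow> f i \<in> V"
  shows "finsum R f {..n} \<in> V"
  using assms(4)
proof (induction n)
  case 0
  then show ?case using assms(1) by (subst finsum_0) auto
next
  case (Suc n)
  then show ?case using assms(1,3) by (subst finsum_Suc) auto
qed

text \<open>Requiring \<open>f\<close> to vanish beyond \<open>n\<close> makes \<open>f\<close>
  independent of \<open>n\<close>, so that it is a function of \<open>x\<close> alone; this is what
  \<open>cmp\<close> selects.\<close>

definition decomposes :: "(nat \<Rightarrow> 'a) \<Rightarrow> 'a \<Rightarrow> nat \<Rightarrow> bool" where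
  "decomposes f x n \<longleftrightarrow> (\<forall>u. f u \<in> G u) \<and> (\<forall>u>n. f u = \<zero>) \<and> x = finsum R f {..n}"

lemma decomposes_extend:
  assumes "decomposes f x n" "n \<le> m" shows "decomposes f x m"
  using assms(2,1)
proof (induction m rule: dec_induct)
  case (step m)
  then have f: "\<And>u. f u \<in> G u" "f (Suc m) = \<zero>" "x = finsum R f {..m}" "\<forall>u>m. f u = \<zero>"
    unfolding decomposes_def by auto
  have c: "f \<in> {..k} \<rightarrow> carrier R" for k using f(1) G_carrier by blast
  have "finsum R f {..Suc m} = x" using f c[of m] by (subst finsum_Suc[OF c]) simp
  then show ?case using f unfolding decomposes_def by auto
qed simp

lemma decomposes_unique:
  assumes "decomposes f x n" "decomposes g x m" shows "f = g"
proof -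
  let ?N = "max n m"
  have fg: "decomposes f x ?N" "decomposes g x ?N" using assms by (auto intro: decomposes_extend)
  then have m: "\<And>u. f u \<in> G u" "\<And>u. g u \<in> G u" unfolding decomposes_def by auto
  define h where "h = (\<lambda>u. f u \<oplus> \<ominus> g u)"
  have h: "\<And>u. h u \<in> G u"
    unfolding h_def using subspaceD(6)[OF G_subspace m] by (simp add: a_minus_def)
  have c: "f \<in> {..?N} \<rightarrow> carrier R" "g \<in> {..?N} \<rightarrow> carrier R" "h \<in> {..?N} \<rightarrow> carrier R"
    using G_carrier[OF m(1)] G_carrier[OF m(2)] G_carrier[OF h] by auto
  have mc: "f u \<in> carrier R" "g u \<in> carrier R" for u
    using G_carrier[OF m(1)] G_carrier[OF m(2)] .
  have f_eq: "f u = h u \<oplus> g u" for u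
    using mc[of u] by (simp add: h_def a_assoc l_neg)
  then have "f = (\<lambda>u. h u \<oplus> g u)" by (rule ext)
  then have "finsum R f {..?N} = finsum R h {..?N} \<oplus> finsum R g {..?N}"
    using finsum_addf[OF c(3,2)] by simp
  then have "x = finsum R h {..?N} \<oplus> x" "x \<in> carrier R"
    using fg finsum_closed[OF c(1)] unfolding decomposes_def by auto
  then have "finsum R h {..?N} = \<zero>" using finsum_closed[OF c(3)] by (metis add.r_cancel_one')
  then have "\<forall>u\<le>?N. h u = \<zero>"
    using graded_conjuncts[THEN conjunct2, THEN conjunct2, THEN conjunct2, rule_format, of h] h by simp
  then have le: "f u = g u" if "u \<le> ?N" for u
    using that f_eq[of u] mc[of u] by simp
  have "f u = g u" if "\<not> u \<le> ?N" for u
    using that fg unfolding decomposes_def by (simp add: not_le)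
  then have "f u = g u" for u using le[of u] by blast
  then show ?thesis by blast
qed

lemma decomposes_exists:
  assumes "x \<in> carrier R" shows "\<exists>f n. decomposes f x n"
proof -
  obtain f n where f: "\<forall>u. f u \<in> G u" "x = finsum R f {..n}"
    using assms unfolding graded_conjuncts[THEN conjunct2, THEN conjunct2, THEN conjunct1] graded_sum_def by blast
  define g where "g = (\<lambda>u. if u \<le> n then f u else \<zero>)"
  have "finsum R g {..n} = finsum R f {..n}"
    by (rule finsum_cong') (use f G_carrier in \<open>auto simp: g_def\<close>)
  then have "decomposes g x n"
    using f G_zero unfolding decomposes_def g_def by auto
  then show ?thesis by blast
qed

definition cmp :: "'a \<Rightarrow> nat \<Rightarrow> 'a" where
  "cmp x = (THE f. \<exists>n. decomposes f x n)"

lemma cmp_eq: "decomposes f x n \<Longrightarrow> cmp x = f"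
  unfolding cmp_def by (rule the_equality) (auto intro: decomposes_unique)

lemma decomposes_cmp:
  assumes "x \<in> carrier R" shows "\<exists>n. decomposes (cmp x) x n"
proof -
  obtain f n where f: "decomposes f x n" using decomposes_exists[OF assms] by blast
  then show ?thesis using cmp_eq[OF f] by auto
qed

lemma cmp_G: "x \<in> carrier R \<Longrightarrow> cmp x i \<in> G i"
  using decomposes_cmp unfolding decomposes_def by blast

lemma cmp_carrier [simp]: "x \<in> carrier R \<Longrightarrow> cmp x i \<in> carrier R"
  using cmp_G G_carrier by blast

lemma cmp_add:
  assumes "x \<in> carrier R" "y \<in> carrier R" shows "cmp (x \<oplus> y) i = cmp x i \<oplus> cmp y i"
proof -
  obtain n m where "decomposes (cmp x) x n" "decomposes (cmp y) y m"
    using assms decomposes_cmp by metis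
  then have d: "decomposes (cmp x) x (max n m)" "decomposes (cmp y) y (max n m)"
    by (auto intro: decomposes_extend)
  have "finsum R (\<lambda>u. cmp x u \<oplus> cmp y u) {..max n m} = x \<oplus> y"
    using d assms unfolding decomposes_def by (subst finsum_addf) auto
  then have "decomposes (\<lambda>u. cmp x u \<oplus> cmp y u) (x \<oplus> y) (max n m)"
    using d G_add unfolding decomposes_def by auto
  then show ?thesis using cmp_eq by metis
qed

lemma finsum_only_last:
  fixes j :: nat
  assumes "\<And>u. u < j \<Longrightarrow> g u = \<zero>" "\<And>u. g u \<in> carrier R" shows "finsum R g {..j} = g j"
proof (cases j)
  case 0
  have "finsum R g {..0} = g 0" by (rule finsum_0) (use assms(2) in blast)
  then show ?thesis by (simp only: 0)
next
  case (Suc i)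
  have "finsum R g {..i} \<in> {\<zero>}" by (rule finsum_in) (simp_all add: assms(1) Suc)
  moreover have "finsum R g {..Suc i} = g (Suc i) \<oplus> finsum R g {..i}"
    by (rule finsum_Suc) (use assms(2) in blast)
  ultimately show ?thesis using assms(2) by (simp add: Suc)
qed

lemma cmp_homogeneous:
  assumes "x \<in> G j" shows "cmp x i = (if i = j then x else \<zero>)"
proof -
  have "decomposes (\<lambda>u. if u = j then x else \<zero>) x j"
    unfolding decomposes_def using assms G_zero G_carrier[OF assms]
    by (subst finsum_only_last) auto
  then show ?thesis by (simp add: cmp_eq)
qed

lemma cmp_zero [simp]: "cmp \<zero> i = \<zero>"
  using cmp_homogeneous[OF G_zero, of i i] by simp

lemma cmp_mult:
  assumes a: "a \<in> G j" and x: "x \<in> carrier R"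
  shows "cmp (a \<otimes> x) i = (if j \<le> i then a \<otimes> cmp x (i - j) else \<zero>)"
proof -
  define g where "g = (\<lambda>i. if j \<le> i then a \<otimes> cmp x (i - j) else \<zero>)"
  have ac: "a \<in> carrier R" using a G_carrier by blast
  have gc: "g u \<in> carrier R" for u using ac x by (simp add: g_def)
  have "finsum R g {..j + n} = a \<otimes> finsum R (cmp x) {..n}" for n
  proof (induction n)
    case 0
    have "finsum R g {..j} = g j" by (rule finsum_only_last) (auto simp: g_def gc ac x)
    then show ?case using x by (simp add: finsum_0 g_def)
  next
    case (Suc n)
    have "finsum R g {..j + Suc n} = g (Suc (j + n)) \<oplus> finsum R g {..j + n}"
      using gc by (simp add: finsum_Suc)
    then show ?case using Suc ac x by (simp add: finsum_Suc g_def r_distr Suc_diff_le)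
  qed
  moreover obtain n where n: "decomposes (cmp x) x n" using decomposes_cmp x by blast
  moreover have "g u \<in> G u" for u
    using G_mult[OF a cmp_G[OF x, of "u - j"]] G_zero by (cases "j \<le> u") (simp_all add: g_def)
  ultimately have "decomposes g (a \<otimes> x) (j + n)"
    unfolding decomposes_def g_def using ac by auto
  then show ?thesis using cmp_eq by (metis g_def)
qed

lemma cmp_smult: "k \<in> G 0 \<Longrightarrow> x \<in> carrier R \<Longrightarrow> cmp (k \<otimes> x) i = k \<otimes> cmp x i"
  using cmp_mult[of k 0 x i] by simp

text \<open>The form in which decompositions are used throughout: a property closed under addition
  is tested on homogeneous components, and no explicit sums appear.\<close>

lemma in_if_cmps_in:
  assumes "V \<subseteq> carrier R" "\<zero> \<in> V" "\<And>x y. x \<in> V \<Longrightarrow> y \<in> V \<Longrightarrow> x \<oplus> y \<in> V"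
    "x \<in> carrier R" "\<And>i. cmp x i \<in> V"
  shows "x \<in> V"
  using decomposes_cmp[OF assms(4)] finsum_in[of V _ "cmp x"] assms unfolding decomposes_def by metis

section \<open>The filtration by degree\<close>

definition F :: "nat \<Rightarrow> 'a set" where
  "F t = {x \<in> carrier R. \<forall>i>t. cmp x i = \<zero>}"

lemma F_subspace: "subspace (F t)"
  by (rule subspaceI) (auto simp: F_def cmp_add cmp_smult K_carrier)

lemma F_carrier: "F t \<subseteq> carrier R" by (auto simp: F_def)

lemma G_subset_F: "i \<le> t \<Longrightarrow> G i \<subseteq> F t"
  by (auto simp: F_def cmp_homogeneous G_carrier)

lemma F_mono: "s \<le> t \<Longrightarrow> F s \<subseteq> F t"
  by (auto simp: F_def)

lemma F_induct:
  assumes "V \<subseteq> carrier R" "\<zero> \<in> V" "\<And>x y. x \<in> V \<Longrightarrow> y \<in> V \<Longrightarrow> x \<oplus> y \<in> V"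
    "x \<in> F t" "\<And>i. i \<le> t \<Longrightarrow> cmp x i \<in> V"
  shows "x \<in> V"
proof (rule in_if_cmps_in[OF assms(1,2,3)])
  show "cmp x i \<in> V" for i using assms by (cases "i \<le> t") (auto simp: F_def)
qed (use assms in \<open>auto simp: F_def\<close>)

lemma F_exhausts: "x \<in> carrier R \<Longrightarrow> \<exists>t. x \<in> F t"
  using decomposes_cmp unfolding decomposes_def F_def by blast

lemma F_zero: "F 0 = G 0"
proof
  show "F 0 \<subseteq> G 0"
    by (rule subsetI, rule F_induct) (auto intro: G_carrier G_zero G_add cmp_G simp: F_def)
qed (rule G_subset_F, simp)

lemma F_mult:
  assumes x: "x \<in> F s" and y: "y \<in> F t" shows "x \<otimes> y \<in> F (s + t)"
proof -
  let ?V = "{x \<in> carrier R. x \<otimes> y \<in> F (s + t)}"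
  have yc: "y \<in> carrier R" using y by (simp add: F_def)
  note Fs = subspaceD[OF F_subspace]
  have "x \<in> ?V"
  proof (rule F_induct[OF _ _ _ x])
    fix i assume i: "i \<le> s"
    have "cmp x i \<in> G i" using cmp_G x by (simp add: F_def)
    then show "cmp x i \<in> ?V"
      using y i yc G_carrier by (auto simp: F_def cmp_mult)
  qed (use Fs yc in \<open>auto simp: l_distr\<close>)
  then show ?thesis by blast
qed

section \<open>Products of subspaces\<close>

lemma ideal_prod_mono: "A \<subseteq> A' \<Longrightarrow> B \<subseteq> B' \<Longrightarrow> ideal_prod R A B \<subseteq> ideal_prod R A' B'"
proof
  fix x assume "x \<in> ideal_prod R A B" "A \<subseteq> A'" "B \<subseteq> B'"
  then show "x \<in> ideal_prod R A' B'" by (induction rule: ideal_prod.induct) (auto intro: ideal_prod.intros)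
qed

lemma ideal_prod_min:
  assumes "\<And>a b. a \<in> A \<Longrightarrow> b \<in> B \<Longrightarrow> a \<otimes> b \<in> V" "\<And>x y. x \<in> V \<Longrightarrow> y \<in> V \<Longrightarrow> x \<oplus> y \<in> V"
  shows "ideal_prod R A B \<subseteq> V"
proof
  fix x assume "x \<in> ideal_prod R A B"
  then show "x \<in> V" by (induction rule: ideal_prod.induct) (use assms in auto)
qed

text \<open>\<open>ideal_prod\<close> only forms sums of products, so it also serves as the product
  of subspaces that are not ideals, such as \<open>G s\<close> and \<open>F s\<close>.\<close>

lemma ideal_prod_subspace:
  assumes "subspace A" "subspace B" shows "subspace (ideal_prod R A B)"
proof (rule subspaceI)
  note A = subspaceD[OF assms(1)] and B = subspaceD[OF assms(2)]
  show c: "ideal_prod R A B \<subseteq> carrier R" by (rule ideal_prod_min) (use A B in auto)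
  show "\<zero> \<in> ideal_prod R A B" using ideal_prod.prod[OF A(2) B(2), of R] by simp
  fix k x assume k: "k \<in> G 0" and "x \<in> ideal_prod R A B"
  from this(2) show "k \<otimes> x \<in> ideal_prod R A B"
  proof (induction rule: ideal_prod.induct)
    case (prod a b)
    then have "a \<in> carrier R" "b \<in> carrier R" using A(1) B(1) by blast+
    then have "k \<otimes> (a \<otimes> b) = (k \<otimes> a) \<otimes> b" using k K_carrier by (simp add: m_assoc)
    then show ?case using prod A k by (auto intro: ideal_prod.prod)
  next
    case (sum x y)
    then have "x \<in> carrier R" "y \<in> carrier R" using c by blast+
    then have "k \<otimes> (x \<oplus> y) = k \<otimes> x \<oplus> k \<otimes> y" using k K_carrier by (simp add: r_distr)
    then show ?case using sum by (auto intro: ideal_prod.sum)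
  qed
qed (rule ideal_prod.sum)

lemma ideal_prod_mult_right:
  assumes "subspace A" "subspace B" "c \<in> carrier R" "x \<in> ideal_prod R A B" "\<And>b. b \<in> B \<Longrightarrow> b \<otimes> c \<in> B'"
  shows "x \<otimes> c \<in> ideal_prod R A B'"
  using assms(4)
proof (induction rule: ideal_prod.induct)
  case (prod a b)
  then have "a \<in> carrier R" "b \<in> carrier R"
    using subspaceD(1)[OF assms(1)] subspaceD(1)[OF assms(2)] by blast+
  then have "a \<otimes> b \<otimes> c = a \<otimes> (b \<otimes> c)" using assms(3) by (simp add: m_assoc)
  then show ?case using prod assms(5) by (auto intro: ideal_prod.prod)
next
  case (sum x y)
  then have "x \<in> carrier R" "y \<in> carrier R"
    using subspaceD(1)[OF ideal_prod_subspace[OF assms(1,2)]] by blast+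
  then have "(x \<oplus> y) \<otimes> c = x \<otimes> c \<oplus> y \<otimes> c" using assms(3) by (simp add: l_distr)
  then show ?case using sum by (auto intro: ideal_prod.sum)
qed

lemma carrier_induct:
  assumes "\<And>x. x \<in> G 0 \<Longrightarrow> x \<in> V" "\<And>x. x \<in> B \<Longrightarrow> x \<in> V" "generate_ring R (G 0 \<union> B) = carrier R"
    "V \<subseteq> carrier R" "\<And>x y. x \<in> V \<Longrightarrow> y \<in> V \<Longrightarrow> x \<oplus> y \<in> V" "\<And>x y. x \<in> V \<Longrightarrow> y \<in> V \<Longrightarrow> x \<otimes> y \<in> V"
  shows "V = carrier R"
proof -
  have "subring V R"
  proof (rule subringI)
    show "\<one> \<in> V" using assms(1) G_one by blast
    fix x assume "x \<in> V"
    then have "\<ominus> x = (\<ominus> \<one>) \<otimes> x" "\<ominus> \<one> \<in> V" using assms(1,4) K_props G_one by (auto simp: l_minus)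
    then show "\<ominus> x \<in> V" using assms(6) \<open>x \<in> V\<close> by metis
  qed (use assms in auto)
  moreover have "G 0 \<union> B \<subseteq> V" using assms(1,2) by blast
  ultimately have "generate_ring R (G 0 \<union> B) \<subseteq> V"
    using assms(4) by (intro generate_ring_min_subring1) auto
  then show ?thesis using assms(3,4) by blast
qed

text \<open>The elements whose components of positive degree all lie in \<open>G 1\<close> times the
  preceding degree form a subring. It contains the generators of degrees 0 and 1, so it is all of
  \<open>R\<close>.\<close>

lemma G_Suc: "G (Suc l) \<subseteq> ideal_prod R (G 1) (G l)"
proof
  let ?P = "\<lambda>i. ideal_prod R (G 1) (G i)"
  have P: "subspace (?P i)" for i by (intro ideal_prod_subspace G_subspace)
  let ?V = "{x \<in> carrier R. \<forall>i. cmp x (Suc i) \<in> ?P i}"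
  have hom: "a \<otimes> y \<in> ?V" if a: "a \<in> G j" "j = 0 \<or> a \<in> ?P (j - 1)" and y: "y \<in> ?V" for a j y
  proof -
    have c: "a \<in> carrier R" "y \<in> carrier R" using a y G_carrier by auto
    have "cmp (a \<otimes> y) (Suc i) \<in> ?P i" for i
    proof (cases "j \<le> Suc i")
      case True
      show ?thesis
      proof (cases "j = 0")
        case True
        then show ?thesis using a y c subspaceD(4)[OF P] by (simp add: cmp_smult)
      next
        case False
        then have "a \<in> ?P (j - 1)" using a by blast
        then have "a \<otimes> cmp y (Suc i - j) \<in> ?P i"
        proof (rule ideal_prod_mult_right[OF G_subspace G_subspace, rotated])
          fix b assume "b \<in> G (j - 1)"
          then show "b \<otimes> cmp y (Suc i - j) \<in> G i"
            using G_mult[OF _ cmp_G[OF c(2)], of b "j - 1" "Suc i - j"] True False by simp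
        qed (use c in simp)
        then show ?thesis using cmp_mult[OF a(1) c(2)] True by simp
      qed
    next
      case False
      then show ?thesis using cmp_mult[OF a(1) c(2)] subspaceD(2)[OF P] by simp
    qed
    then show ?thesis using c by simp
  qed
  have Vadd: "x \<oplus> y \<in> ?V" if "x \<in> ?V" "y \<in> ?V" for x y
    using that subspaceD(3)[OF P] by (auto simp: cmp_add)
  have "?V = carrier R"
  proof (rule carrier_induct[OF _ _ generated])
    fix x assume x: "x \<in> G 0"
    then show "x \<in> ?V" using G_carrier subspaceD(2)[OF P] by (auto simp: cmp_homogeneous)
  next
    fix x assume x: "x \<in> G 1"
    then have "x \<otimes> \<one> \<in> ?P 0" using G_one by (intro ideal_prod.prod)
    then show "x \<in> ?V" using x G_carrier[OF x] subspaceD(2)[OF P] by (auto simp: cmp_homogeneous)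
  next
    fix x y assume x: "x \<in> ?V" and y: "y \<in> ?V"
    let ?W = "{z \<in> carrier R. z \<otimes> y \<in> ?V}"
    have "x \<in> ?W"
    proof (rule in_if_cmps_in)
      fix i
      have "i = 0 \<or> cmp x i \<in> ?P (i - 1)" using x by (cases i) auto
      then show "cmp x i \<in> ?W" using hom[OF cmp_G] x y by auto
    next
      show "\<zero> \<in> ?W" using y subspaceD(2)[OF P] by simp
      fix a b assume "a \<in> ?W" "b \<in> ?W"
      then show "a \<oplus> b \<in> ?W" using Vadd[of "a \<otimes> y" "b \<otimes> y"] y by (simp add: l_distr)
    qed (use x in auto)
    then show "x \<otimes> y \<in> ?V" by blast
  qed (use Vadd in auto)
  moreover fix x assume x: "x \<in> G (Suc l)"
  ultimately have "cmp x (Suc l) \<in> ?P l" using G_carrier by blast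
  then show "x \<in> ?P l" using x by (simp add: cmp_homogeneous)
qed

lemma G_add_degree: "G (s + t) \<subseteq> ideal_prod R (G s) (G t)"
proof (induction s)
  case 0
  have "x \<in> ideal_prod R (G 0) (G t)" if "x \<in> G t" for x
    using ideal_prod.prod[OF G_one that, of R] G_carrier[OF that] by simp
  then show ?case by auto
next
  case (Suc s)
  have "G (Suc s + t) \<subseteq> ideal_prod R (G 1) (G (s + t))" using G_Suc[of "s + t"] by simp
  also have "\<dots> \<subseteq> ideal_prod R (G (Suc s)) (G t)"
  proof (rule ideal_prod_min)
    fix a b assume a: "a \<in> G 1" and "b \<in> G (s + t)"
    then have "b \<in> ideal_prod R (G s) (G t)" using Suc by blast
    then show "a \<otimes> b \<in> ideal_prod R (G (Suc s)) (G t)"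
    proof (induction rule: ideal_prod.induct)
      case (prod x y)
      then have "a \<otimes> (x \<otimes> y) = (a \<otimes> x) \<otimes> y" using a G_carrier by (simp add: m_assoc)
      then show ?case using prod G_mult[OF a prod(1)] by (auto intro: ideal_prod.prod)
    next
      case (sum x y)
      then have "x \<in> carrier R" "y \<in> carrier R" using subspaceD(1)[OF ideal_prod_subspace[OF G_subspace G_subspace]] by auto
      then show ?case using sum a G_carrier by (auto simp: r_distr intro: ideal_prod.sum)
    qed
  qed (rule ideal_prod.sum)
  finally show ?case .
qed

lemma F_add_degree: "F (s + t) \<subseteq> ideal_prod R (F s) (F t)"
proof
  note P = subspaceD[OF ideal_prod_subspace[OF F_subspace[of s] F_subspace[of t]]]
  fix x assume x: "x \<in> F (s + t)"
  show "x \<in> ideal_prod R (F s) (F t)"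
  proof (rule F_induct[OF P(1,2,3) x])
    fix i assume "i \<le> s + t"
    then obtain a b where ab: "i = a + b" "a \<le> s" "b \<le> t"
      by (metis add_diff_inverse_nat le_add1 le_diff_conv linorder_le_cases add.commute not_le order.refl add.right_neutral le0)
    then have "G i \<subseteq> ideal_prod R (F s) (F t)"
      using G_add_degree[of a b] ideal_prod_mono[OF G_subset_F[OF ab(2)] G_subset_F[OF ab(3)]] by blast
    then show "cmp x i \<in> ideal_prod R (F s) (F t)" using cmp_G[of x i] x by (auto simp: F_def)
  qed
qed

end

section \<open>Homogeneous ideals\<close>

lemma ideals_set_simps [simp]:
  "\<one>\<^bsub>ideals_set A\<^esub> = carrier A" "B \<otimes>\<^bsub>ideals_set A\<^esub> C = ideal_prod A B C"
  by (simp_all add: ideals_set_def)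

lemma (in cring) idealI':
  assumes "Q \<subseteq> carrier R" "\<zero> \<in> Q" "\<And>x y. x \<in> Q \<Longrightarrow> y \<in> Q \<Longrightarrow> x \<oplus> y \<in> Q"
    "\<And>a x. a \<in> carrier R \<Longrightarrow> x \<in> Q \<Longrightarrow> a \<otimes> x \<in> Q"
  shows "ideal Q R"
proof (rule idealI[OF ring_axioms])
  show "subgroup Q (add_monoid R)"
  proof (rule add.subgroupI)
    fix x assume x: "x \<in> Q"
    then have "(\<ominus> \<one>) \<otimes> x \<in> Q" "x \<in> carrier R" using assms by auto
    then show "\<ominus> x \<in> Q" by (simp add: l_minus)
  qed (use assms in auto)
  fix a x assume "a \<in> Q" "x \<in> carrier R"
  then show "x \<otimes> a \<in> Q" "a \<otimes> x \<in> Q" using assms(1,4) m_comm[of a x] by auto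
qed

lemma (in cring) colon_ideal:
  assumes "ideal T R" "w \<in> carrier R" shows "ideal {x \<in> carrier R. x \<otimes> w \<in> T} R"
proof -
  interpret T: ideal T R by fact
  show ?thesis
    using assms(2) T.a_closed T.I_l_closed by (intro idealI') (auto simp: l_distr m_assoc)
qed

text \<open>For a fixed factor the admissible other factors form a colon ideal, so it suffices to
  test generators, in one argument after the other.\<close>

lemma (in cring) ideal_prod_Idl_min:
  assumes "A \<subseteq> carrier R" "B \<subseteq> carrier R" "ideal T R" "\<And>x y. x \<in> A \<Longrightarrow> y \<in> B \<Longrightarrow> x \<otimes> y \<in> T"
  shows "ideal_prod R (Idl A) (Idl B) \<subseteq> T"
proof
  interpret T: ideal T R by fact
  note IA = genideal_ideal[OF assms(1)] and IB = genideal_ideal[OF assms(2)]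
  have 1: "x \<otimes> y \<in> T" if x: "x \<in> Idl A" and y: "y \<in> B" for x y
  proof -
    have "A \<subseteq> {x \<in> carrier R. x \<otimes> y \<in> T}" using assms y by auto
    then have "Idl A \<subseteq> {x \<in> carrier R. x \<otimes> y \<in> T}"
      using y assms(2) by (intro genideal_minimal colon_ideal[OF assms(3)]) auto
    then show ?thesis using x by auto
  qed
  have 2: "x \<otimes> y \<in> T" if x: "x \<in> Idl A" and y: "y \<in> Idl B" for x y
  proof -
    have xc: "x \<in> carrier R" using ideal.Icarr[OF IA x] .
    have "B \<subseteq> {y \<in> carrier R. y \<otimes> x \<in> T}"
    proof
      fix y assume y: "y \<in> B"
      then have yc: "y \<in> carrier R" using assms(2) by blast
      then show "y \<in> {y \<in> carrier R. y \<otimes> x \<in> T}" using 1[OF x y] m_comm[OF xc yc] by simp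
    qed
    then have "Idl B \<subseteq> {y \<in> carrier R. y \<otimes> x \<in> T}"
      using xc by (intro genideal_minimal colon_ideal[OF assms(3)])
    then have "y \<otimes> x \<in> T" using y by blast
    then show ?thesis using m_comm[OF xc ideal.Icarr[OF IB y]] by simp
  qed
  fix z assume "z \<in> ideal_prod R (Idl A) (Idl B)"
  then show "z \<in> T" by (induction rule: ideal_prod.induct) (use 2 T.a_closed in auto)
qed

context std_graded_domain
begin

lemma ideal_subspace: "ideal Q R \<Longrightarrow> subspace Q"
  by (rule ideal_is_subalgebra) (use K_carrier in auto)

lemma ideal_mult:
  assumes "ideal Q R" "a \<in> carrier R" "x \<in> Q" shows "a \<otimes> x \<in> Q" "x \<otimes> a \<in> Q"
  using ideal.I_l_closed[OF assms(1,3,2)] ideal.I_r_closed[OF assms(1,3,2)] by auto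

text \<open>Homogeneity expressed by components, the form in which it is applied;
  \<open>homogeneous_ideal\<close> speaks of generators.\<close>

definition hideal :: "'a set \<Rightarrow> bool" where
  "hideal Q \<longleftrightarrow> ideal Q R \<and> (\<forall>x\<in>Q. \<forall>i. cmp x i \<in> Q)"

text \<open>The elements of the generated ideal all of whose components stay in it again form an
  ideal; multipliers are tested component by component.\<close>

lemma hideal_Idl:
  assumes A: "A \<subseteq> (\<Union>u. G u)" shows "hideal (Idl A)"
proof -
  have c: "A \<subseteq> carrier R" using A G_carrier by auto
  have I: "ideal (Idl A) R" by (rule genideal_ideal[OF c])
  note IS = subspaceD[OF ideal_subspace[OF I]]
  let ?V = "{x \<in> Idl A. \<forall>i. cmp x i \<in> Idl A}"
  have V_add: "x \<oplus> y \<in> ?V" if "x \<in> ?V" "y \<in> ?V" for x y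
    using that IS(1,3) by (auto simp: cmp_add subset_iff)
  have "ideal ?V R"
  proof (rule idealI')
    fix a x assume a: "a \<in> carrier R" and x: "x \<in> ?V"
    then have xc: "x \<in> carrier R" using IS(1) by auto
    have "a \<in> {a \<in> carrier R. a \<otimes> x \<in> ?V}"
    proof (rule in_if_cmps_in[OF _ _ _ a])
      fix b b' assume "b \<in> {a \<in> carrier R. a \<otimes> x \<in> ?V}" "b' \<in> {a \<in> carrier R. a \<otimes> x \<in> ?V}"
      then show "b \<oplus> b' \<in> {a \<in> carrier R. a \<otimes> x \<in> ?V}"
        using V_add[of "b \<otimes> x" "b' \<otimes> x"] xc by (simp add: l_distr)
    next
      fix j
      have "cmp a j \<otimes> x \<in> Idl A" using ideal_mult(1)[OF I cmp_carrier[OF a]] x by blast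
      moreover have "cmp (cmp a j \<otimes> x) i \<in> Idl A" for i
        using ideal_mult(1)[OF I cmp_carrier[OF a], of "cmp x (i - j)" j] x IS(2) a
        by (simp add: cmp_mult[OF cmp_G[OF a] xc])
      ultimately show "cmp a j \<in> {a \<in> carrier R. a \<otimes> x \<in> ?V}" using a by simp
    qed (use xc IS(2) in auto)
    then show "a \<otimes> x \<in> ?V" by blast
  qed (use IS V_add in auto)
  moreover have "A \<subseteq> ?V"
  proof
    fix x assume x: "x \<in> A"
    then obtain u where u: "x \<in> G u" using A by blast
    have "x \<in> Idl A" using x genideal_self[OF c] by blast
    then show "x \<in> ?V" using IS(2) by (simp add: cmp_homogeneous[OF u])
  qed
  ultimately have "Idl A \<subseteq> ?V" by (rule genideal_minimal)
  then show ?thesis using I unfolding hideal_def by blast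
qed

lemma homogeneous_ideal_hideal: "homogeneous_ideal R G Q \<Longrightarrow> hideal Q"
  using hideal_Idl[of "Q \<inter> (\<Union>u. G u)"] unfolding homogeneous_ideal_def by auto

lemma hideal_prod:
  assumes "hideal A" "hideal B" shows "hideal (ideal_prod R A B)"
proof -
  have I: "ideal A R" "ideal B R" using assms unfolding hideal_def by blast+
  have P: "ideal (ideal_prod R A B) R" by (rule ideal_prod_is_ideal[OF I])
  note PS = subspaceD[OF ideal_subspace[OF P]]
  have "cmp x i \<in> ideal_prod R A B" if "x \<in> ideal_prod R A B" for x i
    using that
  proof (induction rule: ideal_prod.induct)
    case (prod a b)
    have c: "a \<in> carrier R" "b \<in> carrier R"
      using ideal.Icarr[OF I(1) prod(1)] ideal.Icarr[OF I(2) prod(2)] .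
    let ?V = "{a \<in> carrier R. cmp (a \<otimes> b) i \<in> ideal_prod R A B}"
    have "a \<in> ?V"
    proof (rule in_if_cmps_in[OF _ _ _ c(1)])
      fix j
      have "cmp a j \<in> A" "cmp b (i - j) \<in> B" using assms prod unfolding hideal_def by blast+
      then show "cmp a j \<in> ?V"
        using c PS(2) ideal_prod.prod[of "cmp a j" A "cmp b (i - j)" B R] by (simp add: cmp_mult[OF cmp_G])
    next
      fix x y assume "x \<in> ?V" "y \<in> ?V"
      then show "x \<oplus> y \<in> ?V" using c PS(3) by (simp add: l_distr cmp_add)
    qed (use c PS(2) in auto)
    then show ?case by blast
  next
    case (sum x y)
    then have "x \<in> carrier R" "y \<in> carrier R" using PS(1) by blast+
    then show ?case using sum PS(3) by (simp add: cmp_add)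
  qed
  then show ?thesis using P unfolding hideal_def by blast
qed

lemma ideal_power_ideal: "ideal J R \<Longrightarrow> ideal (ideal_power R J n) R"
  by (induction n) (auto intro: oneideal ideal_prod_is_ideal)

lemma ideal_power_add:
  "ideal J R \<Longrightarrow> ideal_prod R (ideal_power R J m) (ideal_power R J n) = ideal_power R J (m + n)"
  using monoid.nat_pow_mult[OF comm_monoid.axioms(1)[OF ideals_set_is_comm_monoid], of J m n]
  by (simp add: ideals_set_def)

lemma ideal_power_mult:
  "ideal J R \<Longrightarrow> ideal_power R (ideal_power R J m) n = ideal_power R J (m * n)"
  using monoid.nat_pow_pow[OF comm_monoid.axioms(1)[OF ideals_set_is_comm_monoid], of J m n]
  by (simp add: ideals_set_def)

lemma ideal_power_1: "ideal J R \<Longrightarrow> ideal_power R J 1 = J"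
  using ideal_prod_commute[OF oneideal, of J] ideal_prod_one[of J] by simp

lemma hideal_carrier: "hideal (carrier R)"
  unfolding hideal_def using oneideal by simp

lemma hideal_power: "hideal J \<Longrightarrow> hideal (ideal_power R J n)"
  by (induction n) (auto intro: hideal_carrier hideal_prod)

section \<open>Ideals generated in bounded degrees\<close>

definition gen :: "'a set \<Rightarrow> nat \<Rightarrow> bool" where
  "gen Q \<gamma> \<longleftrightarrow> generated_in_degrees_le R G Q \<gamma>"

lemma gen_hideal: "gen Q \<gamma> \<Longrightarrow> hideal Q"
  using hideal_Idl[of "Q \<inter> (\<Union>u\<le>\<gamma>. G u)"] unfolding gen_def generated_in_degrees_le_def by auto

lemma gen_ideal: "gen Q \<gamma> \<Longrightarrow> ideal Q R"
  using gen_hideal unfolding hideal_def by blast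

lemma gen_min:
  assumes "gen Q \<gamma>" "ideal T R" "\<And>a w. a \<le> \<gamma> \<Longrightarrow> w \<in> Q \<Longrightarrow> w \<in> G a \<Longrightarrow> w \<in> T"
  shows "Q \<subseteq> T"
  using genideal_minimal[OF assms(2), of "Q \<inter> (\<Union>u\<le>\<gamma>. G u)"] assms(1,3)
  unfolding gen_def generated_in_degrees_le_def by auto

lemma gen_carrier: "gen (carrier R) 0"
proof -
  have "ideal (Idl (carrier R \<inter> (\<Union>u\<le>0. G u))) R" by (rule genideal_ideal) auto
  moreover have "\<one> \<in> Idl (carrier R \<inter> (\<Union>u\<le>0. G u))"
    using genideal_self[of "carrier R \<inter> (\<Union>u\<le>0. G u)"] G_one by auto
  ultimately show ?thesis
    unfolding gen_def generated_in_degrees_le_def by (rule ideal.one_imp_carrier)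
qed

lemma gen_prod_min:
  assumes J: "gen J \<gamma>" and Q: "gen Q \<gamma>'" and T: "ideal T R"
    and *: "\<And>a b w w'. a \<le> \<gamma> \<Longrightarrow> b \<le> \<gamma>' \<Longrightarrow> w \<in> J \<Longrightarrow> w \<in> G a \<Longrightarrow> w' \<in> Q \<Longrightarrow> w' \<in> G b \<Longrightarrow> w \<otimes> w' \<in> T"
  shows "ideal_prod R J Q \<subseteq> T"
proof (rule ideal_prod_min)
  have 1: "x \<otimes> w' \<in> T" if w': "b \<le> \<gamma>'" "w' \<in> Q" "w' \<in> G b" and x: "x \<in> J" for x w' b
  proof -
    have "J \<subseteq> {x \<in> carrier R. x \<otimes> w' \<in> T}"
      using * w' G_carrier by (intro gen_min[OF J] colon_ideal[OF T]) auto
    then show ?thesis using x by blast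
  qed
  fix x y assume x: "x \<in> J" and y: "y \<in> Q"
  then have xc: "x \<in> carrier R" using ideal.Icarr[OF gen_ideal[OF J]] by blast
  have "Q \<subseteq> {y \<in> carrier R. y \<otimes> x \<in> T}"
    using 1[OF _ _ _ x] G_carrier xc m_comm[OF _ xc] by (intro gen_min[OF Q] colon_ideal[OF T]) auto
  then show "x \<otimes> y \<in> T" using y m_comm[OF xc, of y] by auto
qed (use subspaceD(3)[OF ideal_subspace[OF T]] in blast)

text \<open>Quantifying over the multiples makes this set an ideal, so that an inclusion in it can be tested
  on homogeneous generators.\<close>

definition cmps_in :: "nat set \<Rightarrow> 'a set \<Rightarrow> 'a set" where
  "cmps_in A P = {x \<in> carrier R. \<forall>s\<in>carrier R. \<forall>n\<in>A. cmp (s \<otimes> x) n \<in> P}"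

lemma cmps_in_ideal:
  assumes "subspace P" shows "ideal (cmps_in A P) R"
proof (rule idealI')
  note P = subspaceD[OF assms]
  show "\<zero> \<in> cmps_in A P" using P(2) by (simp add: cmps_in_def)
  show "x \<oplus> y \<in> cmps_in A P" if "x \<in> cmps_in A P" "y \<in> cmps_in A P" for x y
    using that P(3) by (simp add: cmps_in_def r_distr cmp_add)
  show "a \<otimes> x \<in> cmps_in A P" if "a \<in> carrier R" "x \<in> cmps_in A P" for a x
    using that m_assoc[of _ a x, symmetric] by (auto simp: cmps_in_def)
qed (auto simp: cmps_in_def)

lemma cmps_in_homogeneousI:
  assumes w: "w \<in> G j" and P: "subspace P" and "\<And>i r. i + j \<in> A \<Longrightarrow> r \<in> G i \<Longrightarrow> w \<otimes> r \<in> P"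
  shows "w \<in> cmps_in A P"
proof -
  have wc: "w \<in> carrier R" using w G_carrier by blast
  have "cmp (s \<otimes> w) n \<in> P" if s: "s \<in> carrier R" and n: "n \<in> A" for s n
    using assms(3)[OF _ cmp_G[OF s], of "n - j"] n subspaceD(2)[OF P]
    by (cases "j \<le> n") (simp_all add: m_comm[OF s wc] cmp_mult[OF w s])
  then show ?thesis using wc by (simp add: cmps_in_def)
qed

lemma cmps_in_F:
  assumes "x \<in> cmps_in {..N} P" "x \<in> F N" "subspace P" shows "x \<in> P"
proof (rule F_induct[OF _ _ _ assms(2)])
  fix i assume "i \<le> N"
  moreover have "cmp (\<one> \<otimes> x) i = cmp x i" using assms(1) by (simp add: cmps_in_def)
  ultimately show "cmp x i \<in> P" using assms(1) one_closed unfolding cmps_in_def by (metis (lifting) atMost_iff mem_Collect_eq)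
qed (use subspaceD[OF assms(3)] in auto)

lemma ideal_prod_mult_left:
  assumes "subspace A" "subspace B" "c \<in> carrier R" "x \<in> ideal_prod R A B" "\<And>a. a \<in> A \<Longrightarrow> c \<otimes> a \<in> A'"
  shows "c \<otimes> x \<in> ideal_prod R A' B"
  using assms(4)
proof (induction rule: ideal_prod.induct)
  case (prod a b)
  then have "a \<in> carrier R" "b \<in> carrier R"
    using subspaceD(1)[OF assms(1)] subspaceD(1)[OF assms(2)] by blast+
  then have "c \<otimes> (a \<otimes> b) = (c \<otimes> a) \<otimes> b" using assms(3) by (simp add: m_assoc)
  then show ?case using prod assms(5) by (auto intro: ideal_prod.prod)
next
  case (sum x y)
  then have "x \<in> carrier R" "y \<in> carrier R"
    using subspaceD(1)[OF ideal_prod_subspace[OF assms(1,2)]] by blast+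
  then have "c \<otimes> (x \<oplus> y) = c \<otimes> x \<oplus> c \<otimes> y" using assms(3) by (simp add: r_distr)
  then show ?case using sum by (auto intro: ideal_prod.sum)
qed

lemma Int_F_subspace: "ideal Q R \<Longrightarrow> subspace (Q \<inter> F t)"
  by (intro subalgebra_inter ideal_subspace F_subspace)

text \<open>In a multiple \<open>w \<otimes> r\<close> of a generator \<open>w\<close> of degree
  \<open>j\<close> the factor \<open>r\<close> has degree at most \<open>\<gamma> - j + u\<close>.
  By standardness of the grading, \<open>r\<close> is a sum of products of elements of
  \<open>F (\<gamma> - j)\<close> and \<open>F u\<close>, and the first factors lift
  \<open>w\<close> into \<open>F \<gamma>\<close>.\<close>

lemma gen_Int_F:
  assumes Q: "gen Q \<gamma>" shows "Q \<inter> F (\<gamma> + u) \<subseteq> ideal_prod R (Q \<inter> F \<gamma>) (F u)"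
proof
  let ?P = "ideal_prod R (Q \<inter> F \<gamma>) (F u)"
  have P: "subspace ?P" by (intro ideal_prod_subspace Int_F_subspace F_subspace gen_ideal[OF Q])
  have "Q \<subseteq> cmps_in {..\<gamma> + u} ?P"
  proof (rule gen_min[OF Q cmps_in_ideal[OF P]])
    fix j w assume j: "j \<le> \<gamma>" and w: "w \<in> Q" "w \<in> G j"
    show "w \<in> cmps_in {..\<gamma> + u} ?P"
    proof (rule cmps_in_homogeneousI[OF w(2) P])
      fix i r assume "i + j \<in> {..\<gamma> + u}" and r: "r \<in> G i"
      then have i: "i + j \<le> \<gamma> + u" by simp
      have "r \<in> F ((\<gamma> - j) + u)" by (rule subsetD[OF G_subset_F r]) (use i j in arith)
      then have "r \<in> ideal_prod R (F (\<gamma> - j)) (F u)" using F_add_degree by blast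
      then show "w \<otimes> r \<in> ?P"
      proof (rule ideal_prod_mult_left[OF F_subspace F_subspace G_carrier[OF w(2)]])
        fix a assume a: "a \<in> F (\<gamma> - j)"
        then have "w \<otimes> a \<in> F (j + (\<gamma> - j))" using F_mult G_subset_F[of j j] w(2) by blast
        then show "w \<otimes> a \<in> Q \<inter> F \<gamma>"
          using j ideal_mult(2)[OF gen_ideal[OF Q] _ w(1)] a F_carrier by auto
      qed
    qed
  qed
  moreover fix x assume "x \<in> Q \<inter> F (\<gamma> + u)"
  ultimately show "x \<in> ?P" using cmps_in_F[OF _ _ P] by blast
qed

lemma gen_prod:
  assumes J: "gen J \<gamma>" and Q: "gen Q \<gamma>'" shows "gen (ideal_prod R J Q) (\<gamma> + \<gamma>')"
proof -
  let ?A = "ideal_prod R J Q \<inter> (\<Union>u\<le>\<gamma> + \<gamma>'. G u)"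
  have I: "ideal (ideal_prod R J Q) R" by (rule ideal_prod_is_ideal[OF gen_ideal[OF J] gen_ideal[OF Q]])
  have Ac: "?A \<subseteq> carrier R" using G_carrier by auto
  have "ideal_prod R J Q \<subseteq> Idl ?A"
  proof (rule gen_prod_min[OF J Q genideal_ideal[OF Ac]])
    fix a b w w' assume "a \<le> \<gamma>" "b \<le> \<gamma>'" "w \<in> J" "w \<in> G a" "w' \<in> Q" "w' \<in> G b"
    then have "w \<otimes> w' \<in> ?A" using G_mult[of w a w' b] ideal_prod.prod[of w J w' Q R] by force
    then show "w \<otimes> w' \<in> Idl ?A" using genideal_self[OF Ac] by blast
  qed
  moreover have "Idl ?A \<subseteq> ideal_prod R J Q" by (rule genideal_minimal[OF I]) blast
  ultimately show ?thesis unfolding gen_def generated_in_degrees_le_def by blast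
qed

text \<open>The same splitting with two generators: the degrees missing up to
  \<open>\<gamma>\<close> and \<open>\<gamma>'\<close> are distributed over both factors. Iterated,
  it shows that a power of an ideal, cut at the matching multiple of \<open>\<gamma>\<close>, is
  spanned by products of elements cut at \<open>\<gamma>\<close>.\<close>

lemma gen_prod_Int_F:
  assumes J: "gen J \<gamma>" and Q: "gen Q \<gamma>'"
  shows "ideal_prod R J Q \<inter> F (\<gamma> + \<gamma>') \<subseteq> ideal_prod R (J \<inter> F \<gamma>) (Q \<inter> F \<gamma>')"
proof
  let ?P = "ideal_prod R (J \<inter> F \<gamma>) (Q \<inter> F \<gamma>')"
  note JF = Int_F_subspace[OF gen_ideal[OF J], of \<gamma>]
  have P: "subspace ?P" by (intro ideal_prod_subspace JF Int_F_subspace gen_ideal[OF Q])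
  have "ideal_prod R J Q \<subseteq> cmps_in {..\<gamma> + \<gamma>'} ?P"
  proof (rule gen_prod_min[OF J Q cmps_in_ideal[OF P]])
    fix a b w w' assume a: "a \<le> \<gamma>" and b: "b \<le> \<gamma>'" and w: "w \<in> J" "w \<in> G a" and w': "w' \<in> Q" "w' \<in> G b"
    show "w \<otimes> w' \<in> cmps_in {..\<gamma> + \<gamma>'} ?P"
    proof (rule cmps_in_homogeneousI[OF G_mult[OF w(2) w'(2)] P])
      fix i r assume "i + (a + b) \<in> {..\<gamma> + \<gamma>'}" and r: "r \<in> G i"
      then have i: "i + (a + b) \<le> \<gamma> + \<gamma>'" by simp
      have "r \<in> F ((\<gamma> - a) + (\<gamma>' - b))" by (rule subsetD[OF G_subset_F r]) (use i a b in arith)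
      then have "r \<in> ideal_prod R (F (\<gamma> - a)) (F (\<gamma>' - b))" using F_add_degree by blast
      then have "w \<otimes> r \<in> ideal_prod R (J \<inter> F \<gamma>) (F (\<gamma>' - b))"
      proof (rule ideal_prod_mult_left[OF F_subspace F_subspace G_carrier[OF w(2)]])
        fix x assume x: "x \<in> F (\<gamma> - a)"
        then have "w \<otimes> x \<in> F (a + (\<gamma> - a))" using F_mult G_subset_F[of a a] w(2) by blast
        then show "w \<otimes> x \<in> J \<inter> F \<gamma>"
          using a ideal_mult(2)[OF gen_ideal[OF J] _ w(1)] x F_carrier by auto
      qed
      then have "(w \<otimes> r) \<otimes> w' \<in> ?P"
      proof (rule ideal_prod_mult_right[OF JF F_subspace G_carrier[OF w'(2)]])
        fix x assume x: "x \<in> F (\<gamma>' - b)"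
        then have "x \<otimes> w' \<in> F ((\<gamma>' - b) + b)" using F_mult G_subset_F[of b b] w'(2) by blast
        then show "x \<otimes> w' \<in> Q \<inter> F \<gamma>'"
          using b ideal_mult(1)[OF gen_ideal[OF Q] _ w'(1)] x F_carrier by auto
      qed
      moreover have "(w \<otimes> r) \<otimes> w' = w \<otimes> w' \<otimes> r"
        using G_carrier[OF w(2)] G_carrier[OF w'(2)] G_carrier[OF r] by (simp add: m_ac)
      ultimately show "w \<otimes> w' \<otimes> r \<in> ?P" by simp
    qed
  qed
  moreover fix x assume "x \<in> ideal_prod R J Q \<inter> F (\<gamma> + \<gamma>')"
  ultimately show "x \<in> ?P" using cmps_in_F[OF _ _ P] by blast
qed

lemma gen_power: "gen J \<beta> \<Longrightarrow> gen (ideal_power R J v) (\<beta> * v)"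
proof (induction v)
  case 0
  then show ?case using gen_carrier by simp
next
  case (Suc v)
  then have "gen (ideal_prod R (ideal_power R J v) J) (\<beta> * v + \<beta>)" by (intro gen_prod) auto
  then show ?case by (simp add: add.commute)
qed

text \<open>The finitely many algebra generators may be inhomogeneous. Their components of degree 1
  span \<open>G 1\<close>, since the degree 1 component of a product is a combination of those of
  the factors with coefficients in the field.\<close>

lemma F_1_finite_dimension: "finite_dimension (G 0) (F 1)"
proof -
  obtain B where B: "finite B" "B \<subseteq> carrier R" "generate_ring R (G 0 \<union> B) = carrier R"
    using finitely_generated by blast
  let ?W = "(\<lambda>x. cmp x 1) ` B"
  have Wc: "?W \<subseteq> carrier R" using B by auto
  note W = subspaceD[OF spn_subspace[OF Wc]]
  let ?V = "{x \<in> carrier R. cmp x 1 \<in> spn ?W}"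
  have V_add: "x \<oplus> y \<in> ?V" if "x \<in> ?V" "y \<in> ?V" for x y
    using that W(3) by (simp add: cmp_add)
  have V: "?V = carrier R"
  proof (rule carrier_induct[OF _ _ B(3)])
    fix x assume "x \<in> G 0"
    then show "x \<in> ?V" using W(2) G_carrier by (simp add: cmp_homogeneous)
  next
    fix x assume "x \<in> B"
    then show "x \<in> ?V" using B spn_base[OF Wc] by auto
  next
    fix x y assume x: "x \<in> ?V" and y: "y \<in> ?V"
    let ?U = "{z \<in> carrier R. z \<otimes> y \<in> ?V}"
    have "x \<in> ?U"
    proof (rule in_if_cmps_in)
      fix i
      have c: "x \<in> carrier R" "y \<in> carrier R" using x y by auto
      have "(if i \<le> 1 then cmp x i \<otimes> cmp y (1 - i) else \<zero>) \<in> spn ?W"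
      proof -
        consider "i = 0" | "i = 1" | "i > 1" by linarith
        then show ?thesis
        proof cases
          case 1
          then show ?thesis using W(4)[OF cmp_G[OF c(1), of 0], of "cmp y 1"] y by simp
        next
          case 2
          then show ?thesis using W(4)[OF cmp_G[OF c(2), of 0], of "cmp x 1"] x c
            by (simp add: m_comm)
        next
          case 3
          then show ?thesis using W(2) by simp
        qed
      qed
      then show "cmp x i \<in> ?U"
        using c W(2) by (cases "i \<le> 1") (simp_all add: cmp_mult[OF cmp_G[OF c(1)] c(2)])
    next
      fix a b assume "a \<in> ?U" "b \<in> ?U"
      then show "a \<oplus> b \<in> ?U" using V_add[of "a \<otimes> y" "b \<otimes> y"] y by (simp add: l_distr)
    qed (use x y W(2) in auto)
    then show "x \<otimes> y \<in> ?V" by blast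
  qed (use V_add in auto)
  have G1: "G 1 \<subseteq> spn ?W"
  proof
    fix x assume x: "x \<in> G 1"
    then have "x \<in> ?V" unfolding V by (rule G_carrier)
    then show "x \<in> spn ?W" using cmp_homogeneous[OF x, of 1] by simp
  qed
  let ?W' = "insert \<one> ?W"
  have W'c: "?W' \<subseteq> carrier R" using Wc by auto
  note W' = subspaceD[OF spn_subspace[OF W'c]]
  have "F 1 \<subseteq> spn ?W'"
  proof
    fix x assume x: "x \<in> F 1"
    then have c: "x \<in> carrier R" by (simp add: F_def)
    show "x \<in> spn ?W'"
    proof (rule F_induct[OF W'(1-3) x])
      fix i :: nat assume "i \<le> 1"
      then consider "i = 0" | "i = 1" by linarith
      then show "cmp x i \<in> spn ?W'"
      proof cases
        case 1
        then show ?thesis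
          using W'(4)[OF cmp_G[OF c, of 0] spn_base[OF W'c, of \<one>]] c by simp
      next
        case 2
        then show ?thesis using G1 cmp_G[OF c, of 1] spn_mono[of ?W ?W'] by blast
      qed
    qed
  qed
  then show ?thesis
    using subspace_finite_dimension[OF spn_finite_dimension[OF _ W'c] F_subspace] B(1) by blast
qed

lemma F_finite_dimension: "finite_dimension (G 0) (F t)"
proof (induction t)
  case 0
  have "F 0 \<subseteq> F 1" by (rule F_mono) simp
  then show ?case using subspace_finite_dimension[OF F_1_finite_dimension F_subspace] by blast
next
  case (Suc t)
  obtain as where as: "set as \<subseteq> F 1" "spn (set as) = F 1" using finite_spanning_set[OF F_1_finite_dimension] by blast
  obtain bs where bs: "set bs \<subseteq> F t" "spn (set bs) = F t" using finite_spanning_set[OF Suc] by blast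
  let ?A = "(\<lambda>(a, b). a \<otimes> b) ` (set as \<times> set bs)"
  have c: "set as \<subseteq> carrier R" "set bs \<subseteq> carrier R" using as(1) bs(1) F_carrier by blast+
  then have Ac: "?A \<subseteq> carrier R" by auto
  note A = subspaceD[OF spn_subspace[OF Ac]]
  have 1: "a \<otimes> y \<in> spn ?A" if "a \<in> set as" "y \<in> F t" for a y
  proof -
    have "a \<otimes> y \<in> spn ((\<lambda>b. a \<otimes> b) ` set bs)"
      using spn_mult[OF c(2), of a y] that c bs by blast
    then show ?thesis using spn_mono[of "(\<lambda>b. a \<otimes> b) ` set bs" ?A] that by force
  qed
  have 2: "x \<otimes> y \<in> spn ?A" if "x \<in> F 1" "y \<in> F t" for x y
  proof -
    have yc: "y \<in> carrier R" using that F_carrier by blast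
    have "y \<otimes> x \<in> spn ((\<lambda>a. y \<otimes> a) ` set as)"
      using spn_mult[OF c(1) yc, of x] that as by blast
    moreover have "(\<lambda>a. y \<otimes> a) ` set as \<subseteq> spn ?A"
      using 1[OF _ that(2)] c(1) yc m_comm[OF yc] by auto
    ultimately have "y \<otimes> x \<in> spn ?A" using spn_min[OF spn_subspace[OF Ac]] by blast
    moreover have "x \<in> carrier R" using that F_carrier by blast
    ultimately show ?thesis using m_comm[OF yc] by simp
  qed
  have "F (Suc t) \<subseteq> ideal_prod R (F 1) (F t)" using F_add_degree[of 1 t] by simp
  also have "\<dots> \<subseteq> spn ?A" by (rule ideal_prod_min[OF 2 A(3)])
  finally show ?case
    by (rule subspace_finite_dimension[OF spn_finite_dimension[OF _ Ac] F_subspace, rotated]) simp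
qed

lemma Int_F_finite_dimension: "ideal Q R \<Longrightarrow> finite_dimension (G 0) (Q \<inter> F t)"
  by (rule subspace_finite_dimension[OF F_finite_dimension Int_F_subspace]) auto

end

section \<open>The bigraded Rees algebra\<close>

lemma deg_replicate_zero: "udeg ts (replicate n 0) = 0 \<and> vdeg ts (replicate n 0) = 0"
proof (induction ts arbitrary: n)
  case (Cons t ts)
  then show ?case by (cases n) auto
qed simp

lemma deg_unit:
  "i < length ts \<Longrightarrow> udeg ts ((replicate (length ts) 0)[i := 1]) = (if ts ! i then 0 else 1) \<and>
    vdeg ts ((replicate (length ts) 0)[i := 1]) = (if ts ! i then 1 else 0)"
proof (induction ts arbitrary: i)
  case (Cons t ts)
  then show ?case using deg_replicate_zero[of ts "length ts"] by (cases i) auto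
qed simp

context domain_over_field
begin

lemma mon_replicate_zero: "set ys \<subseteq> carrier R \<Longrightarrow> mon ys (replicate n 0) = \<one>"
proof (induction ys arbitrary: n)
  case (Cons y ys)
  then show ?case by (cases n) auto
qed simp

lemma mon_unit:
  "set ys \<subseteq> carrier R \<Longrightarrow> i < length ys \<Longrightarrow> mon ys ((replicate (length ys) 0)[i := 1]) = ys ! i"
proof (induction ys arbitrary: i)
  case (Cons y ys)
  have "i = Suc j \<Longrightarrow> ys ! j \<in> carrier R" for j using Cons.prems by (auto dest: nth_mem)
  then show ?case using Cons mon_replicate_zero[of ys "length ys"] by (cases i) auto
qed simp

end

context bigraded_span
begin

lemma monspan_subspace: "subspace (monspan w)"
  unfolding monspan_def using mon_carrier[OF ys_carrier] by (intro spn_subspace) auto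

lemma generator_mult_monspan:
  assumes i: "i < length ys" and x: "x \<in> monspan (u, v)"
  shows "ys ! i \<otimes> x \<in> monspan (u + (if ts ! i then 0 else 1), v + (if ts ! i then 1 else 0))"
proof -
  let ?e = "(replicate (length ys) 0)[i := 1]"
  have c: "mon ys ` cell ts w \<subseteq> carrier R" for w using mon_carrier[OF ys_carrier] by auto
  have "ys ! i \<otimes> x \<in> spn ((\<lambda>a. ys ! i \<otimes> a) ` mon ys ` cell ts (u, v))"
    using x ys_carrier i unfolding monspan_def by (intro spn_mult c) auto
  also have "\<dots> \<subseteq> monspan (u + (if ts ! i then 0 else 1), v + (if ts ! i then 1 else 0))"
    unfolding monspan_def image_image
  proof (rule spn_mono, rule image_subsetI)
    fix \<alpha> assume "\<alpha> \<in> cell ts (u, v)"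
    then have \<alpha>: "length \<alpha> = length ys" "udeg ts \<alpha> = u" "vdeg ts \<alpha> = v"
      using length_ts by (auto simp: cell_def)
    have "ys ! i \<otimes> mon ys \<alpha> = mon ys (map2 (+) \<alpha> ?e)"
      using mon_add[OF ys_carrier, of \<alpha> ?e] mon_unit[OF ys_carrier i] \<alpha> by simp
    moreover have "map2 (+) \<alpha> ?e \<in> cell ts (u + (if ts ! i then 0 else 1), v + (if ts ! i then 1 else 0))"
      using deg_add[of \<alpha> ts ?e] deg_unit[of i ts] \<alpha> i length_ts by (simp add: cell_def)
    ultimately show "ys ! i \<otimes> mon ys \<alpha> \<in> mon ys ` cell ts (u + (if ts ! i then 0 else 1), v + (if ts ! i then 1 else 0))"
      by simp
  qed
  finally show ?thesis .
qed

lemma spn_mult_monspan: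
  assumes A: "A \<subseteq> carrier R" "\<And>a. a \<in> A \<Longrightarrow> a \<otimes> x \<in> monspan w" and a: "a \<in> spn A" and x: "x \<in> carrier R"
  shows "a \<otimes> x \<in> monspan w"
proof -
  note M = subspaceD[OF monspan_subspace[of w]]
  have "subspace {a \<in> carrier R. a \<otimes> x \<in> monspan w}"
    using M x K_carrier by (intro subspaceI) (auto simp: l_distr m_assoc)
  then show ?thesis using spn_min[of "{a \<in> carrier R. a \<otimes> x \<in> monspan w}" A] A a by blast
qed

end

text \<open>Used for \<open>I ^ v0\<close> and for its saturation, and also for the unit ideal,
  where it yields the ascending chain condition for ideals of \<open>R\<close>.\<close>

locale filtered_rees = std_graded_domain +
  fixes J :: "'a set" and \<beta> :: nat
  assumes gen_J: "gen J \<beta>"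
begin

abbreviation pow :: "nat \<Rightarrow> 'a set" where
  "pow v \<equiv> ideal_power R J v"

definition B :: "nat \<Rightarrow> nat \<Rightarrow> 'a set" where
  "B u v = pow v \<inter> F (\<beta> * v + u)"

text \<open>Chosen once and for all, since the sublocale below needs fixed lists of generators:
  \<open>f1\<close> in bidegree (1,0) and \<open>zs\<close> in bidegree (0,1).\<close>

definition f1 :: "'a list" where
  "f1 = (SOME as. set as \<subseteq> F 1 \<and> spn (set as) = F 1)"

definition zs :: "'a list" where
  "zs = (SOME as. set as \<subseteq> J \<inter> F \<beta> \<and> spn (set as) = J \<inter> F \<beta>)"

lemma f1: "set f1 \<subseteq> F 1" "spn (set f1) = F 1"
  using someI_ex[OF finite_spanning_set[OF F_1_finite_dimension]] unfolding f1_def by blast+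

lemma J_ideal: "ideal J R" by (rule gen_ideal[OF gen_J])

lemma zs: "set zs \<subseteq> J \<inter> F \<beta>" "spn (set zs) = J \<inter> F \<beta>"
  using someI_ex[OF finite_spanning_set[OF Int_F_finite_dimension[OF J_ideal]]] unfolding zs_def by blast+

lemma pow_ideal: "ideal (pow v) R" by (rule ideal_power_ideal[OF J_ideal])

lemma gens_carrier: "set f1 \<subseteq> carrier R" "set zs \<subseteq> carrier R"
  using f1(1) zs(1) F_carrier by blast+

end

sublocale filtered_rees \<subseteq> bigraded_span R "G 0" "f1 @ zs"
    "replicate (length f1) False @ replicate (length zs) True"
  using gens_carrier by unfold_locales auto

context filtered_rees
begin

abbreviation ys where "ys \<equiv> f1 @ zs"
abbreviation ts where "ts \<equiv> replicate (length f1) False @ replicate (length zs) True"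

lemma ys_nth:
  assumes "i < length ys"
  shows "ts ! i \<Longrightarrow> ys ! i \<in> J \<inter> F \<beta>" "\<not> ts ! i \<Longrightarrow> ys ! i \<in> F 1"
  using assms f1(1) zs(1) by (auto simp: nth_append split: if_splits)

lemma B_mult: "x \<in> B s t \<Longrightarrow> y \<in> B u v \<Longrightarrow> x \<otimes> y \<in> B (s + u) (t + v)"
  using ideal_prod.prod[of x "pow t" y "pow v" R] F_mult[of x "\<beta> * t + s" y "\<beta> * v + u"]
    ideal_power_add[OF J_ideal, of t v]
  by (simp add: B_def algebra_simps)

lemma B_subspace: "subspace (B u v)"
  unfolding B_def by (rule Int_F_subspace[OF pow_ideal])

lemma one_in_B: "\<one> \<in> B 0 0"
  using G_one by (simp add: B_def F_zero)

lemma ys_in_B: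
  assumes "i < length ys" shows "ys ! i \<in> B (if ts ! i then 0 else 1) (if ts ! i then 1 else 0)"
  using ys_nth[OF assms] F_carrier ideal_power_1[OF J_ideal] by (auto simp: B_def)

text \<open>Generalized to arbitrary lists, because the induction removes generators from the fixed
  list \<open>ys\<close>.\<close>

lemma mon_in_B_aux:
  "length ys' = length ts' \<Longrightarrow> length \<delta> = length ys' \<Longrightarrow>
   (\<And>i. i < length ys' \<Longrightarrow> ys' ! i \<in> B (if ts' ! i then 0 else 1) (if ts' ! i then 1 else 0)) \<Longrightarrow>
   mon ys' \<delta> \<in> B (udeg ts' \<delta>) (vdeg ts' \<delta>)"
proof (induction ys' ts' arbitrary: \<delta> rule: list_induct2)
  case Nil
  then show ?case using one_in_B by simp
next
  case (Cons y ys' t ts')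
  obtain a as where \<delta>: "\<delta> = a # as" using Cons.prems by (metis length_Suc_conv)
  have y: "y \<in> B (if t then 0 else 1) (if t then 1 else 0)" using Cons.prems(2)[of 0] by simp
  have "y [^] a \<in> B (if t then 0 else a) (if t then a else 0)"
  proof (induction a)
    case 0
    then show ?case using one_in_B by simp
  next
    case (Suc a)
    then show ?case using B_mult[OF Suc y] by (auto split: if_splits)
  qed
  moreover have "mon ys' as \<in> B (udeg ts' as) (vdeg ts' as)"
    using Cons.prems \<delta> by (intro Cons.IH) force+
  ultimately show ?case using B_mult by (simp add: \<delta>)
qed

lemma mon_in_B: "length \<delta> = length ys \<Longrightarrow> mon ys \<delta> \<in> B (udeg ts \<delta>) (vdeg ts \<delta>)"
  using ys_in_B by (intro mon_in_B_aux) auto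

lemma monspan_subset_B: "monspan (u, v) \<subseteq> B u v"
  unfolding monspan_def
proof (rule spn_min[OF B_subspace], rule image_subsetI)
  fix \<alpha> assume "\<alpha> \<in> cell ts (u, v)"
  then show "mon ys \<alpha> \<in> B u v" using mon_in_B[of \<alpha>] by (auto simp: cell_def)
qed

lemma F_1_mult_monspan:
  assumes "a \<in> F 1" "x \<in> monspan (u, v)" shows "a \<otimes> x \<in> monspan (Suc u, v)"
proof (rule spn_mult_monspan[OF gens_carrier(1)])
  show "x \<in> carrier R" using assms subspaceD(1)[OF monspan_subspace] by blast
  fix b assume "b \<in> set f1"
  then obtain i where "i < length f1" "b = f1 ! i" by (metis in_set_conv_nth)
  then show "b \<otimes> x \<in> monspan (Suc u, v)"
    using generator_mult_monspan[of i x u v] assms by (simp add: nth_append)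
qed (use assms f1 in auto)

lemma J_mult_monspan:
  assumes "a \<in> J \<inter> F \<beta>" "x \<in> monspan (u, v)" shows "a \<otimes> x \<in> monspan (u, Suc v)"
proof (rule spn_mult_monspan[OF gens_carrier(2)])
  show "x \<in> carrier R" using assms subspaceD(1)[OF monspan_subspace] by blast
  fix b assume "b \<in> set zs"
  then obtain i where "i < length zs" "b = zs ! i" by (metis in_set_conv_nth)
  then show "b \<otimes> x \<in> monspan (u, Suc v)"
    using generator_mult_monspan[of "length f1 + i" x u v] assms by (simp add: nth_append)
qed (use assms zs in auto)

lemma F_mult_monspan: "a \<in> F s \<Longrightarrow> x \<in> monspan (u, v) \<Longrightarrow> a \<otimes> x \<in> monspan (s + u, v)"
proof (induction s arbitrary: a)
  case 0
  then show ?case using subspaceD(4)[OF monspan_subspace] F_zero by simp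
next
  case (Suc s)
  note M = subspaceD[OF monspan_subspace[of "(Suc s + u, v)"]]
  have xc: "x \<in> carrier R" using Suc.prems subspaceD(1)[OF monspan_subspace] by blast
  have "ideal_prod R (F 1) (F s) \<subseteq> {a \<in> carrier R. a \<otimes> x \<in> monspan (Suc s + u, v)}"
  proof (rule ideal_prod_min)
    fix b c assume b: "b \<in> F 1" and c: "c \<in> F s"
    then have "b \<in> carrier R" "c \<in> carrier R" using F_carrier by blast+
    then show "b \<otimes> c \<in> {a \<in> carrier R. a \<otimes> x \<in> monspan (Suc s + u, v)}"
      using F_1_mult_monspan[OF b Suc.IH[OF c Suc.prems(2)]] xc by (simp add: m_assoc)
  qed (use M xc in \<open>auto simp: l_distr\<close>)
  moreover have "a \<in> ideal_prod R (F 1) (F s)" using F_add_degree[of 1 s] Suc.prems(1) by auto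
  ultimately show ?case by blast
qed

lemma one_in_monspan: "\<one> \<in> monspan (0, 0)"
proof -
  let ?z = "replicate (length ys) (0::nat)"
  have "?z \<in> cell ts (0, 0)" using deg_replicate_zero[of ts "length ys"] by (simp add: cell_def)
  then have "mon ys ?z \<in> spn (mon ys ` cell ts (0, 0))"
    using mon_carrier[OF ys_carrier] by (intro spn_base) auto
  then show ?thesis unfolding monspan_def using mon_replicate_zero[OF ys_carrier] by simp
qed

lemma B_0_subset_monspan: "B 0 v \<subseteq> monspan (0, v)"
proof (induction v)
  case 0
  have "x \<in> monspan (0, 0)" if "x \<in> F 0" for x
    using F_mult_monspan[OF that one_in_monspan] that F_carrier[of 0] by (auto simp: subset_iff)
  then show ?case by (auto simp: B_def)
next
  case (Suc v)
  have "B 0 (Suc v) \<subseteq> ideal_prod R (B 0 v) (J \<inter> F \<beta>)"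
    using gen_prod_Int_F[OF gen_power[OF gen_J] gen_J, of v] by (simp add: B_def add.commute)
  also have "\<dots> \<subseteq> monspan (0, Suc v)"
  proof (rule ideal_prod_min)
    fix a b assume a: "a \<in> B 0 v" and b: "b \<in> J \<inter> F \<beta>"
    then have "a \<otimes> b = b \<otimes> a" using F_carrier subspaceD(1)[OF B_subspace] by (intro m_comm) blast+
    then show "a \<otimes> b \<in> monspan (0, Suc v)" using J_mult_monspan[OF b] Suc a by auto
  qed (rule subspaceD(3)[OF monspan_subspace])
  finally show ?case .
qed

text \<open>The bigraded algebra is generated in bidegrees (1,0) and (0,1): a power of
  \<open>J\<close> cut at \<open>\<beta> * v + u\<close> is its part at \<open>\<beta> * v\<close>
  times \<open>F u\<close>, and that part is generated by \<open>J \<inter> F \<beta>\<close>. Both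
  facts rest on \<open>\<beta>\<close> bounding the degrees of generators of
  \<open>J\<close>.\<close>

lemma monspan_eq_B: "monspan (u, v) = B u v"
proof
  have "B u v \<subseteq> ideal_prod R (B 0 v) (F u)"
    using gen_Int_F[OF gen_power[OF gen_J], of v u] by (simp add: B_def)
  also have "\<dots> \<subseteq> monspan (u, v)"
  proof (rule ideal_prod_min)
    fix a b assume a: "a \<in> B 0 v" and b: "b \<in> F u"
    then have "a \<otimes> b = b \<otimes> a" using F_carrier subspaceD(1)[OF B_subspace] by (intro m_comm) blast+
    then show "a \<otimes> b \<in> monspan (u, v)" using F_mult_monspan[OF b, of a 0 v] B_0_subset_monspan a by auto
  qed (rule subspaceD(3)[OF monspan_subspace])
  finally show "B u v \<subseteq> monspan (u, v)" .
qed (rule monspan_subset_B)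

lemma bigraded_submoduleI:
  assumes "\<And>u v. subspace (Q (u, v))" "\<And>u v. Q (u, v) \<subseteq> B u v"
    "\<And>m s t u v x. m \<in> B s t \<Longrightarrow> x \<in> Q (u, v) \<Longrightarrow> m \<otimes> x \<in> Q (u + s, v + t)"
  shows "bigraded_submodule Q"
  unfolding bigraded_submodule_def using assms mon_in_B monspan_eq_B by auto

lemma ev_bin2_dm_B: "ev_bin2 (\<lambda>(u, v). int (dm (B u v)))"
proof -
  have "bigraded_submodule (\<lambda>(u, v). B u v)"
    using B_subspace B_mult by (intro bigraded_submoduleI) (auto simp: add.commute)
  then show ?thesis using ev_bin2_dm[of "\<lambda>(u, v). B u v"] by (simp add: case_prod_unfold)
qed

text \<open>Multiplication by \<open>a\<close> embeds the module \<open>K\<close> into the Rees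
  algebra with a shift of the bidegree by \<open>(e, 1)\<close>. The image is a bigraded submodule,
  to which the count of initial exponents applies, and the embedding preserves dimensions. The bound
  \<open>N\<close> is again uniform in \<open>v\<close>.\<close>

lemma dm_module_poly:
  assumes K: "\<And>v. ideal (K v) R" "\<And>v x y. x \<in> J \<Longrightarrow> y \<in> K v \<Longrightarrow> x \<otimes> y \<in> K (Suc v)"
    and a: "a \<in> F e" "a \<noteq> \<zero>" and aK: "\<And>v x. x \<in> K v \<Longrightarrow> a \<otimes> x \<in> pow (Suc v)"
  shows "\<exists>N. \<forall>v\<ge>N. \<exists>P. \<forall>u\<ge>N. real (dm (K v \<inter> F (\<beta> * v + u))) = poly P (real u)"
proof -
  have ac: "a \<in> carrier R" using a F_carrier by blast
  have Kc: "x \<in> carrier R" if "x \<in> K v" for x v using ideal.Icarr[OF K(1) that] .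
  have pK: "m \<otimes> x \<in> K (v + t)" if "m \<in> pow t" "x \<in> K v" for m x v t
    using that
  proof (induction t arbitrary: m)
    case 0
    then show ?case using ideal_mult(1)[OF K(1)] by simp
  next
    case (Suc t)
    then have "m \<in> ideal_prod R (pow t) J" by simp
    then show ?case
    proof (induction rule: ideal_prod.induct)
      case (prod b c)
      have "b \<in> carrier R" "c \<in> carrier R" using prod ideal.Icarr[OF pow_ideal] ideal.Icarr[OF J_ideal] by auto
      then have "b \<otimes> c \<otimes> x = c \<otimes> (b \<otimes> x)" using Kc[OF Suc.prems(2)] by (simp add: m_ac)
      then show ?case using K(2)[OF prod(2) Suc.IH[OF prod(1) Suc.prems(2)]] by simp
    next
      case (sum b c)
      then have "b \<in> carrier R" "c \<in> carrier R"
        using ideal.Icarr[OF ideal_prod_is_ideal[OF pow_ideal J_ideal]] by blast+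
      then show ?case using sum subspaceD(3)[OF ideal_subspace[OF K(1)]] Kc[OF Suc.prems(2)]
        by (simp add: l_distr)
    qed
  qed
  define C where "C = (\<lambda>u v. (\<lambda>x. a \<otimes> x) ` (K v \<inter> F (\<beta> * v + u)))"
  have C_sub: "subspace (C u v)" for u v
  proof -
    note V = subspaceD[OF Int_F_subspace[OF K(1), of v "\<beta> * v + u"]]
    have "subspace ((\<lambda>x. a \<otimes> x) ` (K v \<inter> F (\<beta> * v + u)))"
    proof (rule subspaceI)
      show "\<zero> \<in> (\<lambda>x. a \<otimes> x) ` (K v \<inter> F (\<beta> * v + u))" using V(2) ac by (force intro: image_eqI[of _ _ \<zero>])
      fix x y assume "x \<in> (\<lambda>x. a \<otimes> x) ` (K v \<inter> F (\<beta> * v + u))" "y \<in> (\<lambda>x. a \<otimes> x) ` (K v \<inter> F (\<beta> * v + u))"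
      then obtain x' y' where *: "x' \<in> K v \<inter> F (\<beta> * v + u)" "y' \<in> K v \<inter> F (\<beta> * v + u)" "x = a \<otimes> x'" "y = a \<otimes> y'"
        by blast
      then have "x \<oplus> y = a \<otimes> (x' \<oplus> y')" using V(1) ac by (simp add: r_distr subset_iff)
      then show "x \<oplus> y \<in> (\<lambda>x. a \<otimes> x) ` (K v \<inter> F (\<beta> * v + u))" using V(3)[OF *(1,2)] by blast
    next
      fix k x assume k: "k \<in> G 0" and "x \<in> (\<lambda>x. a \<otimes> x) ` (K v \<inter> F (\<beta> * v + u))"
      then obtain x' where *: "x' \<in> K v \<inter> F (\<beta> * v + u)" "x = a \<otimes> x'" by blast
      then have "k \<otimes> x = a \<otimes> (k \<otimes> x')" using V(1) ac K_carrier[OF k] by (simp add: m_lcomm subset_iff)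
      then show "k \<otimes> x \<in> (\<lambda>x. a \<otimes> x) ` (K v \<inter> F (\<beta> * v + u))" using V(4)[OF k *(1)] by blast
    qed (use V(1) ac in auto)
    then show ?thesis by (simp add: C_def)
  qed
  \<comment> \<open>The shifted image, extended by zero to the bidegrees that the shift does not
    reach.\<close>
  define Q where "Q = (\<lambda>(u, v). if e \<le> u \<and> 1 \<le> v then C (u - e) (v - 1) else {\<zero>})"
  have "bigraded_submodule Q"
  proof (rule bigraded_submoduleI)
    show "subspace (Q (u, v))" for u v
      using C_sub subspaceI[of "{\<zero>}"] K_carrier by (simp add: Q_def)
    show "Q (u, v) \<subseteq> B u v" for u v
    proof (cases "e \<le> u \<and> 1 \<le> v")
      case True
      then obtain u' v' where uv: "u = e + u'" "v = Suc v'" by (metis le_add_diff_inverse not_less_eq_eq One_nat_def not0_implies_Suc le_zero_eq nat.distinct(1))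
      show ?thesis
      proof
        fix y assume "y \<in> Q (u, v)"
        then obtain x where x: "x \<in> K v'" "x \<in> F (\<beta> * v' + u')" "y = a \<otimes> x"
          using uv by (auto simp: Q_def C_def)
        have "y \<in> F (e + (\<beta> * v' + u'))" using F_mult[OF a(1) x(2)] x(3) by simp
        moreover have "F (e + (\<beta> * v' + u')) \<subseteq> F (\<beta> * v + u)" by (rule F_mono) (simp add: uv)
        ultimately show "y \<in> B u v" using aK[OF x(1)] x(3) by (auto simp: B_def uv)
      qed
    next
      case False
      then show ?thesis using subspaceD(2)[OF B_subspace] by (auto simp: Q_def)
    qed
    fix m s t u v x assume m: "m \<in> B s t" and x: "x \<in> Q (u, v)"
    have mc: "m \<in> carrier R" using m subspaceD(1)[OF B_subspace] by blast
    show "m \<otimes> x \<in> Q (u + s, v + t)"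
    proof (cases "e \<le> u \<and> 1 \<le> v")
      case True
      then obtain u' v' where uv: "u = e + u'" "v = Suc v'" by (metis le_add_diff_inverse not_less_eq_eq One_nat_def not0_implies_Suc le_zero_eq nat.distinct(1))
      obtain z where z: "z \<in> K v'" "z \<in> F (\<beta> * v' + u')" "x = a \<otimes> z"
        using x uv by (auto simp: Q_def C_def)
      have "m \<otimes> x = a \<otimes> (m \<otimes> z)" using z mc ac Kc by (simp add: m_lcomm)
      moreover have "m \<otimes> z \<in> K (v' + t)" using pK[OF _ z(1)] m by (simp add: B_def)
      moreover have "m \<otimes> z \<in> F (\<beta> * (v' + t) + (u' + s))"
        using F_mult[of m "\<beta> * t + s" z "\<beta> * v' + u'"] m z(2) by (simp add: B_def algebra_simps)
      ultimately show ?thesis by (auto simp: Q_def C_def uv)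
    next
      case False
      then have "m \<otimes> x = \<zero>" using x mc by (auto simp: Q_def)
      moreover have "\<zero> \<in> Q (u + s, v + t)" using subspaceD(2)[OF C_sub] by (simp add: Q_def)
      ultimately show ?thesis by simp
    qed
  qed
  then have "ev_bin2 (\<lambda>w. int (dm (Q w)))" by (rule ev_bin2_dm)
  then obtain N where N: "\<And>v. v \<ge> N \<Longrightarrow> \<exists>P. \<forall>u\<ge>N. real_of_int (int (dm (Q (u, v)))) = poly P (real u)"
    using ev_bin2_poly_fst[of "\<lambda>w. int (dm (Q w))"] by auto
  have dmQ: "dm (Q (u + e, Suc v)) = dm (K v \<inter> F (\<beta> * v + u))" for u v
    using dm_mult(2)[OF Int_F_finite_dimension[OF K(1)] ac a(2)] by (simp add: Q_def C_def)
  have "\<exists>P. \<forall>u\<ge>N. real (dm (K v \<inter> F (\<beta> * v + u))) = poly P (real u)" if v: "v \<ge> N" for v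
  proof -
    obtain P where P: "\<And>u. u \<ge> N \<Longrightarrow> real (dm (Q (u, Suc v))) = poly P (real u)"
      using N[of "Suc v"] v by auto
    \<comment> \<open>The shift is undone by composing the polynomial found at \<open>u + e\<close>
      with \<open>X + e\<close>.\<close>
    have "real (dm (K v \<inter> F (\<beta> * v + u))) = poly (pcompose P [:real e, 1:]) (real u)" if "u \<ge> N" for u
      using P[of "u + e"] that dmQ[of u v] by (simp add: poly_pcompose add.commute)
    then show ?thesis by blast
  qed
  then show ?thesis by blast
qed

end

text \<open>The stabilization of chains of bigraded submodules, for the Rees algebra of the unit ideal.\<close>

lemma (in std_graded_domain) ideal_chain_stabilizes:
  assumes I: "\<And>n. ideal (Q n) R" and mono: "\<And>n. Q n \<subseteq> Q (Suc n)"
  shows "\<exists>N. \<forall>n\<ge>N. Q n = Q N"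
proof -
  interpret filtered_rees R G "carrier R" 0
    using gen_carrier by unfold_locales
  have sub: "bigraded_submodule (\<lambda>(u, v::nat). Q n \<inter> F u)" for n
  proof (rule bigraded_submoduleI)
    \<comment> \<open>All powers of the unit ideal are \<open>R\<close>, and with
      \<open>\<beta> = 0\<close> the piece of bidegree \<open>(u, v)\<close> is \<open>F u\<close>
      for every \<open>v\<close>.\<close>
    have "pow v = carrier R" for v
      by (induction v) (simp_all add: ideal_prod_one oneideal)
    then have B: "B u v = F u" for u v using F_carrier by (auto simp: B_def)
    show "subspace (case (u, v) of (u, v) \<Rightarrow> Q n \<inter> F u)" for u v :: nat
      using Int_F_subspace[OF I] by simp
    show "(case (u, v) of (u, v) \<Rightarrow> Q n \<inter> F u) \<subseteq> B u v" for u v by (simp add: B)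
    fix m s t u x and v :: nat assume "m \<in> B s t" "x \<in> (case (u, v) of (u, v) \<Rightarrow> Q n \<inter> F u)"
    then show "m \<otimes> x \<in> (case (u + s, v + t) of (u, v) \<Rightarrow> Q n \<inter> F u)"
      using F_mult[of m s x u] ideal_mult(1)[OF I] F_carrier[of s, THEN subsetD] by (auto simp: B add.commute)
  qed
  have m: "(\<lambda>(u, v::nat). Q n \<inter> F u) w \<subseteq> (\<lambda>(u, v). Q (Suc n) \<inter> F u) w" for n w
    using mono[of n] by (cases w) auto
  obtain N where N: "\<And>n w. n \<ge> N \<Longrightarrow> (\<lambda>(u, v::nat). Q n \<inter> F u) w = (\<lambda>(u, v). Q N \<inter> F u) w"
    using bigraded_chain_stabilizes[of "\<lambda>n (u, v::nat). Q n \<inter> F u", OF sub m] by blast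
  have "Q n = Q N" if "n \<ge> N" for n
  proof -
    have eq: "Q n \<inter> F u = Q N \<inter> F u" for u using N[OF that, of "(u, 0)"] by simp
    have "x \<in> Q n \<longleftrightarrow> x \<in> Q N" if "x \<in> carrier R" for x
      using F_exhausts[OF that] eq by blast
    then show ?thesis using ideal.Icarr[OF I] by blast
  qed
  then show ?thesis by blast
qed

section \<open>Growth and chains of primes\<close>

context std_graded_domain
begin

section \<open>Growth of quotients by homogeneous ideals\<close>

definition hgrow :: "'a set \<Rightarrow> nat \<Rightarrow> nat" where
  "hgrow Q t = dm (F t) - dm (Q \<inter> F t)"

text \<open>Ensures that the natural subtraction in \<open>hgrow\<close> is a true
  difference.\<close>

lemma dm_Int_F_le: "ideal Q R \<Longrightarrow> dm (Q \<inter> F t) \<le> dm (F t)"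
  by (rule dm_mono(1)[OF F_finite_dimension Int_F_subspace]) auto

lemma hgrow_antimono:
  assumes "ideal Q R" "ideal Q' R" "Q \<subseteq> Q'" shows "hgrow Q' t \<le> hgrow Q t"
  unfolding hgrow_def
  using dm_mono(1)[OF Int_F_finite_dimension[OF assms(2)] Int_F_subspace[OF assms(1)], of t t] assms(3)
  by (intro diff_le_mono2) auto

definition add_principal :: "'a set \<Rightarrow> 'a \<Rightarrow> 'a set" where
  "add_principal Q a = {q \<oplus> a \<otimes> r | q r. q \<in> Q \<and> r \<in> carrier R}"

lemma add_principal_hideal:
  assumes Q: "hideal Q" and a: "a \<in> G e"
  shows "hideal (add_principal Q a)" "Q \<subseteq> add_principal Q a" "a \<in> add_principal Q a"
proof -
  have I: "ideal Q R" using Q unfolding hideal_def by blast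
  note QS = subspaceD[OF ideal_subspace[OF I]]
  have Qc: "q \<in> carrier R" if "q \<in> Q" for q using QS(1) that by blast
  have ac: "a \<in> carrier R" using a G_carrier by blast
  show sub: "Q \<subseteq> add_principal Q a"
  proof
    fix q assume "q \<in> Q"
    moreover have "q = q \<oplus> a \<otimes> \<zero>" using Qc[OF \<open>q \<in> Q\<close>] ac by simp
    ultimately show "q \<in> add_principal Q a" unfolding add_principal_def by blast
  qed
  have "a = \<zero> \<oplus> a \<otimes> \<one>" using ac by simp
  then show "a \<in> add_principal Q a" unfolding add_principal_def using QS(2) one_closed by blast
  have "ideal (add_principal Q a) R"
  proof (rule idealI')
    show "add_principal Q a \<subseteq> carrier R" unfolding add_principal_def using Qc ac by auto
    show "\<zero> \<in> add_principal Q a" using sub QS(2) by blast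
    fix x y assume "x \<in> add_principal Q a" "y \<in> add_principal Q a"
    then obtain q r q' r' where *: "q \<in> Q" "r \<in> carrier R" "q' \<in> Q" "r' \<in> carrier R"
      "x = q \<oplus> a \<otimes> r" "y = q' \<oplus> a \<otimes> r'" unfolding add_principal_def by blast
    have "x \<oplus> y = (q \<oplus> q') \<oplus> a \<otimes> (r \<oplus> r')"
      unfolding * using Qc[OF *(1)] Qc[OF *(3)] *(2,4) ac by (simp add: r_distr a_ac)
    then show "x \<oplus> y \<in> add_principal Q a"
      unfolding add_principal_def using QS(3)[OF *(1,3)] *(2,4) by blast
  next
    fix b x assume b: "b \<in> carrier R" and "x \<in> add_principal Q a"
    then obtain q r where *: "q \<in> Q" "r \<in> carrier R" "x = q \<oplus> a \<otimes> r" unfolding add_principal_def by blast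
    have "b \<otimes> x = b \<otimes> q \<oplus> a \<otimes> (b \<otimes> r)"
      unfolding * using Qc[OF *(1)] *(2) ac b by (simp add: r_distr m_lcomm)
    then show "b \<otimes> x \<in> add_principal Q a"
      unfolding add_principal_def using ideal_mult(1)[OF I b *(1)] *(2) b by blast
  qed
  moreover have "cmp x i \<in> add_principal Q a" if "x \<in> add_principal Q a" for x i
  proof -
    obtain q r where *: "q \<in> Q" "r \<in> carrier R" "x = q \<oplus> a \<otimes> r" using \<open>x \<in> add_principal Q a\<close> unfolding add_principal_def by blast
    have "cmp x i = cmp q i \<oplus> a \<otimes> (if e \<le> i then cmp r (i - e) else \<zero>)"
      unfolding * using Qc[OF *(1)] *(2) ac by (simp add: cmp_add cmp_mult[OF a])
    moreover have "cmp q i \<in> Q" using Q *(1) unfolding hideal_def by blast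
    moreover have "(if e \<le> i then cmp r (i - e) else \<zero>) \<in> carrier R" using *(2) by simp
    ultimately show ?thesis unfolding add_principal_def by blast
  qed
  ultimately show "hideal (add_principal Q a)" unfolding hideal_def by blast
qed

text \<open>Since \<open>a\<close> is homogeneous, a representation can be truncated degree by
  degree. The bound on \<open>r\<close> is written \<open>t < e + i\<close>, so that for
  \<open>t < e\<close> it says that \<open>r\<close> vanishes altogether.\<close>

lemma add_principal_Int_F:
  assumes Q: "hideal Q" and a: "a \<in> G e" and x: "x \<in> add_principal Q a" "x \<in> F t"
  shows "\<exists>q r. q \<in> Q \<inter> F t \<and> r \<in> carrier R \<and> (\<forall>i. t < e + i \<longrightarrow> cmp r i = \<zero>) \<and> x = q \<oplus> a \<otimes> r"
proof -
  have I: "ideal Q R" using Q unfolding hideal_def by blast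
  note QF = subspaceD[OF Int_F_subspace[OF I, of t]]
  have ac: "a \<in> carrier R" using a G_carrier by blast
  let ?V = "{x \<in> carrier R. \<exists>q r. q \<in> Q \<inter> F t \<and> r \<in> carrier R \<and> (\<forall>i. t < e + i \<longrightarrow> cmp r i = \<zero>) \<and> x = q \<oplus> a \<otimes> r}"
  have "x \<in> ?V"
  proof (rule F_induct[OF _ _ _ x(2)])
    have "\<zero> = \<zero> \<oplus> a \<otimes> \<zero>" using ac by simp
    then show "\<zero> \<in> ?V" using QF(2) zero_closed cmp_zero by blast
    fix y z assume "y \<in> ?V" "z \<in> ?V"
    then obtain q r q' r' where *: "q \<in> Q \<inter> F t" "r \<in> carrier R" "\<forall>i. t < e + i \<longrightarrow> cmp r i = \<zero>" "y = q \<oplus> a \<otimes> r"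
      "q' \<in> Q \<inter> F t" "r' \<in> carrier R" "\<forall>i. t < e + i \<longrightarrow> cmp r' i = \<zero>" "z = q' \<oplus> a \<otimes> r'" by blast
    have "q \<in> carrier R" "q' \<in> carrier R" using * QF(1) by blast+
    then have "y \<oplus> z = (q \<oplus> q') \<oplus> a \<otimes> (r \<oplus> r')" "y \<oplus> z \<in> carrier R"
      unfolding * using *(2,6) ac by (simp_all add: r_distr a_ac)
    moreover have "\<forall>i. t < e + i \<longrightarrow> cmp (r \<oplus> r') i = \<zero>" using * by (simp add: cmp_add)
    ultimately show "y \<oplus> z \<in> ?V" using QF(3)[OF *(1,5)] *(2,6) by blast
  next
    fix i assume i: "i \<le> t"
    obtain q r where *: "q \<in> Q" "r \<in> carrier R" "x = q \<oplus> a \<otimes> r" using x(1) unfolding add_principal_def by blast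
    have qc: "q \<in> carrier R" using *(1) ideal.Icarr[OF I] by blast
    let ?r = "if e \<le> i then cmp r (i - e) else \<zero>"
    have "cmp x i = cmp q i \<oplus> a \<otimes> ?r"
      unfolding * using qc *(2) ac by (simp add: cmp_add cmp_mult[OF a])
    moreover have "cmp q i \<in> Q \<inter> F t"
      using Q *(1) cmp_G[OF qc, of i] G_subset_F[OF i] unfolding hideal_def by blast
    moreover have "?r \<in> carrier R" using *(2) by simp
    moreover have "\<forall>j. t < e + j \<longrightarrow> cmp ?r j = \<zero>"
      using i cmp_homogeneous[OF cmp_G[OF *(2), of "i - e"]] by auto
    moreover have "cmp x i \<in> carrier R" using x(2) by (simp add: F_def)
    ultimately show "cmp x i \<in> ?V" by blast
  qed auto
  then show ?thesis by blast
qed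

text \<open>The dimension count in the exact sequence \<open>0 \<rightarrow> R/(Q : a)(-e)
  \<rightarrow> R/Q \<rightarrow> R/(Q + aR) \<rightarrow> 0\<close>, cut off at degree
  \<open>t\<close>. It is carried out with the sum and the intersection of
  \<open>Q \<inter> F t\<close> and \<open>a F (t - e)\<close>.\<close>

lemma hgrow_add_principal:
  assumes Q: "hideal Q" and a: "a \<in> G e" "a \<noteq> \<zero>"
  shows "e \<le> t \<Longrightarrow> hgrow Q t = hgrow {x \<in> carrier R. x \<otimes> a \<in> Q} (t - e) + hgrow (add_principal Q a) t"
    "t < e \<Longrightarrow> hgrow Q t = hgrow (add_principal Q a) t"
proof -
  have I: "ideal Q R" using Q unfolding hideal_def by blast
  have I': "ideal (add_principal Q a) R" using add_principal_hideal(1)[OF Q a(1)] unfolding hideal_def by blast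
  note QF = subspaceD[OF Int_F_subspace[OF I, of t]]
  have ac: "a \<in> carrier R" using a G_carrier by blast
  let ?C = "{x \<in> carrier R. x \<otimes> a \<in> Q}"
  have IC: "ideal ?C R" by (rule colon_ideal[OF I ac])
  have no_part: "r = \<zero>" if "r \<in> carrier R" "\<forall>i. cmp r i = \<zero>" for r
    using in_if_cmps_in[of "{\<zero>}" r] that by auto
  {
    assume t: "e \<le> t"
    let ?E = "Q \<inter> F t" and ?A = "(\<lambda>x. a \<otimes> x) ` F (t - e)" and ?D = "(\<lambda>x. a \<otimes> x) ` (?C \<inter> F (t - e))"
    have aF: "a \<otimes> x \<in> F t" if "x \<in> F (t - e)" for x
      using F_mult[of a e x "t - e"] G_subset_F[of e e] a(1) that t by auto
    have sum: "?E <+>\<^bsub>R\<^esub> ?A = add_principal Q a \<inter> F t"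
    proof (intro equalityI subsetI)
      fix x assume "x \<in> ?E <+>\<^bsub>R\<^esub> ?A"
      then obtain q r where *: "q \<in> ?E" "r \<in> F (t - e)" "x = q \<oplus> a \<otimes> r" unfolding set_add_def' by blast
      then have "x \<in> F t" using subspaceD(3)[OF F_subspace] aF by blast
      then show "x \<in> add_principal Q a \<inter> F t" using * F_carrier unfolding add_principal_def by blast
    next
      fix x assume "x \<in> add_principal Q a \<inter> F t"
      then obtain q r where *: "q \<in> Q \<inter> F t" "r \<in> carrier R" "\<forall>i. t < e + i \<longrightarrow> cmp r i = \<zero>" "x = q \<oplus> a \<otimes> r"
        using add_principal_Int_F[OF Q a(1)] by blast
      then have "r \<in> F (t - e)" using t by (simp add: F_def)
      then show "x \<in> ?E <+>\<^bsub>R\<^esub> ?A" using * unfolding set_add_def' by blast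
    qed
    have inter: "?E \<inter> ?A = ?D"
    proof (intro equalityI subsetI)
      fix x assume "x \<in> ?E \<inter> ?A"
      then obtain r where *: "x \<in> Q" "r \<in> F (t - e)" "x = a \<otimes> r" by blast
      have rc: "r \<in> carrier R" using * F_carrier by blast
      then have "r \<otimes> a \<in> Q" using *(1,3) m_comm[OF ac rc] by simp
      then show "x \<in> ?D" using * rc by blast
    next
      fix x assume "x \<in> ?D"
      then obtain r where *: "r \<in> carrier R" "r \<otimes> a \<in> Q" "r \<in> F (t - e)" "x = a \<otimes> r" by blast
      then have "x \<in> ?E" using aF[OF *(3)] m_comm[OF ac *(1)] by simp
      then show "x \<in> ?E \<inter> ?A" using * by blast
    qed
    have "dimension (dm ?E) (G 0) ?E" "dimension (dm (F (t - e))) (G 0) ?A" "dimension (dm (?C \<inter> F (t - e))) (G 0) (?E \<inter> ?A)"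
      using finite_dimensionE[OF subfield Int_F_finite_dimension[OF I, of t]]
        finite_dimensionE[OF subfield dm_mult(1)[OF F_finite_dimension ac a(2)], of "t - e"]
        finite_dimensionE[OF subfield dm_mult(1)[OF Int_F_finite_dimension[OF IC] ac a(2)], of "t - e"]
      unfolding inter dm_mult(2)[OF F_finite_dimension ac a(2)] dm_mult(2)[OF Int_F_finite_dimension[OF IC] ac a(2)]
      by blast+
    from dimension_sum_space[OF subfield this]
    have "dm (add_principal Q a \<inter> F t) = dm ?E + dm (F (t - e)) - dm (?C \<inter> F (t - e))"
      unfolding sum by (rule dim_unique)
    then show "hgrow Q t = hgrow ?C (t - e) + hgrow (add_principal Q a) t"
      using dm_Int_F_le[OF I, of t] dm_Int_F_le[OF IC, of "t - e"] dm_Int_F_le[OF I', of t]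
      unfolding hgrow_def by linarith
  next
    assume t: "t < e"
    have "add_principal Q a \<inter> F t = Q \<inter> F t"
    proof (intro equalityI subsetI)
      fix x assume "x \<in> add_principal Q a \<inter> F t"
      then obtain q r where *: "q \<in> Q \<inter> F t" "r \<in> carrier R" "\<forall>i. t < e + i \<longrightarrow> cmp r i = \<zero>" "x = q \<oplus> a \<otimes> r"
        using add_principal_Int_F[OF Q a(1)] by blast
      then have "\<forall>i. cmp r i = \<zero>" using t by simp
      then have "r = \<zero>" by (rule no_part[OF *(2)])
      then show "x \<in> Q \<inter> F t" using * QF(1) ac by auto
    next
      fix x assume "x \<in> Q \<inter> F t"
      then show "x \<in> add_principal Q a \<inter> F t" using add_principal_hideal(2)[OF Q a(1)] by blast
    qed
    then show "hgrow Q t = hgrow (add_principal Q a) t" by (simp add: hgrow_def)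
  }
qed

text \<open>Level \<open>k\<close> stands for growth of order \<open>k - 1\<close>. The separate
  value at \<open>k = 0\<close> makes an ideal small at level 0 only if it is all of
  \<open>R\<close>, which no power of \<open>t + 1\<close> could express.\<close>

definition order_bound :: "nat \<Rightarrow> nat \<Rightarrow> nat" where
  "order_bound k t = (if k = 0 then 0 else (t + 1) ^ (k - 1))"

definition small :: "nat \<Rightarrow> 'a set \<Rightarrow> bool" where
  "small k Q \<longleftrightarrow> (\<exists>C. \<forall>t. hgrow Q t \<le> C * order_bound k t)"

lemma order_bound_mono: "s \<le> t \<Longrightarrow> order_bound k s \<le> order_bound k t"
  unfolding order_bound_def by (simp add: power_mono)

lemma small_antimono: "small k Q \<Longrightarrow> ideal Q R \<Longrightarrow> ideal Q' R \<Longrightarrow> Q \<subseteq> Q' \<Longrightarrow> small k Q'"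
  unfolding small_def using hgrow_antimono le_trans by meson

lemma small_from_parts:
  assumes Q: "hideal Q" and a: "a \<in> G e" "a \<noteq> \<zero>"
    and small: "small k {x \<in> carrier R. x \<otimes> a \<in> Q}" "small k (add_principal Q a)"
  shows "small k Q"
proof -
  obtain C C' where C: "\<And>t. hgrow {x \<in> carrier R. x \<otimes> a \<in> Q} t \<le> C * order_bound k t"
    "\<And>t. hgrow (add_principal Q a) t \<le> C' * order_bound k t"
    using small unfolding small_def by blast
  have "hgrow Q t \<le> (C + C') * order_bound k t" for t
  proof (cases "e \<le> t")
    case True
    have "C * order_bound k (t - e) \<le> C * order_bound k t" by (intro mult_le_mono order_bound_mono) auto
    then show ?thesis
      using hgrow_add_principal(1)[OF Q a True] C(1)[of "t - e"] C(2)[of t]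
      unfolding distrib_right by linarith
  next
    case False
    then show ?thesis
      using hgrow_add_principal(2)[OF Q a, of t] C(2)[of t] by (simp add: distrib_right)
  qed
  then show ?thesis unfolding small_def by blast
qed

section \<open>From growth to chains of primes\<close>

lemma maximal_hideal:
  assumes "A Q" "\<And>P. A P \<Longrightarrow> hideal P"
  shows "\<exists>P. A P \<and> Q \<subseteq> P \<and> (\<forall>P'. A P' \<longrightarrow> P \<subseteq> P' \<longrightarrow> P' = P)"
proof (rule ccontr)
  assume neg: "\<not> ?thesis"
  have larger: "\<exists>P'. A P' \<and> P \<subset> P'" if "A P" "Q \<subseteq> P" for P
  proof -
    have "\<not> (\<forall>P'. A P' \<longrightarrow> P \<subseteq> P' \<longrightarrow> P' = P)" using neg that by simp
    then obtain P' where "A P'" "P \<subseteq> P'" "P' \<noteq> P" by (simp only: not_all not_imp) (elim exE conjE)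
    then show ?thesis by auto
  qed
  \<comment> \<open>Without a maximal element, dependent choice produces a strictly ascending chain
    of ideals.\<close>
  have "\<exists>f. \<forall>n. (A (f n) \<and> Q \<subseteq> f n) \<and> f n \<subset> f (Suc n)"
  proof (rule dependent_nat_choice)
    show "\<exists>x. A x \<and> Q \<subseteq> x" using assms(1) by blast
    fix P and n :: nat assume "A P \<and> Q \<subseteq> P"
    then obtain P' where "A P'" "P \<subset> P'" using larger[of P] by auto
    then show "\<exists>y. (A y \<and> Q \<subseteq> y) \<and> P \<subset> y" using \<open>A P \<and> Q \<subseteq> P\<close> by auto
  qed
  then obtain f where "\<forall>n. (A (f n) \<and> Q \<subseteq> f n) \<and> f n \<subset> f (Suc n)" by (elim exE)
  then have f': "(A (f n) \<and> Q \<subseteq> f n) \<and> f n \<subset> f (Suc n)" for n by (rule spec)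
  note f = f'[THEN conjunct1, THEN conjunct1] f'[THEN conjunct2]
  have "ideal (f n) R" for n using assms(2)[OF f(1)] unfolding hideal_def by blast
  moreover have "f n \<subseteq> f (Suc n)" for n by (rule psubset_imp_subset[OF f(2)])
  ultimately have "\<exists>N. \<forall>n\<ge>N. f n = f N" by (rule ideal_chain_stabilizes)
  then obtain N where N: "\<forall>n\<ge>N. f n = f N" by (elim exE)
  have "f (Suc N) = f N" by (rule N[rule_format]) simp
  then show False using f(2)[of N] by simp
qed

lemma cmp_mult_top:
  assumes x: "x \<in> F s" and y: "y \<in> F t" shows "cmp (x \<otimes> y) (s + t) = cmp x s \<otimes> cmp y t"
proof -
  have yc: "y \<in> carrier R" using y F_carrier by blast
  have xc: "x \<in> carrier R" using x F_carrier by blast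
  let ?V = "{z \<in> carrier R. cmp (z \<otimes> y) (s + t) = cmp z s \<otimes> cmp y t}"
  have "x \<in> ?V"
  proof (rule F_induct[OF _ _ _ x])
    fix a b assume "a \<in> ?V" "b \<in> ?V"
    then show "a \<oplus> b \<in> ?V" using yc by (simp add: l_distr cmp_add)
  next
    fix i assume i: "i \<le> s"
    show "cmp x i \<in> ?V"
    proof (cases "i = s")
      case True
      then show ?thesis using xc cmp_mult[OF cmp_G[OF xc, of s] yc, of "s + t"] cmp_homogeneous[OF cmp_G[OF xc, of s], of s] by simp
    next
      case False
      then have "t < s + t - i" using i by simp
      then have "cmp y (s + t - i) = \<zero>" using y by (simp add: F_def)
      then show ?thesis
        using False i xc yc cmp_mult[OF cmp_G[OF xc, of i] yc, of "s + t"] cmp_homogeneous[OF cmp_G[OF xc, of i], of s] by simp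
    qed
  qed (use yc in auto)
  then show ?thesis by blast
qed

lemma add_minus_cancel:
  assumes "x \<in> carrier R" "y \<in> carrier R" shows "y \<oplus> (x \<ominus> y) = x"
proof -
  have "y \<oplus> (x \<ominus> y) = x \<oplus> (y \<oplus> \<ominus> y)"
    unfolding a_minus_def using assms by (intro a_lcomm) auto
  then show ?thesis using assms by (simp add: r_neg)
qed

text \<open>Components that lie in \<open>P\<close> may be dropped without leaving the residue
  class. This serves to isolate the top component outside a prime, and to detect inclusions of
  ideals in bounded degrees.\<close>

lemma truncate_mod_ideal:
  assumes P: "ideal P R" and x: "x \<in> carrier R" "\<And>i. i > s \<Longrightarrow> cmp x i \<in> P"
  shows "\<exists>y\<in>F s. cmp y s = cmp x s \<and> x \<ominus> y \<in> P"
proof -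
  note PS = subspaceD[OF ideal_subspace[OF P]] and FS = subspaceD[OF F_subspace[of s]]
  let ?V = "{z \<in> carrier R. \<exists>y\<in>F s. cmp y s = cmp z s \<and> z \<ominus> y \<in> P}"
  have "x \<in> ?V"
  proof (rule in_if_cmps_in[OF _ _ _ x(1)])
    have "\<zero> \<ominus> \<zero> \<in> P" using PS(2) by (simp add: a_minus_def)
    then show "\<zero> \<in> ?V" using FS(2) zero_closed by blast
    fix a b assume "a \<in> ?V" "b \<in> ?V"
    then obtain y z where *: "a \<in> carrier R" "b \<in> carrier R" "y \<in> F s" "z \<in> F s" "cmp y s = cmp a s" "cmp z s = cmp b s"
      "a \<ominus> y \<in> P" "b \<ominus> z \<in> P" by blast
    have c: "y \<in> carrier R" "z \<in> carrier R" using * FS(1) by blast+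
    have "a \<oplus> b \<ominus> (y \<oplus> z) = (a \<ominus> y) \<oplus> (b \<ominus> z)"
      using * c by (simp add: a_minus_def minus_add a_ac)
    then have "a \<oplus> b \<ominus> (y \<oplus> z) \<in> P" using PS(3)[OF *(7,8)] by simp
    moreover have "cmp (y \<oplus> z) s = cmp (a \<oplus> b) s" using * c by (simp add: cmp_add)
    ultimately show "a \<oplus> b \<in> ?V" using FS(3)[OF *(3,4)] *(1,2) by blast
  next
    fix i
    have c: "cmp x i \<in> carrier R" using x by simp
    show "cmp x i \<in> ?V"
    proof (cases "i \<le> s")
      case True
      then have "cmp x i \<in> F s" using G_subset_F cmp_G[OF x(1)] by blast
      moreover have "cmp x i \<ominus> cmp x i \<in> P" using c PS(2) by (simp add: a_minus_def r_neg)
      ultimately show ?thesis using c by blast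
    next
      case False
      then have "cmp x i \<ominus> \<zero> \<in> P" using x(2)[of i] c by (simp add: a_minus_def)
      moreover have "cmp \<zero> s = cmp (cmp x i) s"
        using False cmp_homogeneous[OF cmp_G[OF x(1), of i], of s] by simp
      ultimately show ?thesis using c FS(2) by blast
    qed
  qed auto
  then show ?thesis by blast
qed

text \<open>For \<open>x\<close> and \<open>y\<close> outside \<open>P\<close> take the largest
  degrees of components outside \<open>P\<close> and discard everything above modulo
  \<open>P\<close>. The top component of the product of the truncations is the product of these two
  components.\<close>

lemma hideal_prime_test:
  assumes P: "hideal P" "P \<noteq> carrier R"
    and hom: "\<And>i j a b. a \<in> G i \<Longrightarrow> b \<in> G j \<Longrightarrow> a \<otimes> b \<in> P \<Longrightarrow> a \<in> P \<or> b \<in> P"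
  shows "primeideal P R"
proof (rule primeidealI)
  show I: "ideal P R" using P unfolding hideal_def by blast
  note PS = subspaceD[OF ideal_subspace[OF I]]
  show "cring R" by (rule is_cring)
  show "carrier R \<noteq> P" using P by blast
  fix x y assume x: "x \<in> carrier R" and y: "y \<in> carrier R" and xy: "x \<otimes> y \<in> P"
  have last: "\<exists>s. cmp z s \<notin> P \<and> (\<forall>i>s. cmp z i \<in> P)" if z: "z \<in> carrier R" "z \<notin> P" for z
  proof -
    obtain t where t: "z \<in> F t" using F_exhausts z by blast
    let ?S = "{s. cmp z s \<notin> P}"
    have "?S \<subseteq> {..t}" using t PS(2) by (auto simp: F_def not_le[symmetric])
    then have fin: "finite ?S" by (rule finite_subset) simp
    have "?S \<noteq> {}" using in_if_cmps_in[of P z] PS z by blast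
    then have "Max ?S \<in> ?S" using fin by (rule Max_in[rotated])
    moreover have "cmp z i \<in> P" if "i > Max ?S" for i
      using that Max_ge[OF fin, of i] by force
    ultimately show ?thesis by blast
  qed
  show "x \<in> P \<or> y \<in> P"
  proof (rule ccontr)
    assume "\<not> (x \<in> P \<or> y \<in> P)"
    then have "x \<notin> P" "y \<notin> P" by simp_all
    from last[OF x this(1)] last[OF y this(2)]
    obtain s t where s: "cmp x s \<notin> P" "\<And>i. i > s \<Longrightarrow> cmp x i \<in> P"
      and t: "cmp y t \<notin> P" "\<And>i. i > t \<Longrightarrow> cmp y i \<in> P"
      by (elim exE conjE) simp
    obtain x' where x': "x' \<in> F s" "cmp x' s = cmp x s" "x \<ominus> x' \<in> P" using truncate_mod_ideal[OF I x s(2)] by blast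
    obtain y' where y': "y' \<in> F t" "cmp y' t = cmp y t" "y \<ominus> y' \<in> P" using truncate_mod_ideal[OF I y t(2)] by blast
    have c: "x' \<in> carrier R" "y' \<in> carrier R" using x' y' F_carrier by blast+
    \<comment> \<open>The part of \<open>x \<otimes> y\<close> that is lost by truncating both
      factors; it lies in \<open>P\<close>.\<close>
    define p where "p = x' \<otimes> (y \<ominus> y') \<oplus> (x \<ominus> x') \<otimes> y"
    have pP: "p \<in> P"
      unfolding p_def by (intro PS(3) ideal_mult(1)[OF I c(1) y'(3)] ideal_mult(2)[OF I y x'(3)])
    have xc: "x = x' \<oplus> (x \<ominus> x')" and yc: "y = y' \<oplus> (y \<ominus> y')"
      using c x y add_minus_cancel by simp_all
    have "x \<otimes> y = x' \<otimes> y \<oplus> (x \<ominus> x') \<otimes> y"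
      using x y c by (subst xc, subst l_distr) auto
    moreover have "x' \<otimes> y = x' \<otimes> y' \<oplus> x' \<otimes> (y \<ominus> y')"
      using y c by (subst yc, subst r_distr) auto
    ultimately have "x \<otimes> y = x' \<otimes> y' \<oplus> p"
      unfolding p_def using x y c by (simp add: a_assoc)
    moreover have "p \<in> carrier R" using pP PS(1) by blast
    ultimately have "x' \<otimes> y' = x \<otimes> y \<ominus> p"
      using c by (simp add: a_minus_def a_assoc r_neg)
    then have "x' \<otimes> y' \<in> P" using PS(6)[OF xy pP] by simp
    then have "cmp (x' \<otimes> y') (s + t) \<in> P" using P(1) unfolding hideal_def by blast
    then have "cmp x s \<otimes> cmp y t \<in> P" using cmp_mult_top[OF x'(1) y'(1)] x'(2) y'(2) by simp
    then show False using hom[OF cmp_G[OF x] cmp_G[OF y]] s(1) t(1) by blast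
  qed
qed

text \<open>Take \<open>P\<close> maximal among the homogeneous ideals above \<open>Q\<close> that
  are not small. If \<open>a \<otimes> b \<in> P\<close> with both factors outside \<open>P\<close>,
  then \<open>P + aR\<close> and \<open>P + bR\<close> are small. The colon ideal
  \<open>P : a\<close> contains \<open>P + bR\<close>, so it is small too, and the exact sequence
  for \<open>a\<close> makes \<open>P\<close> small.\<close>

lemma prime_above:
  assumes Q: "hideal Q" "\<not> small k Q"
  shows "\<exists>P. hideal P \<and> primeideal P R \<and> Q \<subseteq> P \<and> \<not> small k P"
proof -
  have "\<exists>P. (hideal P \<and> \<not> small k P) \<and> Q \<subseteq> P \<and> (\<forall>P'. hideal P' \<and> \<not> small k P' \<longrightarrow> P \<subseteq> P' \<longrightarrow> P' = P)"
    by (rule maximal_hideal) (use Q in auto)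
  then obtain P where P: "hideal P" "\<not> small k P" "Q \<subseteq> P"
    and "\<forall>P'. hideal P' \<and> \<not> small k P' \<longrightarrow> P \<subseteq> P' \<longrightarrow> P' = P"
    by (elim exE conjE)
  then have max: "\<And>P'. hideal P' \<Longrightarrow> \<not> small k P' \<Longrightarrow> P \<subseteq> P' \<Longrightarrow> P' = P" by simp
  have I: "ideal P R" using P unfolding hideal_def by blast
  have "primeideal P R"
  proof (rule hideal_prime_test[OF P(1)])
    show "P \<noteq> carrier R"
    proof
      assume "P = carrier R"
      then have "hgrow P t = 0" for t using F_carrier by (simp add: hgrow_def Int_absorb1)
      then show False using P(2) unfolding small_def by auto
    qed
    fix i j a b assume a: "a \<in> G i" and b: "b \<in> G j" and ab: "a \<otimes> b \<in> P"
    show "a \<in> P \<or> b \<in> P"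
    proof (rule ccontr)
      assume n: "\<not> (a \<in> P \<or> b \<in> P)"
      have small: "small k (add_principal P c)" if "c \<in> G l" "c \<notin> P" for c l
        using max[OF add_principal_hideal(1)[OF P(1) that(1)] _ add_principal_hideal(2)[OF P(1) that(1)]]
          add_principal_hideal(3)[OF P(1) that(1)] that(2) by blast
      have ac: "a \<in> carrier R" and bc: "b \<in> carrier R" using a b G_carrier by auto
      have IC: "ideal {x \<in> carrier R. x \<otimes> a \<in> P} R" by (rule colon_ideal[OF I ac])
      have "add_principal P b \<subseteq> {x \<in> carrier R. x \<otimes> a \<in> P}"
      proof
        fix x assume "x \<in> add_principal P b"
        then obtain q r where *: "q \<in> P" "r \<in> carrier R" "x = q \<oplus> b \<otimes> r" unfolding add_principal_def by blast
        have qc: "q \<in> carrier R" using * ideal.Icarr[OF I] by blast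
        have "x \<otimes> a = q \<otimes> a \<oplus> r \<otimes> (a \<otimes> b)" unfolding * using qc *(2) ac bc by algebra
        then have "x \<otimes> a \<in> P"
          using subspaceD(3)[OF ideal_subspace[OF I]] ideal_mult[OF I] *(1,2) ac ab by metis
        then show "x \<in> {x \<in> carrier R. x \<otimes> a \<in> P}" using * qc bc by simp
      qed
      then have "small k {x \<in> carrier R. x \<otimes> a \<in> P}"
        using small_antimono[OF small[OF b] _ IC] n add_principal_hideal(1)[OF P(1) b]
        unfolding hideal_def by blast
      moreover have "a \<noteq> \<zero>" using n subspaceD(2)[OF ideal_subspace[OF I]] by blast
      ultimately have "small k P" using small_from_parts[OF P(1) a] small[OF a] n by blast
      then show False using P(2) by blast
    qed
  qed
  then show ?thesis using P by blast
qed

text \<open>For a homogeneous \<open>a\<close> of positive degree outside the prime \<open>P\<close>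
  the colon ideal \<open>P : a\<close> is \<open>P\<close>, so the exact sequence becomes a
  recursion that sums up the growth of \<open>P + aR\<close>. Summation raises the order by at most
  one; hence \<open>P + aR\<close> cannot be small at level \<open>k\<close>.\<close>

lemma larger_hideal:
  assumes P: "hideal P" "primeideal P R" "\<not> small (Suc k) P"
  shows "\<exists>Q. hideal Q \<and> P \<subset> Q \<and> \<not> small k Q"
proof -
  have I: "ideal P R" using P unfolding hideal_def by blast
  have "\<exists>e a. a \<in> G e \<and> e > 0 \<and> a \<notin> P"
  proof (rule ccontr)
    assume "\<not> ?thesis"
    then have n: "a \<in> P" if "a \<in> G e" "e > 0" for a e using that by blast
    \<comment> \<open>If \<open>P\<close> contains everything homogeneous of positive degree, then
      \<open>F t\<close> is spanned by 1 and \<open>P \<inter> F t\<close>.\<close>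
    have "hgrow P t \<le> 1" for t
    proof -
      let ?E = "P \<inter> F t"
      note E = subspaceD[OF Int_F_subspace[OF I, of t]]
      have c: "insert \<one> ?E \<subseteq> carrier R" using E(1) by auto
      note S = subspaceD[OF spn_subspace[OF c]]
      have "F t \<subseteq> spn (insert \<one> ?E)"
      proof
        fix x assume x: "x \<in> F t"
        then have xc: "x \<in> carrier R" using F_carrier by blast
        show "x \<in> spn (insert \<one> ?E)"
        proof (rule F_induct[OF S(1-3) x])
          fix i assume i: "i \<le> t"
          show "cmp x i \<in> spn (insert \<one> ?E)"
          proof (cases "i = 0")
            case True
            then show ?thesis using S(4)[OF cmp_G[OF xc, of 0] spn_base[OF c, of \<one>]] xc by simp
          next
            case False
            then have "cmp x i \<in> ?E" using n[OF cmp_G[OF xc]] G_subset_F[OF i] cmp_G[OF xc] by blast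
            then show ?thesis using spn_base[OF c] by blast
          qed
        qed
      qed
      moreover have "spn (insert \<one> ?E) = line_extension (G 0) \<one> ?E"
        using spn_insert[OF E(1) one_closed] spn_of_subspace[OF Int_F_subspace[OF I]] by simp
      ultimately have sub: "F t \<subseteq> line_extension (G 0) \<one> ?E" by simp
      have d: "dimension (dm ?E) (G 0) ?E" using finite_dimensionE[OF subfield Int_F_finite_dimension[OF I]] .
      show ?thesis
      proof (cases "\<one> \<in> ?E")
        case True
        then have "insert \<one> ?E = ?E" by blast
        then have "F t \<subseteq> ?E" using sub spn_insert[OF E(1) one_closed] spn_of_subspace[OF Int_F_subspace[OF I]] by metis
        then have "?E = F t" by blast
        then show ?thesis by (simp add: hgrow_def)
      next
        case False
        have "dimension (Suc (dm ?E)) (G 0) (line_extension (G 0) \<one> ?E)"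
          by (rule Suc_dim[OF one_closed False d])
        then have "dm (F t) \<le> Suc (dm ?E)"
          using dm_mono(1)[OF finite_dimensionI F_subspace sub] dim_unique by metis
        then show ?thesis by (simp add: hgrow_def)
      qed
    qed
    then have "hgrow P t \<le> 1 * order_bound (Suc k) t" for t
      using le_trans[OF _ one_le_power[of "t + 1" k]] by (simp add: order_bound_def)
    then show False using P(3) unfolding small_def by blast
  qed
  then obtain e a where a: "a \<in> G e" "e > 0" "a \<notin> P" by blast
  have ac: "a \<in> carrier R" using a G_carrier by blast
  have a0: "a \<noteq> \<zero>" using a(3) subspaceD(2)[OF ideal_subspace[OF I]] by blast
  let ?Q = "add_principal P a"
  have colon: "{x \<in> carrier R. x \<otimes> a \<in> P} = P"
    using primeideal.I_prime[OF P(2)] a(3) ac ideal_mult(2)[OF I ac] ideal.Icarr[OF I] by blast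
  have "\<not> small k ?Q"
  proof
    assume "small k ?Q"
    then obtain C where C: "\<And>t. hgrow ?Q t \<le> C * order_bound k t" unfolding small_def by blast
    \<comment> \<open>The recursion descends in steps of \<open>e > 0\<close> and ends below
      \<open>e\<close>; \<open>M\<close> bounds every value at which it can end.\<close>
    define M where "M = (\<Sum>s<e. hgrow P s)"
    have bound: "hgrow P t \<le> M + (t + 1) * (C * order_bound k t)" for t
    proof (induction t rule: less_induct)
      case (less t)
      show ?case
      proof (cases "e \<le> t")
        case False
        then have "hgrow P t \<le> M" unfolding M_def by (intro member_le_sum) auto
        then show ?thesis by simp
      next
        case True
        then have "hgrow P t = hgrow P (t - e) + hgrow ?Q t"
          using hgrow_add_principal(1)[OF P(1) a(1) a0] colon by simp
        also have "\<dots> \<le> (M + (t - e + 1) * (C * order_bound k (t - e))) + C * order_bound k t"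
          using less.IH[of "t - e"] True a(2) C[of t] by (intro add_mono) auto
        also have "(t - e + 1) * (C * order_bound k (t - e)) \<le> t * (C * order_bound k t)"
          using True a(2) by (intro mult_le_mono order_bound_mono) auto
        finally show ?thesis by simp
      qed
    qed
    have ob: "(t + 1) * order_bound k t \<le> order_bound (Suc k) t" for t
      by (cases k) (simp_all add: order_bound_def)
    have "hgrow P t \<le> (M + C) * order_bound (Suc k) t" for t
    proof -
      have "M \<le> M * order_bound (Suc k) t" by (simp add: order_bound_def)
      moreover have "(t + 1) * (C * order_bound k t) \<le> C * order_bound (Suc k) t"
        using mult_le_mono2[OF ob[of t], of C] by (simp only: mult_ac)
      ultimately show ?thesis using bound[of t] unfolding distrib_right by linarith
    qed
    then show False using P(3) unfolding small_def by blast
  qed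
  moreover have "P \<subset> ?Q" using add_principal_hideal(2,3)[OF P(1) a(1)] a(3) by blast
  ultimately show ?thesis using add_principal_hideal(1)[OF P(1) a(1)] by blast
qed

text \<open>Each level of growth is traded for one prime: pass to a strictly larger ideal that is
  not small one level below, then to a prime above it.\<close>

lemma prime_chain:
  assumes "hideal P" "primeideal P R" "\<not> small k P"
  shows "\<exists>f. f 0 = P \<and> (\<forall>i\<le>k. primeideal (f i) R) \<and> (\<forall>i<k. f i \<subset> f (Suc i))"
  using assms
proof (induction k arbitrary: P)
  case 0
  then show ?case by (intro exI[of _ "\<lambda>_. P"]) simp
next
  case (Suc k)
  obtain Q where Q: "hideal Q" "P \<subset> Q" "\<not> small k Q" using larger_hideal[OF Suc.prems] by blast
  obtain P' where P': "hideal P'" "primeideal P' R" "Q \<subseteq> P'" "\<not> small k P'" using prime_above[OF Q(1,3)] by blast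
  obtain f where f: "f 0 = P'" "\<And>i. i \<le> k \<Longrightarrow> primeideal (f i) R" "\<And>i. i < k \<Longrightarrow> f i \<subset> f (Suc i)"
    using Suc.IH[OF P'(1,2,4)] by blast
  define g where "g = case_nat P f"
  have "primeideal (g i) R" if "i \<le> Suc k" for i
    using that f(2) Suc.prems(2) by (cases i) (auto simp: g_def)
  moreover have "g i \<subset> g (Suc i)" if "i < Suc k" for i
    using that f(1,3) Q(2) P'(3) by (cases i) (auto simp: g_def)
  ultimately show ?case by (intro exI[of _ g]) (simp add: g_def)
qed

text \<open>Faster growth would produce a chain of \<open>d + 1\<close> strict inclusions of primes,
  starting at the zero ideal, which is prime in a domain.\<close>

lemma dm_F_bound:
  assumes "krull_dim R = enat d"
  shows "\<exists>C. \<forall>t. dm (F t) \<le> C * (t + 1) ^ d"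
proof -
  have h0: "hideal {\<zero>}" unfolding hideal_def using zeroideal by simp
  have "small (Suc d) {\<zero>}"
  proof (rule ccontr)
    assume "\<not> small (Suc d) {\<zero>}"
    from prime_chain[OF h0 zeroprimeideal this]
    obtain f where "\<forall>i\<le>Suc d. primeideal (f i) R" "\<forall>i<Suc d. f i \<subset> f (Suc i)"
      by (elim exE conjE)
    then have "enat (Suc d) \<le> krull_dim R"
      unfolding krull_dim_def by (intro Sup_upper) blast
    then show False using assms by simp
  qed
  moreover have "hgrow {\<zero>} t = dm (F t)" for t
  proof -
    have "{\<zero>} \<inter> F t = {\<zero>}" using subspaceD(2)[OF F_subspace] by blast
    moreover have "dm {\<zero>} = 0" using dim_unique[OF zero_dim] .
    ultimately show ?thesis by (simp add: hgrow_def)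
  qed
  ultimately show ?thesis unfolding small_def order_bound_def by simp
qed

end

section \<open>Saturation\<close>

context std_graded_domain
begin

abbreviation mm :: "'a set" where "mm \<equiv> irrelevant R G"

lemma irrelevant_eq: "mm = {x \<in> carrier R. cmp x 0 = \<zero>}"
proof (intro equalityI subsetI)
  fix x assume "x \<in> mm"
  then obtain f n where f: "\<And>u. f u \<in> (if u = 0 then {\<zero>} else G u)" "x = finsum R f {..n}"
    unfolding irrelevant_def graded_sum_def by auto
  have fG: "f u \<in> G u" for u using f(1)[of u] G_zero by (auto split: if_splits)
  have "x \<in> {x \<in> carrier R. cmp x 0 = \<zero>}" unfolding f(2)
  proof (rule finsum_in)
    fix i
    have "f 0 = \<zero>" using f(1)[of 0] by simp
    then show "f i \<in> {x \<in> carrier R. cmp x 0 = \<zero>}"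
      using fG[of i] G_carrier[OF fG[of i]] by (cases "i = 0") (simp_all add: cmp_homogeneous)
  qed (auto simp: cmp_add)
  then show "x \<in> {x \<in> carrier R. cmp x 0 = \<zero>}" .
next
  fix x assume "x \<in> {x \<in> carrier R. cmp x 0 = \<zero>}"
  then have x: "x \<in> carrier R" "cmp x 0 = \<zero>" by auto
  obtain n where n: "x = finsum R (cmp x) {..n}" using decomposes_cmp[OF x(1)] unfolding decomposes_def by blast
  have "\<forall>u. cmp x u \<in> (if u = 0 then {\<zero>} else G u)" using x cmp_G[OF x(1)] by simp
  then show "x \<in> mm" using n unfolding irrelevant_def graded_sum_def by blast
qed

lemma cmp_mult_0: "a \<in> carrier R \<Longrightarrow> x \<in> carrier R \<Longrightarrow> cmp (a \<otimes> x) 0 = cmp a 0 \<otimes> cmp x 0"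
proof -
  assume a: "a \<in> carrier R" and x: "x \<in> carrier R"
  have "a \<in> {a \<in> carrier R. cmp (a \<otimes> x) 0 = cmp a 0 \<otimes> cmp x 0}"
  proof (rule in_if_cmps_in[OF _ _ _ a])
    fix i
    show "cmp a i \<in> {a \<in> carrier R. cmp (a \<otimes> x) 0 = cmp a 0 \<otimes> cmp x 0}"
      using a x cmp_mult[OF cmp_G[OF a, of i] x, of 0] cmp_homogeneous[OF cmp_G[OF a, of i], of 0]
      by (cases "i = 0") simp_all
  qed (use x in \<open>auto simp: l_distr cmp_add\<close>)
  then show ?thesis by blast
qed

lemma mm_hideal: "hideal mm"
proof -
  have "ideal mm R" unfolding irrelevant_eq
    by (rule idealI') (auto simp: cmp_add cmp_mult_0)
  moreover have "cmp x i \<in> mm" if "x \<in> mm" for x i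
    using that cmp_homogeneous[OF cmp_G[of x i], of 0] unfolding irrelevant_eq by (cases "i = 0") auto
  ultimately show ?thesis unfolding hideal_def by blast
qed

lemma mm_ideal: "ideal mm R"
  using mm_hideal unfolding hideal_def by blast

lemma mm_power_ideal: "ideal (ideal_power R mm j) R"
  by (rule ideal_power_ideal[OF mm_ideal])

lemma G_in_mm_power: "j \<le> l \<Longrightarrow> G l \<subseteq> ideal_power R mm j"
proof (induction j arbitrary: l)
  case 0
  then show ?case using G_carrier by auto
next
  case (Suc j)
  then obtain l' where l: "l = Suc l'" "j \<le> l'" by (cases l) auto
  have "G 1 \<subseteq> mm"
  proof
    fix x assume x: "x \<in> G 1"
    then show "x \<in> mm" unfolding irrelevant_eq using G_carrier[OF x] cmp_homogeneous[OF x, of 0] by simp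
  qed
  then have "ideal_prod R (G 1) (G l') \<subseteq> ideal_prod R mm (ideal_power R mm j)"
    using Suc.IH[OF l(2)] by (rule ideal_prod_mono)
  then show ?case
    using G_Suc[of l'] ideal_prod_commute[OF mm_ideal mm_power_ideal, of j] by (auto simp: l)
qed

lemma mm_power_antimono: "i \<le> j \<Longrightarrow> ideal_power R mm j \<subseteq> ideal_power R mm i"
  using ideal_power_add[OF mm_ideal, of i "j - i"] ideal_prod_inter[OF mm_power_ideal mm_power_ideal, of i "j - i"]
  by auto

abbreviation sat :: "'a set \<Rightarrow> 'a set" where
  "sat Q \<equiv> saturation R mm Q"

definition sat_upto :: "'a set \<Rightarrow> nat \<Rightarrow> 'a set" where
  "sat_upto Q j = {x \<in> carrier R. \<forall>y\<in>ideal_power R mm j. x \<otimes> y \<in> Q}"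

lemma sat_eq: "sat Q = (\<Union>j. sat_upto Q j)"
  unfolding saturation_def sat_upto_def by blast

lemma sat_upto_ideal:
  assumes "ideal Q R" shows "ideal (sat_upto Q j) R"
proof (rule idealI')
  note Q = subspaceD[OF ideal_subspace[OF assms]]
  note c = ideal.Icarr[OF mm_power_ideal, of _ j]
  show "\<zero> \<in> sat_upto Q j" using Q(2) c by (simp add: sat_upto_def)
  show "x \<oplus> y \<in> sat_upto Q j" if "x \<in> sat_upto Q j" "y \<in> sat_upto Q j" for x y
    using that Q(3) c by (simp add: sat_upto_def l_distr)
  show "a \<otimes> x \<in> sat_upto Q j" if "a \<in> carrier R" "x \<in> sat_upto Q j" for a x
    using that ideal_mult(1)[OF assms] c by (simp add: sat_upto_def m_assoc)
qed (auto simp: sat_upto_def)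

lemma sat_upto_mono: "i \<le> j \<Longrightarrow> sat_upto Q i \<subseteq> sat_upto Q j"
  using mm_power_antimono unfolding sat_upto_def by blast

text \<open>By the ascending chain condition one power of the maximal ideal works for all elements
  of the saturation.\<close>

lemma sat_upto_stabilizes:
  assumes "ideal Q R" shows "\<exists>j. sat Q = sat_upto Q j"
proof -
  have "\<exists>N. \<forall>n\<ge>N. sat_upto Q n = sat_upto Q N"
    by (rule ideal_chain_stabilizes[OF sat_upto_ideal[OF assms] sat_upto_mono]) simp
  then obtain N where N: "\<forall>n\<ge>N. sat_upto Q n = sat_upto Q N" by (elim exE)
  have "sat_upto Q j \<subseteq> sat_upto Q N" for j
    using sat_upto_mono[of j "max j N" Q] N[rule_format, of "max j N"] by simp
  then show ?thesis unfolding sat_eq by blast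
qed

lemma sat_hideal:
  assumes "hideal Q" shows "hideal (sat Q)"
proof -
  have I: "ideal Q R" using assms unfolding hideal_def by blast
  note QS = subspaceD[OF ideal_subspace[OF I]]
  have "cmp x i \<in> sat_upto Q j" if x: "x \<in> sat_upto Q j" for x i j
  proof -
    have xc: "x \<in> carrier R" using x by (simp add: sat_upto_def)
    have "cmp x i \<otimes> y \<in> Q" if y: "y \<in> ideal_power R mm j" for y
    proof -
      have yc: "y \<in> carrier R" using ideal.Icarr[OF mm_power_ideal y] .
      have "y \<in> {y \<in> carrier R. cmp x i \<otimes> y \<in> Q}"
      proof (rule in_if_cmps_in[OF _ _ _ yc])
        fix l
        have "cmp y l \<in> ideal_power R mm j" using hideal_power[OF mm_hideal] y unfolding hideal_def by blast
        then have "x \<otimes> cmp y l \<in> Q" using x by (simp add: sat_upto_def)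
        then have "cmp y l \<otimes> x \<in> Q" using yc m_comm[OF xc, of "cmp y l"] by simp
        then have "cmp (cmp y l \<otimes> x) (l + i) \<in> Q" using assms unfolding hideal_def by blast
        then show "cmp y l \<in> {y \<in> carrier R. cmp x i \<otimes> y \<in> Q}"
          using xc yc m_comm[of "cmp x i" "cmp y l"] by (simp add: cmp_mult[OF cmp_G[OF yc] xc])
      qed (use xc QS in \<open>auto simp: r_distr\<close>)
      then show ?thesis by blast
    qed
    then show ?thesis using xc by (simp add: sat_upto_def)
  qed
  moreover obtain j where "sat Q = sat_upto Q j" using sat_upto_stabilizes[OF I] by blast
  ultimately show ?thesis using sat_upto_ideal[OF I] unfolding hideal_def by metis
qed

lemma sat_superset: "ideal Q R \<Longrightarrow> Q \<subseteq> sat Q"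
  using ideal_mult(2)[of Q] ideal.Icarr[of Q R] unfolding sat_eq sat_upto_def by (auto intro!: exI[of _ 0])

lemma sat_mult:
  assumes A: "ideal A R" and B: "ideal B R" and x: "x \<in> sat A" and y: "y \<in> sat B"
  shows "x \<otimes> y \<in> sat (ideal_prod R A B)"
proof -
  obtain i j where i: "x \<in> sat_upto A i" and j: "y \<in> sat_upto B j" using x y unfolding sat_eq by blast
  have c: "x \<in> carrier R" "y \<in> carrier R" using i j by (simp_all add: sat_upto_def)
  note P = subspaceD[OF ideal_subspace[OF ideal_prod_is_ideal[OF A B]]]
  have "x \<otimes> y \<otimes> z \<in> ideal_prod R A B" if "z \<in> ideal_prod R (ideal_power R mm i) (ideal_power R mm j)" for z
    using that
  proof (induction rule: ideal_prod.induct)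
    case (prod p q)
    then have "p \<in> carrier R" "q \<in> carrier R" using ideal.Icarr[OF mm_power_ideal] by blast+
    then have "x \<otimes> y \<otimes> (p \<otimes> q) = (x \<otimes> p) \<otimes> (y \<otimes> q)" using c by (simp add: m_ac)
    then show ?case using i j prod by (auto simp: sat_upto_def intro: ideal_prod.prod)
  next
    case (sum p q)
    then have "p \<in> carrier R" "q \<in> carrier R"
      using ideal.Icarr[OF ideal_prod_is_ideal[OF mm_power_ideal mm_power_ideal]] by blast+
    then show ?case using sum P(3) c by (simp add: r_distr)
  qed
  then have "x \<otimes> y \<in> sat_upto (ideal_prod R A B) (i + j)"
    using c unfolding ideal_power_add[OF mm_ideal] by (simp add: sat_upto_def)
  then show ?thesis unfolding sat_eq by blast
qed

text \<open>The ideals generated by the parts in degrees up to \<open>g\<close> form an ascending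
  chain; where it stops, every component is contained.\<close>

lemma hideal_gen:
  assumes Q: "hideal Q" shows "\<exists>g. gen Q g"
proof -
  have I: "ideal Q R" using Q unfolding hideal_def by blast
  define E where "E = (\<lambda>g. Idl (Q \<inter> (\<Union>u\<le>g. G u)))"
  have c: "Q \<inter> (\<Union>u\<le>g. G u) \<subseteq> carrier R" for g using G_carrier by auto
  have mono: "E i \<subseteq> E j" if "i \<le> j" for i j
  proof -
    have "Q \<inter> (\<Union>u\<le>i. G u) \<subseteq> Q \<inter> (\<Union>u\<le>j. G u)" using that by (intro Int_mono UN_mono) auto
    then show ?thesis unfolding E_def
      by (intro genideal_minimal[OF genideal_ideal[OF c]] order_trans[OF _ genideal_self[OF c]])
  qed
  have "ideal (E g) R" for g unfolding E_def by (rule genideal_ideal[OF c])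
  then have "\<exists>N. \<forall>n\<ge>N. E n = E N" by (rule ideal_chain_stabilizes[OF _ mono]) simp_all
  then obtain N where N: "\<forall>n\<ge>N. E n = E N" by (elim exE)
  have "E N = Q"
  proof
    show "E N \<subseteq> Q" unfolding E_def by (rule genideal_minimal[OF I]) blast
    note ES = subspaceD[OF ideal_subspace[OF genideal_ideal[OF c[of N]]]]
    show "Q \<subseteq> E N"
    proof
      fix x assume x: "x \<in> Q"
      then have xc: "x \<in> carrier R" using ideal.Icarr[OF I] by blast
      show "x \<in> E N"
      proof (rule in_if_cmps_in[OF _ _ _ xc])
        fix i
        have "cmp x i \<in> Q \<inter> (\<Union>u\<le>max i N. G u)"
          using Q x cmp_G[OF xc, of i] unfolding hideal_def by auto
        then have "cmp x i \<in> E (max i N)" unfolding E_def using genideal_self[OF c] by blast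
        then show "cmp x i \<in> E N" using N[rule_format, of "max i N"] by simp
      qed (use ES in \<open>auto simp: E_def\<close>)
    qed
  qed
  then show ?thesis unfolding gen_def generated_in_degrees_le_def E_def by blast
qed

text \<open>Let \<open>sat Q\<close> be generated in degrees up to \<open>g\<close> and be carried
  into \<open>Q\<close> by the power \<open>j\<close> of the maximal ideal. In degrees from
  \<open>g + j\<close> on, the multipliers of the generators have degree at least \<open>j\<close>
  and hence lie in that power.\<close>

lemma sat_eventually:
  assumes Q: "hideal Q" shows "\<exists>t0. \<forall>t\<ge>t0. sat Q \<inter> G t \<subseteq> Q"
proof -
  have I: "ideal Q R" using Q unfolding hideal_def by blast
  obtain j where j: "sat Q = sat_upto Q j" using sat_upto_stabilizes[OF I] by blast
  obtain g where g: "gen (sat Q) g" using hideal_gen[OF sat_hideal[OF Q]] by blast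
  have "sat Q \<subseteq> cmps_in {g + j..} Q"
  proof (rule gen_min[OF g cmps_in_ideal[OF ideal_subspace[OF I]]])
    fix a w assume a: "a \<le> g" and w: "w \<in> sat Q" "w \<in> G a"
    show "w \<in> cmps_in {g + j..} Q"
    proof (rule cmps_in_homogeneousI[OF w(2) ideal_subspace[OF I]])
      fix i r assume "i + a \<in> {g + j..}" and r: "r \<in> G i"
      then have "j \<le> i" using a by simp
      then have "r \<in> ideal_power R mm j" using G_in_mm_power r by blast
      then show "w \<otimes> r \<in> Q" using w(1) unfolding j by (simp add: sat_upto_def)
    qed
  qed
  have "x \<in> Q" if "t \<ge> g + j" "x \<in> sat Q" "x \<in> G t" for x t
  proof -
    have "x \<in> cmps_in {g + j..} Q" using \<open>sat Q \<subseteq> cmps_in {g + j..} Q\<close> that(2) by blast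
    then have "cmp (\<one> \<otimes> x) t \<in> Q" using one_closed that(1) unfolding cmps_in_def by blast
    then show "x \<in> Q" using cmp_homogeneous[OF that(3), of t] G_carrier[OF that(3)] by simp
  qed
  then show ?thesis by blast
qed

section \<open>Length and dimension\<close>

text \<open>Chains of submodules may pass through inhomogeneous ideals. A strict inclusion between
  \<open>A\<close> and \<open>A'\<close> is still visible up to degree \<open>t\<close>, because the
  components above \<open>t\<close> of an element of \<open>A'\<close> lie in \<open>A\<close> and
  can be removed.\<close>

lemma Int_F_psubset:
  assumes A: "hideal A" and I: "ideal N R" "ideal N' R" and sub: "A \<subseteq> N" "N \<subset> N'" "N' \<subseteq> A'" and A': "hideal A'"
    and ev: "\<And>i. i > t \<Longrightarrow> A' \<inter> G i \<subseteq> A"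
  shows "dm (N \<inter> F t) < dm (N' \<inter> F t)"
proof -
  have AI: "ideal A R" using A unfolding hideal_def by blast
  obtain x where x: "x \<in> N'" "x \<notin> N" using sub by blast
  have xc: "x \<in> carrier R" using x ideal.Icarr[OF I(2)] by blast
  have "cmp x i \<in> A" if "i > t" for i
    using ev[OF that] cmp_G[OF xc, of i] A' x(1) sub(3) unfolding hideal_def by blast
  then obtain y where y: "y \<in> F t" "x \<ominus> y \<in> A" using truncate_mod_ideal[OF AI xc] by blast
  have yc: "y \<in> carrier R" using y F_carrier by blast
  note N = subspaceD[OF ideal_subspace[OF I(1)]] and N' = subspaceD[OF ideal_subspace[OF I(2)]]
  have eq2: "x = y \<oplus> (x \<ominus> y)" using add_minus_cancel[OF xc yc] by simp
  have "(y \<oplus> (x \<ominus> y)) \<ominus> (x \<ominus> y) = y" using xc yc by (simp add: a_minus_def a_assoc r_neg)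
  then have eq: "y = x \<ominus> (x \<ominus> y)" "x = y \<oplus> (x \<ominus> y)" using eq2 by simp_all
  have "x \<ominus> y \<in> N" "x \<ominus> y \<in> N'" using y(2) sub by blast+
  have "y \<in> N'" by (subst eq(1)) (rule N'(6)[OF x(1) \<open>x \<ominus> y \<in> N'\<close>])
  moreover have "y \<notin> N"
  proof
    assume "y \<in> N"
    then have "y \<oplus> (x \<ominus> y) \<in> N" using N(3) \<open>x \<ominus> y \<in> N\<close> by blast
    then show False using eq(2) x(2) by simp
  qed
  ultimately have "N \<inter> F t \<noteq> N' \<inter> F t" "N \<inter> F t \<subseteq> N' \<inter> F t" using y(1) sub by blast+
  then show ?thesis
    using dm_mono[OF Int_F_finite_dimension[OF I(2)] Int_F_subspace[OF I(1)], of t t] by linarith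
qed

text \<open>Choose a homogeneous \<open>x\<close> in \<open>A'\<close> outside \<open>Q\<close> of
  the largest possible degree, which is at most \<open>t\<close>. Its multiples by elements of
  positive degree lie in \<open>Q\<close>, so adjoining the line through \<open>x\<close> already
  gives an ideal.\<close>

lemma enlarge_by_line:
  assumes A: "hideal A" and A': "hideal A'" and Q: "hideal Q" "A \<subseteq> Q" "Q \<subset> A'"
    and ev: "\<And>i. i > t \<Longrightarrow> A' \<inter> G i \<subseteq> A"
  shows "\<exists>Q'. hideal Q' \<and> Q \<subset> Q' \<and> Q' \<subseteq> A' \<and> dm (Q' \<inter> F t) = Suc (dm (Q \<inter> F t))"
proof -
  have I: "ideal Q R" "ideal A' R" using Q A' unfolding hideal_def by blast+
  note QS = subspaceD[OF ideal_subspace[OF I(1)]] and AS = subspaceD[OF ideal_subspace[OF I(2)]]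
  let ?S = "{s. \<exists>x\<in>A' \<inter> G s. x \<notin> Q}"
  obtain y where y: "y \<in> A'" "y \<notin> Q" using Q by blast
  have yc: "y \<in> carrier R" using y AS(1) by blast
  obtain i where "cmp y i \<notin> Q" using in_if_cmps_in[of Q y] QS yc y by blast
  then have "i \<in> ?S" using y(1) A' cmp_G[OF yc] unfolding hideal_def by blast
  then have ne: "?S \<noteq> {}" by blast
  have "?S \<subseteq> {..t}" using ev Q(2) by (auto simp: not_le[symmetric])
  then have fin: "finite ?S" by (rule finite_subset) simp
  define s where "s = Max ?S"
  have "s \<in> ?S" unfolding s_def using fin ne by (rule Max_in)
  then obtain x where x: "x \<in> A'" "x \<in> G s" "x \<notin> Q" by blast
  have st: "s \<le> t" using \<open>s \<in> ?S\<close> \<open>?S \<subseteq> {..t}\<close> by blast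
  have above: "z \<in> Q" if "z \<in> A'" "z \<in> G i" "i > s" for z i
    using Max_ge[OF fin, of i] that unfolding s_def by force
  have xc: "x \<in> carrier R" using x G_carrier by blast
  let ?L = "line_extension (G 0) x Q"
  have L: "subspace ?L"
    using spn_subspace[of "insert x Q"] spn_insert[OF QS(1) xc] spn_of_subspace[OF ideal_subspace[OF I(1)]] QS(1) xc
    by simp
  note LS = subspaceD[OF L]
  have QL: "Q \<subseteq> ?L"
  proof
    fix q assume q: "q \<in> Q"
    then have "q = \<zero> \<otimes> x \<oplus> q" using QS(1) xc by auto
    then show "q \<in> ?L" unfolding line_extension_mem_iff using q K_props(2) by blast
  qed
  have kL: "k \<otimes> x \<in> ?L" if "k \<in> G 0" for k
  proof -
    have "k \<otimes> x = k \<otimes> x \<oplus> \<zero>" using K_carrier[OF that] xc by simp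
    then show ?thesis unfolding line_extension_mem_iff using that QS(2) by blast
  qed
  have ax: "a \<otimes> x \<in> ?L" if a: "a \<in> carrier R" for a
  proof -
    have "a \<in> {a \<in> carrier R. a \<otimes> x \<in> ?L}"
    proof (rule in_if_cmps_in[OF _ _ _ a])
      fix i
      show "cmp a i \<in> {a \<in> carrier R. a \<otimes> x \<in> ?L}"
      proof (cases "i = 0")
        case True
        then show ?thesis using kL[OF cmp_G[OF a, of 0]] a by simp
      next
        case False
        have "cmp a i \<otimes> x \<in> Q"
          using above[OF ideal_mult(1)[OF I(2) cmp_carrier[OF a] x(1)] G_mult[OF cmp_G[OF a] x(2)]] False by simp
        then show ?thesis using QL a by auto
      qed
    qed (use LS xc in \<open>auto simp: l_distr\<close>)
    then show ?thesis by blast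
  qed
  have "ideal ?L R"
  proof (rule idealI'[OF LS(1-3)])
    fix a z assume a: "a \<in> carrier R" and "z \<in> ?L"
    then obtain k q where *: "k \<in> G 0" "q \<in> Q" "z = k \<otimes> x \<oplus> q" unfolding line_extension_mem_iff by blast
    have c: "k \<in> carrier R" "q \<in> carrier R" using * K_carrier QS(1) by auto
    then have "a \<otimes> z = (a \<otimes> k) \<otimes> x \<oplus> a \<otimes> q" using * a xc by (simp add: r_distr m_assoc)
    then show "a \<otimes> z \<in> ?L" using LS(3) ax[of "a \<otimes> k"] a c QL ideal_mult(1)[OF I(1) a *(2)] by auto
  qed
  moreover have "cmp z i \<in> ?L" if "z \<in> ?L" for z i
  proof -
    obtain k q where *: "k \<in> G 0" "q \<in> Q" "z = k \<otimes> x \<oplus> q" using \<open>z \<in> ?L\<close> unfolding line_extension_mem_iff by blast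
    have c: "k \<in> carrier R" "q \<in> carrier R" using * K_carrier QS(1) by auto
    have "cmp q i \<in> Q" using Q(1) *(2) unfolding hideal_def by blast
    moreover have "cmp (k \<otimes> x) i \<in> ?L"
      using kL[OF *(1)] LS(2) cmp_homogeneous[OF G_smult[OF *(1) x(2)], of i] by simp
    ultimately show ?thesis using LS(3) QL c xc by (auto simp: * cmp_add)
  qed
  ultimately have hL: "hideal ?L" unfolding hideal_def by blast
  have "x \<in> ?L" using kL[OF G_one] xc by simp
  then have "Q \<subset> ?L" using QL x(3) by blast
  moreover have "?L \<subseteq> A'"
    using AS(3,4) x(1) psubset_imp_subset[OF Q(3), THEN subsetD] by (auto simp: line_extension_mem_iff)
  moreover have "?L \<inter> F t = line_extension (G 0) x (Q \<inter> F t)"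
  proof (intro equalityI subsetI)
    note FS = subspaceD[OF F_subspace[of t]]
    have xF: "x \<in> F t" using G_subset_F[OF st] x(2) by blast
    fix z assume z: "z \<in> ?L \<inter> F t"
    then obtain k q where *: "k \<in> G 0" "q \<in> Q" "z = k \<otimes> x \<oplus> q" unfolding Int_iff line_extension_mem_iff by blast
    have c: "k \<in> carrier R" "q \<in> carrier R" using * K_carrier QS(1) by auto
    have "q = z \<ominus> k \<otimes> x" using * c xc by (simp add: a_minus_def a_ac r_neg r_neg1)
    then have "q \<in> F t" using FS(6) FS(4)[OF *(1) xF] z by auto
    then show "z \<in> line_extension (G 0) x (Q \<inter> F t)" unfolding line_extension_mem_iff using * by blast
  next
    note FS = subspaceD[OF F_subspace[of t]]
    have xF: "x \<in> F t" using G_subset_F[OF st] x(2) by blast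
    fix z assume "z \<in> line_extension (G 0) x (Q \<inter> F t)"
    then show "z \<in> ?L \<inter> F t" unfolding Int_iff line_extension_mem_iff using FS(3) FS(4)[OF _ xF] by auto
  qed
  moreover have "dimension (Suc (dm (Q \<inter> F t))) (G 0) (line_extension (G 0) x (Q \<inter> F t))"
    using x(3) by (intro Suc_dim xc finite_dimensionE[OF subfield Int_F_finite_dimension[OF I(1)]]) auto
  ultimately show ?thesis using hL dim_unique by metis
qed

text \<open>The strict growth of the dimension bounds the length of every chain, and adjoining one
  line at a time attains the bound.\<close>

lemma ideal_chain_length:
  assumes A: "hideal A" and A': "hideal A'" and AA': "A \<subseteq> A'" and ev: "\<And>i. i > t \<Longrightarrow> A' \<inter> G i \<subseteq> A"
  shows "(\<exists>N. (\<forall>i\<le>l. ideal (N i) R \<and> A \<subseteq> N i \<and> N i \<subseteq> A') \<and> (\<forall>i<l. N i \<subset> N (Suc i)))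
    \<longleftrightarrow> l \<le> dm (A' \<inter> F t) - dm (A \<inter> F t)"
proof
  have I: "ideal A R" "ideal A' R" using A A' unfolding hideal_def by blast+
  assume "\<exists>N. (\<forall>i\<le>l. ideal (N i) R \<and> A \<subseteq> N i \<and> N i \<subseteq> A') \<and> (\<forall>i<l. N i \<subset> N (Suc i))"
  then obtain N where N: "\<And>i. i \<le> l \<Longrightarrow> ideal (N i) R" "\<And>i. i \<le> l \<Longrightarrow> A \<subseteq> N i" "\<And>i. i \<le> l \<Longrightarrow> N i \<subseteq> A'"
    "\<And>i. i < l \<Longrightarrow> N i \<subset> N (Suc i)" by blast
  have "i \<le> l \<Longrightarrow> dm (A \<inter> F t) + i \<le> dm (N i \<inter> F t)" for i
  proof (induction i)
    case 0
    then show ?case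
      using dm_mono(1)[OF Int_F_finite_dimension[OF N(1)] Int_F_subspace[OF I(1)], of 0 t t] N(2)[of 0] by auto
  next
    case (Suc i)
    have "dm (N i \<inter> F t) < dm (N (Suc i) \<inter> F t)"
      using Suc.prems by (intro Int_F_psubset[OF A N(1) N(1) N(2) N(4) N(3) A' ev]) auto
    then show ?case using Suc by simp
  qed
  moreover have "dm (N l \<inter> F t) \<le> dm (A' \<inter> F t)"
    using dm_mono(1)[OF Int_F_finite_dimension[OF I(2)] Int_F_subspace[OF N(1)], of l t t] N(3)[of l] by auto
  ultimately show "l \<le> dm (A' \<inter> F t) - dm (A \<inter> F t)" by force
next
  assume "l \<le> dm (A' \<inter> F t) - dm (A \<inter> F t)"
  then have "\<exists>N. (\<forall>i\<le>l. hideal (N i) \<and> A \<subseteq> N i \<and> N i \<subseteq> A' \<and> dm (N i \<inter> F t) = dm (A \<inter> F t) + i) \<and> (\<forall>i<l. N i \<subset> N (Suc i))"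
  proof (induction l)
    case 0
    show ?case using A AA' by (intro exI[of _ "\<lambda>_. A"]) simp
  next
    case (Suc l)
    then obtain N where N: "\<And>i. i \<le> l \<Longrightarrow> hideal (N i) \<and> A \<subseteq> N i \<and> N i \<subseteq> A' \<and> dm (N i \<inter> F t) = dm (A \<inter> F t) + i"
      "\<And>i. i < l \<Longrightarrow> N i \<subset> N (Suc i)" by auto
    have "dm (N l \<inter> F t) < dm (A' \<inter> F t)" using N(1)[of l] Suc.prems by simp
    then have "N l \<noteq> A'" by auto
    then have "N l \<subset> A'" using N(1)[of l] by auto
    then have "\<exists>Q'. hideal Q' \<and> N l \<subset> Q' \<and> Q' \<subseteq> A' \<and> dm (Q' \<inter> F t) = Suc (dm (N l \<inter> F t))"
      using N(1)[of l] by (intro enlarge_by_line[OF A A' _ _ _ ev]) simp_all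
    then obtain Q' where Q': "hideal Q'" "N l \<subset> Q'" "Q' \<subseteq> A'" "dm (Q' \<inter> F t) = Suc (dm (N l \<inter> F t))"
      by (elim exE conjE)
    define N' where "N' = N(Suc l := Q')"
    have "hideal (N' i) \<and> A \<subseteq> N' i \<and> N' i \<subseteq> A' \<and> dm (N' i \<inter> F t) = dm (A \<inter> F t) + i" if "i \<le> Suc l" for i
      using that N(1)[of i] N(1)[of l] Q' by (cases "i = Suc l") (auto simp: N'_def)
    moreover have "N' i \<subset> N' (Suc i)" if "i < Suc l" for i
      using that N(2)[of i] Q'(2) by (cases "i = l") (auto simp: N'_def)
    ultimately show ?case by (intro exI[of _ N'] conjI allI impI) simp_all
  qed
  then obtain N where "\<forall>i\<le>l. hideal (N i) \<and> A \<subseteq> N i \<and> N i \<subseteq> A' \<and> dm (N i \<inter> F t) = dm (A \<inter> F t) + i"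
    "\<forall>i<l. N i \<subset> N (Suc i)" by (elim exE conjE)
  then show "\<exists>N. (\<forall>i\<le>l. ideal (N i) R \<and> A \<subseteq> N i \<and> N i \<subseteq> A') \<and> (\<forall>i<l. N i \<subset> N (Suc i))"
    unfolding hideal_def by (intro exI[of _ N] conjI) simp_all
qed

end

context std_graded_domain
begin

section \<open>Local cohomology as a quotient of the saturation\<close>

lemma Sup_enat_atMost: "Sup {enat l | l. l \<le> L} = enat L"
  by (rule antisym) (auto intro!: Sup_least Sup_upper)

text \<open>The cosets killed by a power of the maximal ideal form \<open>sat Q / Q\<close>, so the
  submodules correspond to the ideals between \<open>Q\<close> and \<open>sat Q\<close>, whose
  chains have been measured.\<close>

lemma module_length_sat_quotient:
  assumes Q: "hideal Q" and ev: "\<And>i. i > t \<Longrightarrow> sat Q \<inter> G i \<subseteq> Q"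
  shows "module_length R (local_cohomology_0 R mm (quot_module R Q)) = enat (dm (sat Q \<inter> F t) - dm (Q \<inter> F t))"
proof -
  have I: "ideal Q R" using Q unfolding hideal_def by blast
  have zero_R: "\<zero> \<in> carrier R" by simp
  interpret ideal Q R by fact
  let ?M = "local_cohomology_0 R mm (quot_module R Q)"
  define c where "c = (\<lambda>x. Q +> x)"
  have SI: "ideal (sat Q) R" using sat_hideal[OF Q] unfolding hideal_def by blast
  note SS = subspaceD[OF ideal_subspace[OF SI]] and QS = subspaceD[OF ideal_subspace[OF I]]
  have Sc: "x \<in> carrier R" if "x \<in> sat Q" for x using SS(1) that by blast
  have c_eq: "c a = c b \<longleftrightarrow> a \<ominus> b \<in> Q" if "a \<in> carrier R" "b \<in> carrier R" for a b
    using quotient_eq_iff_same_a_r_cos[OF I that] by (simp add: c_def)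
  have c0: "c \<zero> = Q" unfolding c_def by (rule a_coset_add_zero[OF QS(1)])
  have c_Q: "c a = Q \<longleftrightarrow> a \<in> Q" if "a \<in> carrier R" for a
    using c_eq[OF that zero_R] that unfolding c0 by (simp add: a_minus_def)
  have c_add: "c a <+> c b = c (a \<oplus> b)" if "a \<in> carrier R" "b \<in> carrier R" for a b
    unfolding c_def by (rule a_rcos_sum[OF that])
  have smult: "a \<odot>\<^bsub>?M\<^esub> c b = c (a \<otimes> b)" if "a \<in> carrier R" "b \<in> carrier R" for a b
    using rcoset_mult_add[OF that] by (simp add: c_def local_cohomology_0_def quot_module_def FactRing_def)
  have smult': "a \<odot>\<^bsub>quot_module R Q\<^esub> c b = c (a \<otimes> b)" if "a \<in> carrier R" "b \<in> carrier R" for a b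
    using rcoset_mult_add[OF that] by (simp add: c_def quot_module_def FactRing_def)
  have add_M: "x \<oplus>\<^bsub>?M\<^esub> y = x <+> y" "\<zero>\<^bsub>?M\<^esub> = Q" for x y
    by (simp_all add: local_cohomology_0_def quot_module_def)
  have zero_q: "\<zero>\<^bsub>quot_module R Q\<^esub> = Q" "carrier (quot_module R Q) = c ` carrier R"
    by (auto simp: quot_module_def c_def A_RCOSETS_def')
  have carrier_M: "carrier ?M = c ` sat Q"
  proof (intro equalityI subsetI)
    fix C assume "C \<in> carrier ?M"
    then obtain x j where x: "x \<in> carrier R" "C = c x" and j: "\<forall>a\<in>ideal_power R mm j. a \<odot>\<^bsub>quot_module R Q\<^esub> C = Q"
      using zero_q by (auto simp: local_cohomology_0_def)
    have "x \<otimes> a \<in> Q" if "a \<in> ideal_power R mm j" for a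
    proof -
      have ac: "a \<in> carrier R" using ideal.Icarr[OF mm_power_ideal that] .
      have "c (a \<otimes> x) = Q" using j that smult'[OF ac x(1)] x(2) by simp
      then show ?thesis using c_Q[of "a \<otimes> x"] ac x(1) m_comm[OF x(1) ac] by simp
    qed
    then show "C \<in> c ` sat Q" using x unfolding saturation_def by blast
  next
    fix C assume "C \<in> c ` sat Q"
    then obtain x where x: "x \<in> sat Q" "C = c x" by blast
    obtain j where j: "\<And>a. a \<in> ideal_power R mm j \<Longrightarrow> x \<otimes> a \<in> Q" using x(1) unfolding saturation_def by blast
    have xc: "x \<in> carrier R" by (rule Sc[OF x(1)])
    have "a \<odot>\<^bsub>quot_module R Q\<^esub> C = Q" if "a \<in> ideal_power R mm j" for a
    proof -
      have ac: "a \<in> carrier R" using ideal.Icarr[OF mm_power_ideal that] .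
      have "a \<otimes> x \<in> Q" using j[OF that] m_comm[OF xc ac] by simp
      then show ?thesis using smult'[OF ac xc] c_Q[of "a \<otimes> x"] ac xc x(2) by simp
    qed
    then show "C \<in> carrier ?M" using zero_q xc x(2) by (auto simp: local_cohomology_0_def)
  qed
  define N where "N = (\<lambda>H. {x \<in> carrier R. c x \<in> H})"
  have sub_to_ideal: "ideal (N H) R \<and> Q \<subseteq> N H \<and> N H \<subseteq> sat Q \<and> H = c ` N H" if H: "submodule H R ?M" for H
  proof -
    interpret H: submodule H R ?M by fact
    have QH: "Q \<in> H" using H.one_closed add_M(2) by simp
    have addH: "C <+> D \<in> H" if "C \<in> H" "D \<in> H" for C D using H.m_closed[OF that] add_M(1) by simp
    have Hc: "H \<subseteq> c ` sat Q" using H.subset carrier_M by simp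
    have "ideal (N H) R"
    proof (rule idealI')
      show "\<zero> \<in> N H" using QH c0 by (simp add: N_def)
      show "x \<oplus> y \<in> N H" if "x \<in> N H" "y \<in> N H" for x y
        using addH[of "c x" "c y"] that c_add[of x y] by (simp add: N_def)
      show "a \<otimes> x \<in> N H" if "a \<in> carrier R" "x \<in> N H" for a x
      proof -
        have x: "c x \<in> H" "x \<in> carrier R" using that(2) by (simp_all add: N_def)
        show ?thesis using H.smult_closed[OF that(1) x(1)] smult[OF that(1) x(2)] that(1) x(2) by (simp add: N_def)
      qed
    qed (auto simp: N_def)
    moreover have "Q \<subseteq> N H"
      using QH c_Q QS(1) by (auto simp: N_def)
    moreover have "N H \<subseteq> sat Q"
    proof
      fix x assume "x \<in> N H"
      then have x: "x \<in> carrier R" "c x \<in> H" by (auto simp: N_def)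
      then obtain y where y: "y \<in> sat Q" "c x = c y" using Hc by blast
      then have "x \<ominus> y \<in> sat Q" using c_eq[OF x(1) Sc[OF y(1)]] sat_superset[OF I] by blast
      then have "y \<oplus> (x \<ominus> y) \<in> sat Q" using SS(3) y(1) by blast
      then show "x \<in> sat Q" using add_minus_cancel[OF x(1) Sc[OF y(1)]] by simp
    qed
    moreover have "H = c ` N H"
      using Hc Sc by (auto simp: N_def)
    ultimately show ?thesis by blast
  qed
  have ideal_to_sub: "submodule (c ` A) R ?M" if A: "ideal A R" "Q \<subseteq> A" "A \<subseteq> sat Q" for A
  proof -
    note AS = subspaceD[OF ideal_subspace[OF A(1)]]
    have Ac: "x \<in> carrier R" if "x \<in> A" for x using AS(1) that by blast
    show ?thesis
    proof (intro submodule.intro subgroup.intro submodule_axioms.intro)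
      show "c ` A \<subseteq> carrier (add_monoid ?M)" using carrier_M A(3) by auto
      show "\<one>\<^bsub>add_monoid ?M\<^esub> \<in> c ` A" using add_M(2) c0 AS(2) by (auto intro!: image_eqI[of _ _ \<zero>])
      show "x \<otimes>\<^bsub>add_monoid ?M\<^esub> y \<in> c ` A" if xy: "x \<in> c ` A" "y \<in> c ` A" for x y
      proof -
        obtain a b where "a \<in> A" "b \<in> A" "x = c a" "y = c b" using xy by blast
        then show ?thesis using add_M(1) c_add[OF Ac Ac, of a b] AS(3) by simp
      qed
      show "a \<odot>\<^bsub>?M\<^esub> x \<in> c ` A" if a: "a \<in> carrier R" and x: "x \<in> c ` A" for a x
      proof -
        obtain b where "b \<in> A" "x = c b" using x by blast
        then show ?thesis using smult[OF a Ac, of b] ideal_mult(1)[OF A(1) a] by simp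
      qed
      show "inv\<^bsub>add_monoid ?M\<^esub> x \<in> c ` A" if x: "x \<in> c ` A" for x
      proof -
        obtain a where a: "a \<in> A" "x = c a" using x by blast
        have ac: "a \<in> carrier R" "\<ominus> a \<in> carrier R" "\<ominus> a \<in> A" using Ac[OF a(1)] AS(5)[OF a(1)] by auto
        have "inv\<^bsub>add_monoid ?M\<^esub> x = c (\<ominus> a)"
          \<comment> \<open>The inverse is identified from its definition, as the only coset of the
            module whose sum with \<open>x\<close> is the zero coset \<open>Q\<close>.\<close>
          unfolding m_inv_def
        proof (rule the_equality)
          have "c a <+> c (\<ominus> a) = Q" "c (\<ominus> a) <+> c a = Q"
            using c_add[OF ac(1,2)] c_add[OF ac(2,1)] c0 ac by (simp_all add: r_neg l_neg)
          then show "c (\<ominus> a) \<in> carrier (add_monoid ?M) \<and> x \<otimes>\<^bsub>add_monoid ?M\<^esub> c (\<ominus> a) = \<one>\<^bsub>add_monoid ?M\<^esub> \<and>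
            c (\<ominus> a) \<otimes>\<^bsub>add_monoid ?M\<^esub> x = \<one>\<^bsub>add_monoid ?M\<^esub>"
            using a(2) carrier_M A(3) ac(3) add_M by auto
        next
          fix y assume y: "y \<in> carrier (add_monoid ?M) \<and> x \<otimes>\<^bsub>add_monoid ?M\<^esub> y = \<one>\<^bsub>add_monoid ?M\<^esub> \<and>
            y \<otimes>\<^bsub>add_monoid ?M\<^esub> x = \<one>\<^bsub>add_monoid ?M\<^esub>"
          then obtain b where b: "b \<in> sat Q" "y = c b" using carrier_M by auto
          have bc: "b \<in> carrier R" by (rule Sc[OF b(1)])
          have "c (a \<oplus> b) = Q" using y add_M c_add[OF ac(1) bc] a(2) b(2) by simp
          then have "a \<oplus> b \<in> Q" using c_Q ac bc by simp
          then have "b \<ominus> \<ominus> a \<in> Q" using ac bc by (simp add: a_minus_def a_comm)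
          then show "y = c (\<ominus> a)" using c_eq[OF bc ac(2)] b(2) by simp
        qed
        then show ?thesis using ac(3) by simp
      qed
    qed
  qed
  have c_strict: "A \<subset> B" if "ideal A R" "Q \<subseteq> A" "A \<subseteq> B" "c ` A \<noteq> c ` B" for A B using that by blast
  have c_strict': "c ` A \<noteq> c ` B" if A: "ideal A R" "Q \<subseteq> A" "A \<subset> B" "B \<subseteq> sat Q" for A B
  proof
    assume eq: "c ` A = c ` B"
    obtain b where b: "b \<in> B" "b \<notin> A" using A(3) by blast
    then obtain a where a: "a \<in> A" "c b = c a" using eq by blast
    have ac: "a \<in> carrier R" "b \<in> carrier R" using a(1) b(1) ideal.Icarr[OF A(1)] Sc A(4) by auto
    have "b \<ominus> a \<in> A" using c_eq[OF ac(2,1)] a(2) A(2) by blast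
    then have "a \<oplus> (b \<ominus> a) \<in> A" using subspaceD(3)[OF ideal_subspace[OF A(1)]] a(1) by blast
    then show False using add_minus_cancel[OF ac(2,1)] b(2) by simp
  qed
  have "(\<exists>H. (\<forall>i\<le>l. submodule (H i) R ?M) \<and> (\<forall>i<l. H i \<subset> H (Suc i))) \<longleftrightarrow>
      l \<le> dm (sat Q \<inter> F t) - dm (Q \<inter> F t)" (is "?L \<longleftrightarrow> ?R") for l
  proof -
    have "?L \<longleftrightarrow> (\<exists>A. (\<forall>i\<le>l. ideal (A i) R \<and> Q \<subseteq> A i \<and> A i \<subseteq> sat Q) \<and> (\<forall>i<l. A i \<subset> A (Suc i)))"
    proof
      assume ?L
      then obtain H where H': "\<forall>i\<le>l. submodule (H i) R ?M" "\<forall>i<l. H i \<subset> H (Suc i)"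
        by (elim exE conjE)
      note H = H'[rule_format]
      have "N (H i) \<subset> N (H (Suc i))" if i: "i < l" for i
      proof (rule c_strict)
        have si: "submodule (H i) R ?M" "submodule (H (Suc i)) R ?M" using H(1) i by simp_all
        show "ideal (N (H i)) R" "Q \<subseteq> N (H i)" using sub_to_ideal[OF si(1)] by simp_all
        show "N (H i) \<subseteq> N (H (Suc i))" using H(2)[OF i] by (auto simp: N_def)
        show "c ` N (H i) \<noteq> c ` N (H (Suc i))"
          using sub_to_ideal[OF si(1)] sub_to_ideal[OF si(2)] H(2)[OF i] by (metis psubsetE order_refl)
      qed
      then show "\<exists>A. (\<forall>i\<le>l. ideal (A i) R \<and> Q \<subseteq> A i \<and> A i \<subseteq> sat Q) \<and> (\<forall>i<l. A i \<subset> A (Suc i))"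
        using sub_to_ideal[OF H(1)] by (intro exI[of _ "\<lambda>i. N (H i)"]) simp
    next
      assume "\<exists>A. (\<forall>i\<le>l. ideal (A i) R \<and> Q \<subseteq> A i \<and> A i \<subseteq> sat Q) \<and> (\<forall>i<l. A i \<subset> A (Suc i))"
      then obtain A where A': "\<forall>i\<le>l. ideal (A i) R \<and> Q \<subseteq> A i \<and> A i \<subseteq> sat Q" "\<forall>i<l. A i \<subset> A (Suc i)"
        by (elim exE conjE)
      note A = A'[rule_format]
      have "c ` A i \<subset> c ` A (Suc i)" if i: "i < l" for i
        using c_strict'[OF _ _ A(2)[OF i]] A(1)[of i] A(1)[of "Suc i"] A(2)[OF i] i
        by (intro psubsetI image_mono) auto
      then show ?L using ideal_to_sub A(1) by (intro exI[of _ "\<lambda>i. c ` A i"]) simp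
    qed
    also have "\<dots> \<longleftrightarrow> ?R"
      by (rule ideal_chain_length[OF Q sat_hideal[OF Q] sat_superset[OF I] ev])
    finally show ?thesis .
  qed
  then show ?thesis unfolding module_length_def by (simp add: Sup_enat_atMost)
qed

end

section \<open>Homogenization\<close>

context std_graded_domain
begin

interpretation P: UP_domain R "UP R"
  by unfold_locales auto

abbreviation S :: "('a, nat \<Rightarrow> 'a) up_ring" where "S \<equiv> UP R"

text \<open>The degree \<open>t\<close> form \<open>\<Sum>\<^sub>i x\<^sub>i U\<^bsup>t - i\<^esup>\<close> that specializes to \<open>x\<close> at \<open>U = 1\<close>.\<close>

definition homog :: "nat \<Rightarrow> 'a \<Rightarrow> nat \<Rightarrow> 'a" where
  "homog t x = (\<lambda>n. if n \<le> t then cmp x (t - n) else \<zero>)"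

lemma homog_carrier [simp]: "x \<in> carrier R \<Longrightarrow> homog t x \<in> carrier S"
  unfolding UP_def homog_def by (auto intro!: mem_upI exI[of _ t] bound.intro)

lemma coeff_homog: "x \<in> carrier R \<Longrightarrow> up_ring.coeff S (homog t x) n = (if n \<le> t then cmp x (t - n) else \<zero>)"
  using homog_carrier[of x t] unfolding UP_def by (simp add: homog_def)

lemma homog_add:
  "x \<in> carrier R \<Longrightarrow> y \<in> carrier R \<Longrightarrow> homog t (x \<oplus> y) = homog t x \<oplus>\<^bsub>S\<^esub> homog t y"
  by (rule P.up_eqI) (simp_all add: coeff_homog cmp_add)

lemma homog_of_homogeneous:
  assumes "x \<in> G i" "i \<le> t" shows "homog t x = up_ring.monom S x (t - i)"
  using assms G_carrier[OF assms(1)]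
  by (intro P.up_eqI) (auto simp: coeff_homog cmp_homogeneous)

lemma homog_zero: "homog t \<zero> = \<zero>\<^bsub>S\<^esub>"
  using homog_of_homogeneous[OF G_zero, of 0 t] by simp

lemma homog_one: "homog 0 \<one> = \<one>\<^bsub>S\<^esub>"
  using homog_of_homogeneous[OF G_one, of 0] by (simp add: P.monom_one)

text \<open>Both sides are additive in each factor, so homogeneous factors suffice; for these the
  claim is the multiplication of monomials in \<open>U\<close>.\<close>

lemma homog_mult:
  assumes x: "x \<in> F s" and y: "y \<in> F t"
  shows "homog (s + t) (x \<otimes> y) = homog s x \<otimes>\<^bsub>S\<^esub> homog t y"
proof -
  have xc: "x \<in> carrier R" and yc: "y \<in> carrier R" using x y F_carrier by auto
  have 1: "homog (s + t) (a \<otimes> y) = homog s a \<otimes>\<^bsub>S\<^esub> homog t y" if a: "a \<in> G i" "i \<le> s" for a i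
  proof -
    have ac: "a \<in> carrier R" using a G_carrier by blast
    have "y \<in> {y \<in> carrier R. homog (s + t) (a \<otimes> y) = homog s a \<otimes>\<^bsub>S\<^esub> homog t y}"
    proof (rule F_induct[OF _ _ _ y])
      fix j assume j: "j \<le> t"
      have "homog (s + t) (a \<otimes> cmp y j) = up_ring.monom S (a \<otimes> cmp y j) ((s - i) + (t - j))"
        using homog_of_homogeneous[OF G_mult[OF a(1) cmp_G[OF yc, of j]], of "s + t"] a(2) j by simp
      also have "\<dots> = homog s a \<otimes>\<^bsub>S\<^esub> homog t (cmp y j)"
        using homog_of_homogeneous[OF a] homog_of_homogeneous[OF cmp_G[OF yc, of j] j] P.monom_mult[OF ac cmp_carrier[OF yc]]
        by simp
      finally show "cmp y j \<in> {y \<in> carrier R. homog (s + t) (a \<otimes> y) = homog s a \<otimes>\<^bsub>S\<^esub> homog t y}" using yc by simp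
    qed (use ac in \<open>auto simp: homog_zero r_distr homog_add P.UP_r_distr\<close>)
    then show ?thesis by blast
  qed
  have "x \<in> {x \<in> carrier R. homog (s + t) (x \<otimes> y) = homog s x \<otimes>\<^bsub>S\<^esub> homog t y}"
  proof (rule F_induct[OF _ _ _ x])
    fix i assume "i \<le> s"
    then show "cmp x i \<in> {x \<in> carrier R. homog (s + t) (x \<otimes> y) = homog s x \<otimes>\<^bsub>S\<^esub> homog t y}"
      using 1[OF cmp_G[OF xc, of i]] xc by simp
  qed (use yc in \<open>auto simp: homog_zero l_distr homog_add P.UP_l_distr\<close>)
  then show ?thesis by blast
qed

text \<open>The inverse of \<open>homog t\<close> substitutes \<open>U = 1\<close>, that is, it adds
  up the coefficients of a form. These have distinct degrees and are therefore the components of the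
  sum.\<close>

lemma poly_grading_eq: "poly_grading R G t = homog t ` F t"
proof (intro equalityI subsetI)
  fix p assume "p \<in> poly_grading R G t"
  then have p: "p \<in> carrier S" "\<And>i. i \<le> t \<Longrightarrow> up_ring.coeff S p i \<in> G (t - i)" "\<And>i. i > t \<Longrightarrow> up_ring.coeff S p i = \<zero>"
    unfolding poly_grading_def by auto
  define f where "f = (\<lambda>u. if u \<le> t then up_ring.coeff S p (t - u) else \<zero>)"
  have f: "f u \<in> G u" for u
    using p(2)[of "t - u"] G_zero by (cases "u \<le> t") (simp_all add: f_def)
  have "decomposes f (finsum R f {..t}) t" unfolding decomposes_def using f by (auto simp: f_def)
  then have c: "cmp (finsum R f {..t}) = f" by (rule cmp_eq)
  have xc: "finsum R f {..t} \<in> carrier R" using f G_carrier by (intro finsum_closed) auto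
  have "homog t (finsum R f {..t}) = p"
  proof (rule P.up_eqI)
    show "up_ring.coeff S (homog t (finsum R f {..t})) n = up_ring.coeff S p n" for n
      unfolding coeff_homog[OF xc] c using p(3) by (simp add: f_def)
  qed (use p xc in auto)
  moreover have "finsum R f {..t} \<in> F t" using xc unfolding F_def mem_Collect_eq c by (simp add: f_def)
  ultimately show "p \<in> homog t ` F t" by blast
next
  fix p assume "p \<in> homog t ` F t"
  then obtain x where "x \<in> F t" "p = homog t x" by blast
  then show "p \<in> poly_grading R G t"
    using F_carrier cmp_G by (auto simp: poly_grading_def coeff_homog subset_iff)
qed

text \<open>The extension consists of the polynomials with coefficients in \<open>J\<close>; the
  second and third claims are the two halves of this in the form used later.\<close>

lemma extended_ideal_subset:
  assumes J: "ideal J R"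
  shows "ideal (extended_ideal R J) S" "extended_ideal R J \<subseteq> {p \<in> carrier S. \<forall>i. up_ring.coeff S p i \<in> J}"
    "\<And>a i. a \<in> J \<Longrightarrow> up_ring.monom S a i \<in> extended_ideal R J"
proof -
  note Jc = ideal.Icarr[OF J] and JS = subspaceD[OF ideal_subspace[OF J]]
  have c: "(\<lambda>a. up_ring.monom S a 0) ` J \<subseteq> carrier S" using Jc by auto
  show I: "ideal (extended_ideal R J) S" unfolding extended_ideal_def by (rule P.P.genideal_ideal[OF c])
  have "ideal {p \<in> carrier S. \<forall>i. up_ring.coeff S p i \<in> J} S"
  proof (rule P.P.idealI')
    fix a p assume a: "a \<in> carrier S" and p: "p \<in> {p \<in> carrier S. \<forall>i. up_ring.coeff S p i \<in> J}"
    have "(\<Oplus>i\<in>{..n}. up_ring.coeff S a i \<otimes> up_ring.coeff S p (n - i)) \<in> J" for n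
      using ideal_mult(1)[OF J] a p by (intro finsum_in[OF JS(1-3)]) auto
    then show "a \<otimes>\<^bsub>S\<^esub> p \<in> {p \<in> carrier S. \<forall>i. up_ring.coeff S p i \<in> J}" using a p by simp
  qed (use JS in auto)
  moreover have "(\<lambda>a. up_ring.monom S a 0) ` J \<subseteq> {p \<in> carrier S. \<forall>i. up_ring.coeff S p i \<in> J}"
    using Jc JS(2) by auto
  ultimately show "extended_ideal R J \<subseteq> {p \<in> carrier S. \<forall>i. up_ring.coeff S p i \<in> J}"
    unfolding extended_ideal_def by (rule P.P.genideal_minimal)
  fix a i assume a: "a \<in> J"
  have "up_ring.monom S \<one> i \<otimes>\<^bsub>S\<^esub> up_ring.monom S a 0 \<in> extended_ideal R J"
    using P.P.genideal_self[OF c] a unfolding extended_ideal_def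
    by (intro ideal.I_l_closed[OF I[unfolded extended_ideal_def]]) auto
  then show "up_ring.monom S a i \<in> extended_ideal R J"
    using P.monom_mult[OF one_closed Jc[OF a], of i 0] Jc[OF a] by simp
qed

lemma extended_ideal_Int_grading:
  assumes J: "hideal J" shows "extended_ideal R J \<inter> poly_grading R G t = homog t ` (J \<inter> F t)"
proof (intro equalityI subsetI)
  have I: "ideal J R" using J unfolding hideal_def by blast
  note E = extended_ideal_subset[OF I] and JS = subspaceD[OF ideal_subspace[OF I]]
  {
    fix p assume "p \<in> extended_ideal R J \<inter> poly_grading R G t"
    then obtain x where x: "x \<in> F t" "p = homog t x" "p \<in> extended_ideal R J" unfolding poly_grading_eq by blast
    have xc: "x \<in> carrier R" using x F_carrier by blast
    have "x \<in> J"
    proof (rule F_induct[OF JS(1-3) x(1)])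
      fix i assume "i \<le> t"
      moreover have "up_ring.coeff S (homog t x) (t - i) \<in> J" using E(2) x(2,3) by blast
      ultimately show "cmp x i \<in> J" using coeff_homog[OF xc, of t "t - i"] by simp
    qed
    then show "p \<in> homog t ` (J \<inter> F t)" using x by blast
  next
    fix p assume "p \<in> homog t ` (J \<inter> F t)"
    then obtain x where x: "x \<in> J" "x \<in> F t" "p = homog t x" by blast
    have xc: "x \<in> carrier R" using x F_carrier by blast
    note ES = additive_subgroup.a_closed[OF ideal.axioms(1)[OF E(1)]]
    have "x \<in> {x \<in> carrier R. homog t x \<in> extended_ideal R J}"
    proof (rule F_induct[OF _ _ _ x(2)])
      fix i assume i: "i \<le> t"
      have "cmp x i \<in> J" using J x(1) unfolding hideal_def by blast
      then show "cmp x i \<in> {x \<in> carrier R. homog t x \<in> extended_ideal R J}"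
        using homog_of_homogeneous[OF cmp_G[OF xc, of i] i] E(3) xc by simp
    qed (use ES additive_subgroup.zero_closed[OF ideal.axioms(1)[OF E(1)]] in \<open>auto simp: homog_zero homog_add\<close>)
    then show "p \<in> extended_ideal R J \<inter> poly_grading R G t" using x unfolding poly_grading_eq by blast
  }
qed

section \<open>Ideals generated by forms of one degree\<close>

abbreviation hIdl :: "nat \<Rightarrow> 'a set \<Rightarrow> (nat \<Rightarrow> 'a) set" where
  "hIdl t A \<equiv> Idl\<^bsub>S\<^esub> (homog t ` A)"

lemma homog_image_carrier: "A \<subseteq> carrier R \<Longrightarrow> homog t ` A \<subseteq> carrier S"
  using homog_carrier by blast

lemma hIdl_ideal: "A \<subseteq> carrier R \<Longrightarrow> ideal (hIdl t A) S"
  by (rule P.P.genideal_ideal[OF homog_image_carrier])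

lemma hIdl_self: "A \<subseteq> carrier R \<Longrightarrow> x \<in> A \<Longrightarrow> homog t x \<in> hIdl t A"
  using P.P.genideal_self[OF homog_image_carrier] by blast

text \<open>Because homogenization is multiplicative on the filtration, products of ideals of
  \<open>R[U]\<close> generated in one degree reduce to products of subspaces of
  \<open>R\<close>.\<close>

lemma hIdl_prod:
  assumes A: "A \<subseteq> F s" and B: "B \<subseteq> F t"
  shows "ideal_prod S (hIdl s A) (hIdl t B) = hIdl (s + t) (ideal_prod R A B)"
proof
  have c: "A \<subseteq> carrier R" "B \<subseteq> carrier R" using A B F_carrier by blast+
  have ABc: "ideal_prod R A B \<subseteq> carrier R" using c by (intro ideal_prod_min) auto
  show "ideal_prod S (hIdl s A) (hIdl t B) \<subseteq> hIdl (s + t) (ideal_prod R A B)"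
  proof (rule P.P.ideal_prod_Idl_min[OF homog_image_carrier[OF c(1)] homog_image_carrier[OF c(2)] hIdl_ideal[OF ABc]])
    fix x y assume "x \<in> homog s ` A" "y \<in> homog t ` B"
    then obtain a b where *: "a \<in> A" "b \<in> B" "x = homog s a" "y = homog t b" by blast
    show "x \<otimes>\<^bsub>S\<^esub> y \<in> hIdl (s + t) (ideal_prod R A B)"
      using homog_mult[OF subsetD[OF A *(1)] subsetD[OF B *(2)]]
        hIdl_self[OF ABc ideal_prod.prod[OF *(1,2)], of "s + t"] *(3,4) by simp
  qed
  note I = P.P.ideal_prod_is_ideal[OF hIdl_ideal[OF c(1)] hIdl_ideal[OF c(2)], of s t]
  show "hIdl (s + t) (ideal_prod R A B) \<subseteq> ideal_prod S (hIdl s A) (hIdl t B)"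
  proof (rule P.P.genideal_minimal[OF I], rule image_subsetI)
    fix z assume "z \<in> ideal_prod R A B"
    then show "homog (s + t) z \<in> ideal_prod S (hIdl s A) (hIdl t B)"
    proof (induction rule: ideal_prod.induct)
      case (prod a b)
      then have "homog (s + t) (a \<otimes> b) = homog s a \<otimes>\<^bsub>S\<^esub> homog t b" using A B by (intro homog_mult) auto
      then show ?case using prod hIdl_self c by (auto intro: ideal_prod.prod)
    next
      case (sum x y)
      then have "x \<in> carrier R" "y \<in> carrier R" using ABc by blast+
      then show ?case using sum by (simp add: homog_add ideal_prod.sum)
    qed
  qed
qed

abbreviation nn :: "(nat \<Rightarrow> 'a) set" where "nn \<equiv> poly_max_ideal R mm"

lemma nn_ideal: "ideal nn S"
  unfolding poly_max_ideal_def
  by (intro P.P.add_ideals extended_ideal_subset(1)[OF mm_ideal] P.P.genideal_ideal) auto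

lemma nn_parts:
  "extended_ideal R mm \<subseteq> nn" "up_ring.monom S \<one> 1 \<in> nn"
proof -
  let ?U = "Idl\<^bsub>S\<^esub> {up_ring.monom S \<one> 1}"
  have U: "ideal ?U S" by (rule P.P.genideal_ideal) auto
  have E: "ideal (extended_ideal R mm) S" by (rule extended_ideal_subset(1)[OF mm_ideal])
  have z: "\<zero>\<^bsub>S\<^esub> \<in> ?U" "\<zero>\<^bsub>S\<^esub> \<in> extended_ideal R mm"
    using additive_subgroup.zero_closed[OF ideal.axioms(1)] U E by blast+
  have m: "up_ring.monom S \<one> 1 \<in> ?U" using P.P.genideal_self[of "{up_ring.monom S \<one> 1}"] by auto
  show "extended_ideal R mm \<subseteq> nn"
  proof
    fix p assume p: "p \<in> extended_ideal R mm"
    then have "p = p \<oplus>\<^bsub>S\<^esub> \<zero>\<^bsub>S\<^esub>" using ideal.Icarr[OF E p] by simp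
    then show "p \<in> nn" unfolding poly_max_ideal_def set_add_def' using p z(1) by blast
  qed
  have "up_ring.monom S \<one> 1 = \<zero>\<^bsub>S\<^esub> \<oplus>\<^bsub>S\<^esub> up_ring.monom S \<one> 1" by simp
  then show "up_ring.monom S \<one> 1 \<in> nn" unfolding poly_max_ideal_def set_add_def' using m z(2) by blast
qed

text \<open>The variable \<open>U\<close> is the form of degree 1 that comes from
  \<open>\<one> \<in> F 1\<close>, and by standardness the elements of \<open>G 1\<close> generate
  the extension of the maximal ideal.\<close>

lemma nn_eq: "nn = hIdl 1 (F 1)"
proof
  note N = hIdl_ideal[OF F_carrier[of 1], of 1]
  note NS = additive_subgroup.a_closed[OF ideal.axioms(1)[OF N]] additive_subgroup.zero_closed[OF ideal.axioms(1)[OF N]]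
  have "mm \<subseteq> {a \<in> carrier R. up_ring.monom S a 0 \<in> hIdl 1 (F 1)}" (is "_ \<subseteq> ?V")
  proof
    have VI: "ideal ?V R"
    proof (rule idealI')
      fix a x assume a: "a \<in> carrier R" and x: "x \<in> ?V"
      have "up_ring.monom S (a \<otimes> x) 0 = up_ring.monom S a 0 \<otimes>\<^bsub>S\<^esub> up_ring.monom S x 0"
        using P.monom_mult[OF a, of x 0 0] x by simp
      then show "a \<otimes> x \<in> ?V" using a x ideal.I_l_closed[OF N] by simp
    qed (use NS in \<open>auto simp: P.monom_add\<close>)
    note VS = subspaceD[OF ideal_subspace[OF VI]]
    have G1: "G 1 \<subseteq> ?V"
    proof
      fix a assume a: "a \<in> G 1"
      then have "homog 1 a = up_ring.monom S a 0" using homog_of_homogeneous[OF a, of 1] by simp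
      moreover have "a \<in> F 1" using G_subset_F[of 1 1] a by blast
      ultimately show "a \<in> ?V" using hIdl_self[OF F_carrier, of a 1 1] G_carrier[OF a] by simp
    qed
    fix x assume x: "x \<in> mm"
    then have xc: "x \<in> carrier R" "cmp x 0 = \<zero>" unfolding irrelevant_eq by auto
    show "x \<in> ?V"
    proof (rule in_if_cmps_in[OF VS(1-3) xc(1)])
      fix i
      show "cmp x i \<in> ?V"
      proof (cases i)
        case 0
        then show ?thesis using xc VS(2) by simp
      next
        case (Suc l)
        have "ideal_prod R (G 1) (G l) \<subseteq> ?V"
          using ideal_mult(2)[OF VI] G1 G_carrier VS(3) by (intro ideal_prod_min) blast+
        then show ?thesis using cmp_G[OF xc(1), of i] G_Suc[of l] Suc by blast
      qed
    qed
  qed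
  then have E: "extended_ideal R mm \<subseteq> hIdl 1 (F 1)"
    unfolding extended_ideal_def by (intro P.P.genideal_minimal[OF N]) auto
  have one: "\<one> \<in> F 1" using G_subset_F[of 0 1] G_one by auto
  have "homog 1 \<one> = up_ring.monom S \<one> 1" using homog_of_homogeneous[OF G_one, of 1] by simp
  then have "up_ring.monom S \<one> 1 \<in> hIdl 1 (F 1)" using hIdl_self[OF F_carrier one, of 1] by simp
  then have "Idl\<^bsub>S\<^esub> {up_ring.monom S \<one> 1} \<subseteq> hIdl 1 (F 1)" by (intro P.P.genideal_minimal[OF N]) auto
  then show "nn \<subseteq> hIdl 1 (F 1)"
    using E NS(1) unfolding poly_max_ideal_def set_add_def' by blast
  show "hIdl 1 (F 1) \<subseteq> nn"
  proof (rule P.P.genideal_minimal[OF nn_ideal], rule image_subsetI)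
    fix x assume x: "x \<in> F 1"
    have xc: "x \<in> carrier R" using x F_carrier by blast
    note NN = additive_subgroup.a_closed[OF ideal.axioms(1)[OF nn_ideal]] additive_subgroup.zero_closed[OF ideal.axioms(1)[OF nn_ideal]]
    have "x \<in> {x \<in> carrier R. homog 1 x \<in> nn}"
    proof (rule F_induct[OF _ _ _ x])
      fix i :: nat assume "i \<le> 1"
      then consider "i = 0" | "i = 1" by linarith
      then show "cmp x i \<in> {x \<in> carrier R. homog 1 x \<in> nn}"
      proof cases
        case 1
        have c0: "cmp x 0 \<in> carrier R" using xc by simp
        have "homog 1 (cmp x 0) = up_ring.monom S (cmp x 0) 0 \<otimes>\<^bsub>S\<^esub> up_ring.monom S \<one> 1"
          using homog_of_homogeneous[OF cmp_G[OF xc, of 0], of 1] P.monom_mult[OF c0 one_closed, of 0 1] c0 by simp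
        then show ?thesis using 1 nn_parts(2) ideal.I_l_closed[OF nn_ideal] c0 by simp
      next
        case 2
        have "cmp x 1 \<in> mm" using cmp_homogeneous[OF cmp_G[OF xc, of 1], of 0] xc unfolding irrelevant_eq by simp
        then have "up_ring.monom S (cmp x 1) 0 \<in> nn" using nn_parts(1) extended_ideal_subset(3)[OF mm_ideal] by blast
        then show ?thesis using 2 homog_of_homogeneous[OF cmp_G[OF xc, of 1], of 1] xc by simp
      qed
    qed (use NN in \<open>auto simp: homog_zero homog_add\<close>)
    then show "homog 1 x \<in> nn" by blast
  qed
qed

text \<open>Modulo \<open>nn\<close> every polynomial is a scalar, namely the degree 0 component of
  its constant term.\<close>

lemma S_decomp:
  assumes p: "p \<in> carrier S" shows "\<exists>q\<in>nn. p = homog 0 (cmp (up_ring.coeff S p 0) 0) \<oplus>\<^bsub>S\<^esub> q"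
proof -
  let ?k = "cmp (up_ring.coeff S p 0) 0"
  have k: "?k \<in> G 0" "?k \<in> carrier R" using p cmp_G by auto
  note NN = additive_subgroup.a_closed[OF ideal.axioms(1)[OF nn_ideal]] additive_subgroup.zero_closed[OF ideal.axioms(1)[OF nn_ideal]]
  define q where "q = p \<ominus>\<^bsub>S\<^esub> homog 0 ?k"
  have qc: "q \<in> carrier S" using p k by (simp add: q_def)
  have in_nn: "up_ring.monom S a i \<in> nn" if "a \<in> carrier R" "i > 0 \<or> cmp a 0 = \<zero>" for a i
  proof (cases "i = 0")
    case True
    then have "a \<in> mm" using that unfolding irrelevant_eq by simp
    then show ?thesis using nn_parts(1) extended_ideal_subset(3)[OF mm_ideal] by blast
  next
    case False
    then have "up_ring.monom S a i = up_ring.monom S a (i - 1) \<otimes>\<^bsub>S\<^esub> up_ring.monom S \<one> 1"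
      using P.monom_mult[OF that(1) one_closed, of "i - 1" 1] that(1) by simp
    then show ?thesis using nn_parts(2) ideal.I_l_closed[OF nn_ideal] that(1) by simp
  qed
  have h0: "homog 0 ?k = up_ring.monom S ?k 0" using homog_of_homogeneous[OF k(1), of 0] by simp
  have c: "cmp (up_ring.coeff S q 0) 0 = \<zero>"
  proof -
    have pc: "up_ring.coeff S p 0 \<in> carrier R" using p by simp
    have "up_ring.coeff S q 0 = up_ring.coeff S p 0 \<oplus> \<ominus> ?k" using p k h0 by (simp add: q_def a_minus_def)
    moreover have "\<ominus> ?k \<in> G 0" using K_props(5)[OF k(1)] .
    ultimately show ?thesis
      using pc k cmp_homogeneous[of "\<ominus> ?k" 0 0] by (simp add: cmp_add r_neg)
  qed
  have "finsum S (\<lambda>i. up_ring.monom S (up_ring.coeff S q i) i) {..n} \<in> nn" for n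
  proof (induction n)
    case 0
    then show ?case using in_nn[of "up_ring.coeff S q 0" 0] c qc by (subst P.P.finsum_0) auto
  next
    case (Suc n)
    then show ?case using in_nn[of "up_ring.coeff S q (Suc n)" "Suc n"] qc NN(1) by (subst P.P.finsum_Suc) auto
  qed
  then have "q \<in> nn" using P.up_repr[OF qc] by metis
  moreover have "p = homog 0 ?k \<oplus>\<^bsub>S\<^esub> q"
  proof -
    have "homog 0 ?k \<in> carrier S" using k by simp
    then have "homog 0 ?k \<oplus>\<^bsub>S\<^esub> (p \<ominus>\<^bsub>S\<^esub> homog 0 ?k) = p"
      using p unfolding a_minus_def
      by (metis P.P.a_lcomm P.P.a_inv_closed P.P.r_neg P.P.r_zero)
    then show ?thesis by (simp add: q_def)
  qed
  ultimately show ?thesis by blast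
qed

definition high :: "nat \<Rightarrow> 'a set" where
  "high k = {x \<in> carrier R. \<forall>l<k. cmp x l = \<zero>}"

lemma high_ideal: "ideal (high k) R"
proof (rule idealI')
  fix a x assume a: "a \<in> carrier R" and x: "x \<in> high k"
  have xc: "x \<in> carrier R" using x by (simp add: high_def)
  have "a \<in> {a \<in> carrier R. \<forall>l<k. cmp (a \<otimes> x) l = \<zero>}"
  proof (rule in_if_cmps_in[OF _ _ _ a])
    fix i
    show "cmp a i \<in> {a \<in> carrier R. \<forall>l<k. cmp (a \<otimes> x) l = \<zero>}"
      using a x xc by (auto simp: high_def cmp_mult[OF cmp_G[OF a] xc])
  qed (use xc in \<open>auto simp: l_distr cmp_add\<close>)
  then show "a \<otimes> x \<in> high k" using a xc by (simp add: high_def)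
qed (auto simp: high_def cmp_add)

text \<open>The polynomials without a part of total degree below \<open>w\<close>. They separate the
  nonzero forms of degree \<open>w\<close> from ideals generated in degree
  \<open>w + 1\<close>.\<close>

definition high_forms :: "nat \<Rightarrow> (nat \<Rightarrow> 'a) set" where
  "high_forms w = {p \<in> carrier S. \<forall>i. up_ring.coeff S p i \<in> high (w - i)}"

lemma high_forms_ideal: "ideal (high_forms w) S"
proof (rule P.P.idealI')
  note H = subspaceD[OF ideal_subspace[OF high_ideal]]
  show "\<zero>\<^bsub>S\<^esub> \<in> high_forms w" using H(2) by (simp add: high_forms_def)
  show "p \<oplus>\<^bsub>S\<^esub> q \<in> high_forms w" if "p \<in> high_forms w" "q \<in> high_forms w" for p q
    using that H(3) by (simp add: high_forms_def)
  fix a p assume a: "a \<in> carrier S" and p: "p \<in> high_forms w"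
  have "(\<Oplus>i\<in>{..n}. up_ring.coeff S a i \<otimes> up_ring.coeff S p (n - i)) \<in> high (w - n)" for n
  proof (rule finsum_in[OF H(1-3)])
    fix i assume "i \<le> n"
    have "up_ring.coeff S p (n - i) \<in> high (w - (n - i))" using p unfolding high_forms_def by blast
    moreover have "high (w - (n - i)) \<subseteq> high (w - n)" unfolding high_def by auto
    ultimately show "up_ring.coeff S a i \<otimes> up_ring.coeff S p (n - i) \<in> high (w - n)"
      using ideal_mult(1)[OF high_ideal] a by auto
  qed
  then show "a \<otimes>\<^bsub>S\<^esub> p \<in> high_forms w" using a p by (simp add: high_forms_def)
qed (auto simp: high_forms_def)

lemma hIdl_high_forms: "A \<subseteq> carrier R \<Longrightarrow> hIdl w A \<subseteq> high_forms w"
proof (rule P.P.genideal_minimal[OF high_forms_ideal], rule image_subsetI)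
  fix x assume "A \<subseteq> carrier R" "x \<in> A"
  then have xc: "x \<in> carrier R" by blast
  have "up_ring.coeff S (homog w x) i \<in> high (w - i)" for i
    using xc cmp_homogeneous[OF cmp_G[OF xc, of "w - i"]] by (auto simp: coeff_homog high_def)
  then show "homog w x \<in> high_forms w" using xc by (simp add: high_forms_def)
qed

lemma homog_in_high_forms:
  assumes x: "x \<in> F w" and h: "homog w x \<in> high_forms (Suc w)" shows "x = \<zero>"
proof -
  have xc: "x \<in> carrier R" using x F_carrier by blast
  have "x \<in> {\<zero>}"
  proof (rule F_induct[OF _ _ _ x])
    fix i assume i: "i \<le> w"
    have "up_ring.coeff S (homog w x) (w - i) \<in> high (Suc w - (w - i))" using h unfolding high_forms_def by blast
    then have "cmp (cmp x i) i = \<zero>" using i xc by (simp add: coeff_homog high_def Suc_diff_le)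
    then show "cmp x i \<in> {\<zero>}" using cmp_homogeneous[OF cmp_G[OF xc, of i], of i] by simp
  qed auto
  then show ?thesis by simp
qed

end

context filtered_rees
begin

interpretation P: UP_domain R "UP R"
  by unfold_locales auto

section \<open>The Hilbert function of the mixed multiplicities\<close>

abbreviation aa :: "(nat \<Rightarrow> 'a) set" where
  "aa \<equiv> degree_part_ideal S (poly_grading R G) (extended_ideal R J) \<beta>"

lemma aa_eq: "aa = hIdl \<beta> (J \<inter> F \<beta>)"
  unfolding degree_part_ideal_def extended_ideal_Int_grading[OF gen_hideal[OF gen_J]] ..

lemma B_carrier: "B u v \<subseteq> carrier R" using subspaceD(1)[OF B_subspace] .

lemma nn_power: "ideal_power S nn u = hIdl u (F u)"
proof (induction u)
  case 0
  have "\<one>\<^bsub>S\<^esub> \<in> hIdl 0 (F 0)" using hIdl_self[OF F_carrier, of \<one> 0 0] G_one by (simp add: homog_one F_zero)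
  then have "hIdl 0 (F 0) = carrier S" by (rule ideal.one_imp_carrier[OF hIdl_ideal[OF F_carrier]])
  then show ?case by simp
next
  case (Suc u)
  have "ideal_prod R (F u) (F 1) = F (u + 1)"
  proof
    show "ideal_prod R (F u) (F 1) \<subseteq> F (u + 1)"
      by (rule ideal_prod_min[OF F_mult subspaceD(3)[OF F_subspace]])
  qed (rule F_add_degree)
  then show ?case using Suc hIdl_prod[OF order_refl order_refl, of u 1] nn_eq by simp
qed

lemma aa_power: "ideal_power S aa v = hIdl (\<beta> * v) (B 0 v)"
proof (induction v)
  case 0
  have "\<one>\<^bsub>S\<^esub> \<in> hIdl 0 (B 0 0)" using hIdl_self[OF B_carrier, of \<one> 0 0 0] one_in_B by (simp add: homog_one)
  then have "hIdl 0 (B 0 0) = carrier S" by (rule ideal.one_imp_carrier[OF hIdl_ideal[OF B_carrier]])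
  then show ?case by simp
next
  case (Suc v)
  have JB: "J \<inter> F \<beta> = B 0 1" using ideal_power_1[OF J_ideal] by (simp add: B_def)
  have "ideal_prod R (B 0 v) (J \<inter> F \<beta>) = B 0 (Suc v)"
  proof
    show "ideal_prod R (B 0 v) (J \<inter> F \<beta>) \<subseteq> B 0 (Suc v)"
    proof (rule ideal_prod_min[OF _ subspaceD(3)[OF B_subspace]])
      fix a b assume "a \<in> B 0 v" "b \<in> J \<inter> F \<beta>"
      then show "a \<otimes> b \<in> B 0 (Suc v)" unfolding JB using B_mult[of a 0 v b 0 1] by simp
    qed
    show "B 0 (Suc v) \<subseteq> ideal_prod R (B 0 v) (J \<inter> F \<beta>)"
      using gen_prod_Int_F[OF gen_power[OF gen_J] gen_J, of v] by (simp add: B_def add.commute)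
  qed
  moreover have "B 0 v \<subseteq> F (\<beta> * v)" by (auto simp: B_def)
  ultimately show ?case using Suc hIdl_prod[of "B 0 v" "\<beta> * v" "J \<inter> F \<beta>" \<beta>] aa_eq by (simp add: add.commute)
qed

lemma nn_aa_prod: "ideal_prod S (ideal_power S nn u) (ideal_power S aa v) = hIdl (\<beta> * v + u) (B u v)"
proof -
  have "ideal_prod R (F u) (B 0 v) = B u v"
  proof
    have "F u \<subseteq> B u 0" using F_carrier by (auto simp: B_def)
    then show "ideal_prod R (F u) (B 0 v) \<subseteq> B u v"
      using B_mult[of _ u 0 _ 0 v] by (intro ideal_prod_min[OF _ subspaceD(3)[OF B_subspace]]) auto
    have "ideal_prod R (B 0 v) (F u) \<subseteq> ideal_prod R (F u) (B 0 v)"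
    proof (rule ideal_prod_min)
      fix a b assume ab: "a \<in> B 0 v" "b \<in> F u"
      then have "a \<otimes> b = b \<otimes> a" using F_carrier B_carrier by (intro m_comm) blast+
      then show "a \<otimes> b \<in> ideal_prod R (F u) (B 0 v)" using ab by (simp add: ideal_prod.prod)
    qed (rule ideal_prod.sum)
    then show "B u v \<subseteq> ideal_prod R (F u) (B 0 v)"
      using gen_Int_F[OF gen_power[OF gen_J], of v u] by (simp add: B_def)
  qed
  moreover have "B 0 v \<subseteq> F (\<beta> * v)" by (auto simp: B_def)
  ultimately show ?thesis
    using hIdl_prod[of "F u" u "B 0 v" "\<beta> * v"] by (simp add: nn_power aa_power add.commute)
qed

text \<open>Both ideals are generated by forms, \<open>K\<close> in degree
  \<open>\<beta> * v + u\<close> and \<open>J'\<close> in the next degree, and \<open>nn\<close>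
  times \<open>K\<close> lies in \<open>J'\<close>. So the quotient is the space of generating forms
  of \<open>K\<close>, which homogenization identifies with \<open>B u v\<close>.\<close>

lemma bigraded_hilbert_eq: "bigraded_hilbert S (poly_grading R G 0) nn aa u v = dm (B u v)"
proof -
  let ?w = "\<beta> * v + u" and ?V = "homog (\<beta> * v + u) ` B u v"
  define K where "K = hIdl ?w (B u v)"
  define J' where "J' = hIdl (Suc ?w) (B (Suc u) v)"
  have KI: "ideal K S" unfolding K_def by (rule hIdl_ideal[OF B_carrier])
  have JI: "ideal J' S" unfolding J'_def by (rule hIdl_ideal[OF B_carrier])
  interpret JI: ideal J' S by (rule JI)
  interpret h: ring_hom_ring S "S Quot J'" "(+>\<^bsub>S\<^esub>) J'" by (rule JI.rcos_ring_hom_ring)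
  have prodK: "ideal_prod S (ideal_power S nn u) (ideal_power S aa v) = K"
    unfolding K_def by (rule nn_aa_prod)
  have prodJ: "ideal_prod S (ideal_power S nn (u + 1)) (ideal_power S aa v) = J'"
    unfolding J'_def using nn_aa_prod[of "u + 1" v] by simp
  have VK: "?V \<subseteq> K" unfolding K_def by (rule P.P.genideal_self[OF homog_image_carrier[OF B_carrier]])
  have Vc: "?V \<subseteq> carrier S" by (rule homog_image_carrier[OF B_carrier])
  have nK: "ideal_prod S nn K \<subseteq> J'"
  proof -
    have "ideal_prod S (hIdl 1 (F 1)) K = hIdl (1 + ?w) (ideal_prod R (F 1) (B u v))"
      unfolding K_def by (rule hIdl_prod) (auto simp: B_def)
    moreover have "ideal_prod R (F 1) (B u v) \<subseteq> B (Suc u) v"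
    proof (rule ideal_prod_min[OF _ subspaceD(3)[OF B_subspace]])
      fix a b assume "a \<in> F 1" "b \<in> B u v"
      moreover have "F 1 \<subseteq> B 1 0" using F_carrier by (auto simp: B_def)
      ultimately show "a \<otimes> b \<in> B (Suc u) v" using B_mult[of a 1 0 b u v] by auto
    qed
    ultimately show ?thesis unfolding J'_def nn_eq
      using hIdl_self[OF B_carrier, of _ "Suc u" v "Suc ?w"]
      by (simp, intro P.P.genideal_minimal[OF hIdl_ideal[OF B_carrier]]) blast
  qed
  \<comment> \<open>Elements of \<open>J'\<close> have no part of degree
    \<open>\<beta> * v + u\<close>, so only the zero form of that degree lies in
    \<open>J'\<close>.\<close>
  have disj: "x = \<zero>" if "x \<in> B u v" "homog ?w x \<in> J'" for x
  proof (rule homog_in_high_forms)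
    show "x \<in> F ?w" using that(1) by (simp add: B_def)
    show "homog ?w x \<in> high_forms (Suc ?w)"
      using that(2) hIdl_high_forms[OF B_carrier] unfolding J'_def by blast
  qed
  have hJ: "J' +>\<^bsub>S\<^esub> p = J' +>\<^bsub>S\<^esub> q \<longleftrightarrow> p \<ominus>\<^bsub>S\<^esub> q \<in> J'" if "p \<in> carrier S" "q \<in> carrier S" for p q
    using P.P.quotient_eq_iff_same_a_r_cos[OF JI that] by simp
  have cancel: "(p \<oplus>\<^bsub>S\<^esub> q) \<ominus>\<^bsub>S\<^esub> q = p" if "p \<in> carrier S" "q \<in> carrier S" for p q
    using that by (simp add: P.P.minus_eq P.P.a_assoc P.P.r_neg)
  have hc: "homog ?w b \<in> carrier S" if "b \<in> B u v" for b by (rule homog_carrier[OF subsetD[OF B_carrier that]])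
  note BS = subspaceD[OF B_subspace[of u v]]
  \<comment> \<open>The generating forms plus \<open>J'\<close> already make up an ideal, because a
    polynomial is a scalar modulo \<open>nn\<close> and \<open>nn\<close> carries \<open>K\<close>
    into \<open>J'\<close>. Hence all of \<open>K\<close> is contained in it.\<close>
  define T where "T = {q \<in> carrier S. \<exists>b\<in>B u v. \<exists>j\<in>J'. q = homog ?w b \<oplus>\<^bsub>S\<^esub> j}"
  have "ideal T S"
  proof (rule P.P.idealI')
    show "T \<subseteq> carrier S" by (auto simp: T_def)
    have "\<zero>\<^bsub>S\<^esub> = homog ?w \<zero> \<oplus>\<^bsub>S\<^esub> \<zero>\<^bsub>S\<^esub>" by (simp add: homog_zero)
    then show "\<zero>\<^bsub>S\<^esub> \<in> T" unfolding T_def using BS(2) JI.zero_closed P.UP_zero_closed by blast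
  next
    fix p q assume "p \<in> T" "q \<in> T"
    then obtain b j b' j' where *: "b \<in> B u v" "j \<in> J'" "p = homog ?w b \<oplus>\<^bsub>S\<^esub> j"
      "b' \<in> B u v" "j' \<in> J'" "q = homog ?w b' \<oplus>\<^bsub>S\<^esub> j'" unfolding T_def by blast
    have c: "j \<in> carrier S" "j' \<in> carrier S" "b \<in> carrier R" "b' \<in> carrier R"
      using * JI.Icarr BS(1) by auto
    have "p \<oplus>\<^bsub>S\<^esub> q = homog ?w (b \<oplus> b') \<oplus>\<^bsub>S\<^esub> (j \<oplus>\<^bsub>S\<^esub> j')"
      unfolding * using c by (simp add: homog_add P.P.a_ac)
    moreover have "p \<oplus>\<^bsub>S\<^esub> q \<in> carrier S" unfolding * using c by simp
    ultimately show "p \<oplus>\<^bsub>S\<^esub> q \<in> T" unfolding T_def using BS(3)[OF *(1,4)] JI.a_closed[OF *(2,5)] by blast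
  next
    fix p q assume p: "p \<in> carrier S" and "q \<in> T"
    then obtain b j where *: "b \<in> B u v" "j \<in> J'" "q = homog ?w b \<oplus>\<^bsub>S\<^esub> j" unfolding T_def by blast
    let ?k = "cmp (up_ring.coeff S p 0) 0"
    obtain n where n: "n \<in> nn" "p = homog 0 ?k \<oplus>\<^bsub>S\<^esub> n" using S_decomp[OF p] by blast
    have k: "?k \<in> G 0" "?k \<in> carrier R" using p cmp_G by auto
    have c: "j \<in> carrier S" "b \<in> carrier R" "n \<in> carrier S" "homog ?w b \<in> carrier S" "homog 0 ?k \<in> carrier S"
      using * JI.Icarr BS(1) ideal.Icarr[OF nn_ideal n(1)] hc k by auto
    have "homog 0 ?k \<otimes>\<^bsub>S\<^esub> homog ?w b = homog ?w (?k \<otimes> b)"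
      using homog_mult[of ?k 0 b ?w] k(1) *(1) by (simp add: F_zero B_def)
    then have "p \<otimes>\<^bsub>S\<^esub> homog ?w b = homog ?w (?k \<otimes> b) \<oplus>\<^bsub>S\<^esub> n \<otimes>\<^bsub>S\<^esub> homog ?w b"
      by (subst n(2)) (simp add: P.P.l_distr c)
    then have "p \<otimes>\<^bsub>S\<^esub> q = homog ?w (?k \<otimes> b) \<oplus>\<^bsub>S\<^esub> (n \<otimes>\<^bsub>S\<^esub> homog ?w b \<oplus>\<^bsub>S\<^esub> p \<otimes>\<^bsub>S\<^esub> j)"
      unfolding *(3) using c p k by (simp add: P.P.r_distr P.P.a_assoc)
    moreover have "n \<otimes>\<^bsub>S\<^esub> homog ?w b \<in> J'"
      using nK ideal_prod.prod[of n nn "homog ?w b" K S] n(1) VK *(1) by blast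
    moreover have "p \<otimes>\<^bsub>S\<^esub> j \<in> J'" by (rule JI.I_l_closed[OF *(2) p])
    moreover have "p \<otimes>\<^bsub>S\<^esub> q \<in> carrier S" unfolding *(3) using c p by simp
    ultimately show "p \<otimes>\<^bsub>S\<^esub> q \<in> T" unfolding T_def using BS(4)[OF k(1) *(1)] JI.a_closed by blast
  qed
  moreover have "?V \<subseteq> T"
  proof (rule image_subsetI)
    fix b assume b: "b \<in> B u v"
    have "homog ?w b = homog ?w b \<oplus>\<^bsub>S\<^esub> \<zero>\<^bsub>S\<^esub>" using hc[OF b] by simp
    then show "homog ?w b \<in> T" unfolding T_def using b hc[OF b] JI.zero_closed by blast
  qed
  ultimately have KT: "K \<subseteq> T" unfolding K_def by (rule P.P.genideal_minimal)
  define \<psi> where "\<psi> = (\<lambda>x. J' +>\<^bsub>S\<^esub> homog ?w x)"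
  have image_K: "(\<lambda>x. J' +>\<^bsub>S\<^esub> x) ` K = \<psi> ` B u v"
  proof (intro equalityI subsetI)
    fix C assume "C \<in> (\<lambda>x. J' +>\<^bsub>S\<^esub> x) ` K"
    then obtain q where q: "q \<in> T" "C = J' +>\<^bsub>S\<^esub> q" using KT by blast
    then obtain b j where *: "b \<in> B u v" "j \<in> J'" "q = homog ?w b \<oplus>\<^bsub>S\<^esub> j" unfolding T_def by blast
    have jc: "j \<in> carrier S" using JI.Icarr[OF *(2)] .
    have "q = j \<oplus>\<^bsub>S\<^esub> homog ?w b" unfolding *(3) using hc[OF *(1)] jc by (rule P.P.a_comm)
    then have "q \<ominus>\<^bsub>S\<^esub> homog ?w b = j" using cancel[OF jc hc[OF *(1)]] by simp
    then have "C = \<psi> b" unfolding q(2) \<psi>_def using hJ[of q "homog ?w b"] *(2) q(1) hc[OF *(1)] by (simp add: T_def)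
    then show "C \<in> \<psi> ` B u v" using *(1) by blast
  next
    fix C assume "C \<in> \<psi> ` B u v"
    then show "C \<in> (\<lambda>x. J' +>\<^bsub>S\<^esub> x) ` K" unfolding \<psi>_def using VK by blast
  qed
  have const: "(\<lambda>a. up_ring.monom S a 0) \<in> ring_hom R S" by (rule P.const_ring_hom)
  \<comment> \<open>\<open>quot_dim\<close> works over the image of the field in the quotient ring.
    Presenting this image by a ring homomorphism on \<open>R\<close> shows that it is a subfield,
    once \<open>J'\<close> is known to be proper.\<close>
  define \<eta> where "\<eta> = (+>\<^bsub>S\<^esub>) J' \<circ> (\<lambda>a. up_ring.monom S a 0)"
  have "\<eta> \<in> ring_hom R (S Quot J')" unfolding \<eta>_def by (rule ring_hom_trans[OF const JI.rcos_ring_hom])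
  then interpret \<eta>: ring_hom_ring R "S Quot J'" \<eta>
    by (intro ring_hom_ringI2 ring_axioms JI.quotient_is_ring)
  have "\<one>\<^bsub>S\<^esub> \<notin> J'"
  proof
    assume "\<one>\<^bsub>S\<^esub> \<in> J'"
    then have "\<one>\<^bsub>S\<^esub> \<in> high_forms (Suc ?w)" using hIdl_high_forms[OF B_carrier] unfolding J'_def by blast
    then have "up_ring.coeff S \<one>\<^bsub>S\<^esub> 0 \<in> high (Suc ?w - 0)" unfolding high_forms_def by blast
    then have "cmp \<one> 0 = \<zero>" by (simp add: high_def)
    then show False using cmp_homogeneous[OF G_one, of 0] by simp
  qed
  then have "J' +>\<^bsub>S\<^esub> \<one>\<^bsub>S\<^esub> \<noteq> J' +>\<^bsub>S\<^esub> \<zero>\<^bsub>S\<^esub>"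
    using hJ[of "\<one>\<^bsub>S\<^esub>" "\<zero>\<^bsub>S\<^esub>"] by (simp add: P.P.minus_eq)
  then have ne: "\<one>\<^bsub>S Quot J'\<^esub> \<noteq> \<zero>\<^bsub>S Quot J'\<^esub>"
    using h.hom_one h.hom_zero by simp
  have sf: "subfield (\<eta> ` G 0) (S Quot J')" by (rule \<eta>.img_is_subfield(2)[OF subfield ne])
  have \<eta>_eq: "\<eta> k = J' +>\<^bsub>S\<^esub> homog 0 k" if "k \<in> G 0" for k
    using homog_of_homogeneous[OF that, of 0] by (simp add: \<eta>_def)
  have image_k: "(\<lambda>x. J' +>\<^bsub>S\<^esub> x) ` poly_grading R G 0 = \<eta> ` G 0"
    unfolding poly_grading_eq F_zero image_image by (rule image_cong[OF refl]) (simp add: \<eta>_eq)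
  have "ring.dimension (S Quot J') (dm (B u v)) (\<eta> ` G 0) (\<psi> ` B u v)"
  proof (rule dimension_transfer[OF ring_axioms JI.quotient_is_ring subfield])
    show "dimension (dm (B u v)) (G 0) (B u v)"
      using finite_dimensionE[OF subfield] Int_F_finite_dimension[OF pow_ideal] unfolding B_def by blast
    show "\<psi> x \<in> carrier (S Quot J')" if "x \<in> B u v" for x
      unfolding \<psi>_def by (rule h.hom_closed[OF hc[OF that]])
    show "\<psi> (x \<oplus> y) = \<psi> x \<oplus>\<^bsub>S Quot J'\<^esub> \<psi> y" if "x \<in> B u v" "y \<in> B u v" for x y
      unfolding \<psi>_def using h.hom_add[OF hc[OF that(1)] hc[OF that(2)]] that BS(1)
      by (simp add: homog_add subset_iff)
    show "\<psi> (k \<otimes> x) = \<eta> k \<otimes>\<^bsub>S Quot J'\<^esub> \<psi> x" if "k \<in> G 0" "x \<in> B u v" for k x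
    proof -
      have "homog ?w (k \<otimes> x) = homog 0 k \<otimes>\<^bsub>S\<^esub> homog ?w x"
        using homog_mult[of k 0 x ?w] that by (simp add: F_zero B_def)
      then show ?thesis
        unfolding \<psi>_def \<eta>_eq[OF that(1)] using h.hom_mult[of "homog 0 k" "homog ?w x"] hc[OF that(2)] K_carrier[OF that(1)]
        by simp
    qed
    show "inj_on \<psi> (B u v)"
    proof (rule inj_onI)
      fix x y assume x: "x \<in> B u v" and y: "y \<in> B u v" and eq: "\<psi> x = \<psi> y"
      have c: "x \<in> carrier R" "y \<in> carrier R" using x y BS(1) by auto
      have d: "x \<ominus> y \<in> B u v" by (rule BS(6)[OF x y])
      have "homog ?w x \<ominus>\<^bsub>S\<^esub> homog ?w y \<in> J'" using eq hJ[OF hc[OF x] hc[OF y]] by (simp add: \<psi>_def)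
      moreover have "homog ?w x = homog ?w (x \<ominus> y) \<oplus>\<^bsub>S\<^esub> homog ?w y"
      proof -
        have "homog ?w (y \<oplus> (x \<ominus> y)) = homog ?w y \<oplus>\<^bsub>S\<^esub> homog ?w (x \<ominus> y)" using c by (intro homog_add) auto
        then have "homog ?w x = homog ?w y \<oplus>\<^bsub>S\<^esub> homog ?w (x \<ominus> y)" using add_minus_cancel[OF c] by simp
        then show ?thesis using P.P.a_comm[OF hc[OF y] hc[OF d]] by simp
      qed
      ultimately have "homog ?w (x \<ominus> y) \<in> J'" using cancel[OF hc[OF d] hc[OF y]] by simp
      then have "x \<ominus> y = \<zero>" by (rule disj[OF d])
      then show "x = y" using add_minus_cancel[OF c] c by simp
    qed
  qed
  then have "ring.dim (S Quot J') (\<eta> ` G 0) (\<psi> ` B u v) = dm (B u v)"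
    using ring.dimI[OF JI.quotient_is_ring sf] by (simp add: over_def)
  then show ?thesis
    unfolding bigraded_hilbert_def quot_dim_def prodK prodJ image_K image_k .
qed

end

section \<open>Mixed multiplicities as limits\<close>

context filtered_rees
begin

text \<open>This also shows that the description in \<open>mixed_multiplicity\<close> determines one
  integer: an expansion exists because the growth is bounded, and any two expansions have the same
  limit.\<close>

lemma dm_B_limit:
  assumes "krull_dim R = enat d"
  shows "\<exists>N. \<forall>u\<ge>N. (\<lambda>v. real (dm (B u v)) / real v ^ d)
    \<longlonglongrightarrow> of_int (mixed_multiplicity S (poly_grading R G 0) d d nn aa) / fact d"
proof -
  obtain C where C: "\<forall>t. dm (F t) \<le> C * (t + 1) ^ d" using dm_F_bound[OF assms] by blast
  have bound: "real_of_int \<bar>(\<lambda>(u, v). int (dm (B u v))) (u, v)\<bar> \<le> real (C * (\<beta> + 1) ^ d) * (real u + real v + 1) ^ d" for u v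
  proof -
    have "dm (B u v) \<le> dm (F (\<beta> * v + u))"
      by (rule dm_mono(1)[OF F_finite_dimension B_subspace]) (auto simp: B_def)
    also have "\<dots> \<le> C * (\<beta> * v + u + 1) ^ d" by (rule C[rule_format])
    also have "\<dots> \<le> C * ((\<beta> + 1) * (u + v + 1)) ^ d"
      by (intro mult_left_mono power_mono) (auto simp: algebra_simps)
    also have "\<dots> = (C * (\<beta> + 1) ^ d) * (u + v + 1) ^ d" unfolding power_mult_distrib by (simp only: mult.assoc)
    finally have "real (dm (B u v)) \<le> real ((C * (\<beta> + 1) ^ d) * (u + v + 1) ^ d)" by (rule of_nat_mono)
    also have "\<dots> = real (C * (\<beta> + 1) ^ d) * (real u + real v + 1) ^ d" by (simp add: add.commute add.left_commute)
    finally show ?thesis by simp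
  qed
  define f where "f = (\<lambda>u v. real (dm (B u v)))"
  obtain e c N where m: "mixed_form d f e c N"
    using ev_bin2_mixed_form[OF ev_bin2_dm_B bound] unfolding f_def by auto
  have "mixed_multiplicity S (poly_grading R G 0) d d nn aa = e d"
    unfolding mixed_multiplicity_def bigraded_hilbert_eq f_def[THEN fun_cong, THEN fun_cong, symmetric]
      mixed_form_def[symmetric]
  proof (rule the_equality)
    show "\<exists>e' c' N'. e d = e' d \<and> mixed_form d f e' c' N'" using m by blast
    fix z assume "\<exists>e' c' N'. z = e' d \<and> mixed_form d f e' c' N'"
    then obtain e' c' N' where z: "z = e' d" "mixed_form d f e' c' N'" by blast
    have "(of_int (e d) / fact d :: real) = of_int (e' d) / fact d"
      by (rule LIMSEQ_unique[OF mixed_form_limit[OF m, of "max N N'"] mixed_form_limit[OF z(2), of "max N N'"]]) auto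
    then show "z = e d" unfolding z(1) by simp
  qed
  then show ?thesis using mixed_form_limit[OF m] unfolding f_def by (intro exI[of _ N]) simp
qed

text \<open>Multiplication by \<open>a\<close> and by \<open>a'\<close> squeezes the module \<open>K\<close> between two shifts of the Rees algebra.\<close>

lemma dm_module_limit:
  assumes K: "\<And>v. ideal (K v) R"
    and a: "a \<in> F e" "a \<noteq> \<zero>" "\<And>v x. x \<in> pow v \<Longrightarrow> a \<otimes> x \<in> K v"
    and a': "a' \<in> F e'" "a' \<noteq> \<zero>" "\<And>v x. x \<in> K v \<Longrightarrow> a' \<otimes> x \<in> pow (Suc v)"
    and lim: "\<forall>u\<ge>N. (\<lambda>v. real (dm (B u v)) / real v ^ d) \<longlonglongrightarrow> L" and u: "u \<ge> N + e"
  shows "(\<lambda>v. real (dm (K v \<inter> F (\<beta> * v + u))) / real v ^ d) \<longlonglongrightarrow> L"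
proof -
  have B_fin: "finite_dimension (G 0) (B i v)" for i v
    unfolding B_def by (rule Int_F_finite_dimension[OF pow_ideal])
  have ac: "a \<in> carrier R" "a' \<in> carrier R" using a(1) a'(1) F_carrier by blast+
  have mult_subspace: "subspace ((\<lambda>x. b \<otimes> x) ` E)" if "finite_dimension (G 0) E" "b \<in> carrier R" "b \<noteq> \<zero>" for b E
    using dm_mult(1)[OF that] finite_dimension_imp_subalgebra[OF subfield] by blast
  \<comment> \<open>Multiplication by \<open>a\<close> costs up to \<open>e\<close> degrees, so the
    lower bound uses the index \<open>u - e\<close>; the threshold \<open>N + e\<close> keeps it at
    least \<open>N\<close>.\<close>
  have lo: "dm (B (u - e) v) \<le> dm (K v \<inter> F (\<beta> * v + u))" for v
  proof -
    have "(\<lambda>x. a \<otimes> x) ` B (u - e) v \<subseteq> K v \<inter> F (\<beta> * v + u)"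
      using a(3) F_mult[OF a(1), of _ "\<beta> * v + (u - e)"] u
      by (auto simp: B_def add.commute add.left_commute)
    then show ?thesis
      using dm_mono(1)[OF Int_F_finite_dimension[OF K] mult_subspace[OF B_fin ac(1) a(2)]]
        dm_mult(2)[OF B_fin ac(1) a(2)] by metis
  qed
  have hi: "dm (K v \<inter> F (\<beta> * v + u)) \<le> dm (B (u + e') (Suc v))" for v
  proof -
    have "(\<lambda>x. a' \<otimes> x) ` (K v \<inter> F (\<beta> * v + u)) \<subseteq> B (u + e') (Suc v)"
      using a'(3) F_mult[OF a'(1), of _ "\<beta> * v + u"] F_mono[of "e' + (\<beta> * v + u)" "\<beta> * Suc v + (u + e')"]
      by (auto simp: B_def)
    then show ?thesis
      using dm_mono(1)[OF B_fin mult_subspace[OF Int_F_finite_dimension[OF K] ac(2) a'(2)]]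
        dm_mult(2)[OF Int_F_finite_dimension[OF K] ac(2) a'(2)] by metis
  qed
  \<comment> \<open>The upper bound lives at \<open>Suc v\<close>; the ratio of \<open>Suc v\<close>
    to \<open>v\<close> tends to 1, so the limit does not change.\<close>
  have shift: "(\<lambda>v. real (dm (B (u + e') (Suc v))) / real v ^ d) \<longlonglongrightarrow> L"
  proof (rule Lim_transform_eventually)
    have "(\<lambda>v. real (dm (B (u + e') (Suc v))) / real (Suc v) ^ d) \<longlonglongrightarrow> L"
      using LIMSEQ_Suc[OF lim[rule_format, of "u + e'"]] u by simp
    moreover have "(\<lambda>v. (1 + 1 / real v) ^ d) \<longlonglongrightarrow> (1 + 0) ^ d"
      by (intro tendsto_intros lim_1_over_n)
    ultimately show "(\<lambda>v. real (dm (B (u + e') (Suc v))) / real (Suc v) ^ d * (1 + 1 / real v) ^ d) \<longlonglongrightarrow> L"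
      using tendsto_mult by fastforce
    show "\<forall>\<^sub>F v in sequentially. real (dm (B (u + e') (Suc v))) / real (Suc v) ^ d * (1 + 1 / real v) ^ d =
        real (dm (B (u + e') (Suc v))) / real v ^ d"
      using eventually_gt_at_top[of 0]
    proof eventually_elim
      case (elim v)
      then have "1 + 1 / real v = real (Suc v) / real v" by (simp add: field_simps)
      then show ?case by (simp add: power_divide)
    qed
  qed
  show ?thesis
  proof (rule tendsto_sandwich[OF _ _ lim[rule_format, of "u - e"] shift])
    show "\<forall>\<^sub>F v in sequentially. real (dm (B (u - e) v)) / real v ^ d \<le> real (dm (K v \<inter> F (\<beta> * v + u))) / real v ^ d"
      using lo by (simp add: divide_right_mono)
    show "\<forall>\<^sub>F v in sequentially. real (dm (K v \<inter> F (\<beta> * v + u))) / real v ^ d \<le> real (dm (B (u + e') (Suc v))) / real v ^ d"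
      using hi by (simp add: divide_right_mono)
  qed (use u in simp)
qed

end

section \<open>The Veronese subalgebra of the saturated Rees algebra\<close>

context std_graded_domain
begin

interpretation P: UP_domain R "UP R"
  by unfold_locales auto

lemma ideal_power_sat_subset:
  assumes "hideal J" shows "ideal_power R (sat J) v \<subseteq> sat (ideal_power R J v)"
proof (induction v)
  case 0
  then show ?case using sat_superset[OF oneideal] by simp
next
  case (Suc v)
  have J: "ideal J R" using assms by (simp add: hideal_def)
  have I: "ideal (sat (ideal_power R J (Suc v))) R"
    by (rule sat_hideal[OF hideal_power[OF assms, of "Suc v"], unfolded hideal_def, THEN conjunct1])
  have "ideal_prod R (ideal_power R (sat J) v) (sat J) \<subseteq> sat (ideal_power R J (Suc v))"
  proof (rule ideal_prod_min[OF _ subspaceD(3)[OF ideal_subspace[OF I]]])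
    fix x y assume "x \<in> ideal_power R (sat J) v" "y \<in> sat J"
    then show "x \<otimes> y \<in> sat (ideal_power R J (Suc v))"
      using sat_mult[OF ideal_power_ideal[OF J, of v] J, of x y] Suc.IH by auto
  qed
  then show ?case by simp
qed

text \<open>Consider the polynomials whose coefficient at \<open>i * v0\<close> lies in the power
  \<open>i\<close> of the saturation of \<open>I ^ v0\<close> and that have no other terms. They are
  closed under the ring operations and contain the pieces of degrees 0 and 1, so by standardness
  they contain the whole Veronese ring. Comparing coefficients gives the inclusion that uses the
  hypothesis.\<close>

lemma standard_veronese_sat_power:
  assumes I: "hideal I" and v0: "v0 > 0"
    and sg: "standard_graded (veronese v0 (sat_rees R mm I) (sat_rees_grading R mm I))
      (veronese_grading v0 (sat_rees_grading R mm I))"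
  shows "sat (ideal_power R I (v * v0)) = ideal_power R (sat (ideal_power R I v0)) v"
proof (rule subset_antisym)
  let ?H = "sat (ideal_power R I v0)"
  define V where "V = veronese v0 (sat_rees R mm I) (sat_rees_grading R mm I)"
  define D where "D = veronese_grading v0 (sat_rees_grading R mm I)"
  have II: "ideal I R" using I by (simp add: hideal_def)
  have ops: "\<one>\<^bsub>V\<^esub> = \<one>\<^bsub>UP R\<^esub>" "\<And>p q. p \<otimes>\<^bsub>V\<^esub> q = p \<otimes>\<^bsub>UP R\<^esub> q" "\<And>p q. p \<oplus>\<^bsub>V\<^esub> q = p \<oplus>\<^bsub>UP R\<^esub> q"
    unfolding V_def veronese_def sat_rees_def by simp_all
  have D: "D i = (\<lambda>a. up_ring.monom (UP R) a (i * v0)) ` sat (ideal_power R I (i * v0))" for i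
    unfolding D_def veronese_grading_def sat_rees_grading_def by simp
  have VD: "graded_ring V D" "generate_ring V (D 0 \<union> D 1) = carrier V"
    using sg unfolding standard_graded_def V_def D_def by simp_all
  have rV: "ring V" and sub: "additive_subgroup (D i) V" for i using VD(1) unfolding graded_ring_def by simp_all
  interpret V: ring V by (rule rV)
  have HI: "ideal ?H R" using sat_hideal[OF hideal_power[OF I]] by (simp add: hideal_def)
  have pI: "ideal (ideal_power R ?H i) R" for i by (rule ideal_power_ideal[OF HI])
  note pS = subspaceD[OF ideal_subspace[OF pI]]
  have satR: "sat (carrier R) = carrier R" using sat_superset[OF oneideal] by (auto simp: saturation_def)
  define A where "A = {p \<in> carrier (UP R). (\<forall>i. up_ring.coeff (UP R) p (i * v0) \<in> ideal_power R ?H i) \<and>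
    (\<forall>n. \<not> v0 dvd n \<longrightarrow> up_ring.coeff (UP R) p n = \<zero>)}"
  have AI: "p \<in> A" if "p \<in> carrier (UP R)" "\<And>i. up_ring.coeff (UP R) p (i * v0) \<in> ideal_power R ?H i"
    "\<And>n. \<not> v0 dvd n \<Longrightarrow> up_ring.coeff (UP R) p n = \<zero>" for p using that by (simp add: A_def)
  have A: "p \<in> carrier (UP R)" "up_ring.coeff (UP R) p (i * v0) \<in> ideal_power R ?H i"
    "\<not> v0 dvd n \<Longrightarrow> up_ring.coeff (UP R) p n = \<zero>" if "p \<in> A" for p i n using that by (simp_all add: A_def)
  have monom_A: "up_ring.monom (UP R) a (i * v0) \<in> A" if "a \<in> ideal_power R ?H i" for a i
  proof (rule AI)
    have a: "a \<in> carrier R" using pS(1) that by blast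
    then show "up_ring.monom (UP R) a (i * v0) \<in> carrier (UP R)" by simp
    show "up_ring.coeff (UP R) (up_ring.monom (UP R) a (i * v0)) (j * v0) \<in> ideal_power R ?H j" for j
      using that a v0 pS(2) by (cases "i = j") simp_all
    show "up_ring.coeff (UP R) (up_ring.monom (UP R) a (i * v0)) n = \<zero>" if "\<not> v0 dvd n" for n
      using that a by (cases "i * v0 = n") auto
  qed
  have add_A: "p \<oplus>\<^bsub>UP R\<^esub> q \<in> A" if "p \<in> A" "q \<in> A" for p q
    using A[OF that(1)] A[OF that(2)] pS(3) by (intro AI) simp_all
  have mult_A: "p \<otimes>\<^bsub>UP R\<^esub> q \<in> A" if p: "p \<in> A" and q: "q \<in> A" for p q
  proof (rule AI)
    have c: "up_ring.coeff (UP R) p n \<in> carrier R" "up_ring.coeff (UP R) q n \<in> carrier R" for n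
      using A(1)[OF p] A(1)[OF q] by simp_all
    show "p \<otimes>\<^bsub>UP R\<^esub> q \<in> carrier (UP R)" using A(1)[OF p] A(1)[OF q] by simp
    have eq: "up_ring.coeff (UP R) (p \<otimes>\<^bsub>UP R\<^esub> q) n =
        (\<Oplus>i\<in>{..n}. up_ring.coeff (UP R) p i \<otimes> up_ring.coeff (UP R) q (n - i))" for n
      using A(1)[OF p] A(1)[OF q] by simp
    show "up_ring.coeff (UP R) (p \<otimes>\<^bsub>UP R\<^esub> q) (j * v0) \<in> ideal_power R ?H j" for j
      unfolding eq
    proof (rule finsum_in[OF pS(1,2,3)])
      fix i assume i: "i \<le> j * v0"
      show "up_ring.coeff (UP R) p i \<otimes> up_ring.coeff (UP R) q (j * v0 - i) \<in> ideal_power R ?H j"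
      proof (cases "v0 dvd i")
        case True
        then obtain l where l: "i = l * v0" by (metis dvd_def mult.commute)
        then have "l \<le> j" using i v0 by simp
        have "up_ring.coeff (UP R) p i \<otimes> up_ring.coeff (UP R) q ((j - l) * v0)
            \<in> ideal_prod R (ideal_power R ?H l) (ideal_power R ?H (j - l))"
          unfolding l by (rule ideal_prod.prod[OF A(2)[OF p] A(2)[OF q]])
        then show ?thesis using ideal_power_add[OF HI, of l "j - l"] \<open>l \<le> j\<close> by (simp add: l diff_mult_distrib)
      next
        case False
        then show ?thesis using A(3)[OF p] c pS(2) by simp
      qed
    qed
    show "up_ring.coeff (UP R) (p \<otimes>\<^bsub>UP R\<^esub> q) n = \<zero>" if n: "\<not> v0 dvd n" for n
    proof -
      have "up_ring.coeff (UP R) (p \<otimes>\<^bsub>UP R\<^esub> q) n \<in> {\<zero>}" unfolding eq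
      proof (rule finsum_in)
        fix i assume "i \<le> n"
        then have "\<not> v0 dvd i \<or> \<not> v0 dvd (n - i)" using n by (metis dvd_add le_add_diff_inverse)
        then show "up_ring.coeff (UP R) p i \<otimes> up_ring.coeff (UP R) q (n - i) \<in> {\<zero>}"
          using A(3)[OF p] A(3)[OF q] c by auto
      qed auto
      then show ?thesis by simp
    qed
  qed
  have D0: "D 0 \<subseteq> A"
    using monom_A[of _ 0] satR by (auto simp: D)
  have D1: "D 1 \<subseteq> A"
    using monom_A[of _ 1] ideal_power_1[OF HI] by (auto simp: D simp del: One_nat_def)
  have "\<one>\<^bsub>V\<^esub> \<in> D 0"
    unfolding ops D P.monom_one[symmetric] mult_0 by (rule imageI) (simp add: satR)
  \<comment> \<open>Additive inverses in the Veronese ring are products with \<open>-1\<close>, so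
    it suffices that \<open>-1\<close>, an element of the degree 0 piece, lies in
    \<open>A\<close>.\<close>
  then have m1: "\<ominus>\<^bsub>V\<^esub> \<one>\<^bsub>V\<^esub> \<in> A" using D0 additive_subgroup.a_inv_closed[OF sub[of 0]] by blast
  have "h \<in> A" if "h \<in> generate_ring V (D 0 \<union> D 1)" for h
    using that
  proof induction
    case one
    show ?case unfolding ops using monom_A[of \<one> 0] by (simp add: P.monom_one)
  next
    case (incl h)
    then show ?case using D0 D1 by blast
  next
    case (a_inv h)
    then have "h \<in> carrier V" using VD(2) by simp
    then have "\<ominus>\<^bsub>V\<^esub> h = (\<ominus>\<^bsub>V\<^esub> \<one>\<^bsub>V\<^esub>) \<otimes>\<^bsub>V\<^esub> h" by (simp add: V.l_minus)
    then show ?case using mult_A[OF m1 a_inv.IH] by (simp add: ops)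
  next
    case (eng_add h1 h2)
    then show ?case using add_A by (simp add: ops)
  next
    case (eng_mult h1 h2)
    then show ?case using mult_A by (simp add: ops)
  qed
  then have VA: "carrier V \<subseteq> A" using VD(2) by blast
  show "sat (ideal_power R I (v * v0)) \<subseteq> ideal_power R ?H v"
  proof
    fix a assume a: "a \<in> sat (ideal_power R I (v * v0))"
    then have "up_ring.monom (UP R) a (v * v0) \<in> A"
      using VA additive_subgroup.a_Hcarr[OF sub[of v]] D by blast
    from A(2)[OF this, of v] show "a \<in> ideal_power R ?H v"
      using a by (simp add: saturation_def)
  qed
  have "ideal_power R (ideal_power R I v0) v = ideal_power R I (v * v0)"
    using ideal_power_mult[OF II, of v0 v] by (simp add: mult.commute)
  then show "ideal_power R ?H v \<subseteq> sat (ideal_power R I (v * v0))"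
    using ideal_power_sat_subset[OF hideal_power[OF I, of v0], of v] by simp
qed

end

section \<open>The limit\<close>

text \<open>As there are only finitely many classes, a common threshold exists.\<close>

lemma LIMSEQ_residue_classes:
  fixes f :: "nat \<Rightarrow> 'x::metric_space"
  assumes m: "m > 0" and lim: "\<And>r. r < m \<Longrightarrow> (\<lambda>v. f (v * m + r)) \<longlonglongrightarrow> L"
  shows "f \<longlonglongrightarrow> L"
proof (rule metric_LIMSEQ_I)
  fix e :: real assume e: "e > 0"
  have "\<forall>\<^sub>F v in sequentially. \<forall>r\<in>{..<m}. dist (f (v * m + r)) L < e"
    by (rule eventually_ball_finite) (use lim e in \<open>auto simp: tendsto_iff\<close>)
  then obtain M where M: "\<And>v r. v \<ge> M \<Longrightarrow> r < m \<Longrightarrow> dist (f (v * m + r)) L < e"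
    unfolding eventually_sequentially by auto
  have "dist (f n) L < e" if "n \<ge> M * m" for n
  proof -
    have "n div m \<ge> M" using div_le_mono[OF that, of m] m by simp
    then show ?thesis using M[of "n div m" "n mod m"] m by simp
  qed
  then show "\<exists>no. \<forall>n\<ge>no. dist (f n) L < e" by blast
qed

text \<open>\<open>v * m + r\<close> is asymptotic to \<open>m * v\<close>; with
  \<open>m = v0\<close> this is the origin of the factor \<open>1 / v0 ^ d\<close> in the
  theorem.\<close>

lemma LIMSEQ_residue_class_power:
  assumes m: "m > 0" and lim: "(\<lambda>v. f (v * m + r) / real v ^ d) \<longlonglongrightarrow> L"
  shows "(\<lambda>v. f (v * m + r) / real (v * m + r) ^ d) \<longlonglongrightarrow> L / real m ^ d"
proof (rule Lim_transform_eventually)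
  have "(\<lambda>v. real m + real r * (1 / real v)) \<longlonglongrightarrow> real m + real r * 0"
    by (intro tendsto_intros lim_1_over_n)
  then have "(\<lambda>v. (real m + real r * (1 / real v)) ^ d) \<longlonglongrightarrow> real m ^ d"
    using tendsto_power by fastforce
  then show "(\<lambda>v. (f (v * m + r) / real v ^ d) / (real m + real r * (1 / real v)) ^ d) \<longlonglongrightarrow> L / real m ^ d"
    using lim m by (intro tendsto_divide) auto
  show "\<forall>\<^sub>F v in sequentially. (f (v * m + r) / real v ^ d) / (real m + real r * (1 / real v)) ^ d =
      f (v * m + r) / real (v * m + r) ^ d"
    using eventually_gt_at_top[of 0]
  proof eventually_elim
    case (elim v)
    then have "real m + real r * (1 / real v) = real (v * m + r) / real v" by (simp add: field_simps)
    then show ?case using elim by (simp only: power_divide) simp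
  qed
qed

context std_graded_domain
begin

text \<open>The length is a single number, while the dimensions may be compared at any
  \<open>t\<close> beyond the degree from which \<open>sat Q\<close> and \<open>Q\<close> agree.
  Having all these \<open>t\<close> available is what the comparison of polynomials needs.\<close>

lemma local_cohomology_length:
  assumes Q: "hideal Q"
  shows "\<exists>t0 l. module_length R (local_cohomology_0 R mm (quot_module R Q)) = enat l \<and>
    (\<forall>t\<ge>t0. real l = real (dm (sat Q \<inter> F t)) - real (dm (Q \<inter> F t)))"
proof -
  have I: "ideal Q R" "ideal (sat Q) R" using Q sat_hideal[OF Q] by (simp_all add: hideal_def)
  obtain t0 where t0: "\<forall>t\<ge>t0. sat Q \<inter> G t \<subseteq> Q" using sat_eventually[OF Q] by blast
  let ?M = "module_length R (local_cohomology_0 R mm (quot_module R Q))"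
  have len: "?M = enat (dm (sat Q \<inter> F t) - dm (Q \<inter> F t))" if "t \<ge> t0" for t
    by (rule module_length_sat_quotient[OF Q]) (use t0 that in auto)
  have "dm (Q \<inter> F t) \<le> dm (sat Q \<inter> F t)" for t
    by (rule dm_mono(1)[OF Int_F_finite_dimension[OF I(2)] Int_F_subspace[OF I(1)]]) (use sat_superset[OF I(1)] in blast)
  then have "real (dm (sat Q \<inter> F t0) - dm (Q \<inter> F t0)) = real (dm (sat Q \<inter> F t)) - real (dm (Q \<inter> F t))" if "t \<ge> t0" for t
    using len[OF that] len[of t0] by (simp add: of_nat_diff)
  then show ?thesis using len[of t0] by blast
qed

text \<open>Supplies the multipliers that compare residue classes: powers of a nonzero element of
  \<open>I\<close> remain nonzero in a domain.\<close>

lemma nonzero_in_ideal_power: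
  assumes I: "ideal I R" "I \<noteq> {\<zero>}"
  shows "\<exists>a e. a \<in> ideal_power R I n \<and> a \<in> F e \<and> a \<noteq> \<zero>"
proof -
  obtain b where b: "b \<in> I" "b \<noteq> \<zero>" using I subspaceD(2)[OF ideal_subspace[OF I(1)]] by blast
  have bc: "b \<in> carrier R" using ideal.Icarr[OF I(1) b(1)] .
  have "\<exists>a. a \<in> ideal_power R I n \<and> a \<noteq> \<zero>"
  proof (induction n)
    case 0
    then show ?case using one_not_zero by auto
  next
    case (Suc n)
    then obtain a where a: "a \<in> ideal_power R I n" "a \<noteq> \<zero>" by blast
    have ac: "a \<in> carrier R" using ideal.Icarr[OF ideal_power_ideal[OF I(1)] a(1)] .
    have "a \<otimes> b \<in> ideal_power R I (Suc n)" using ideal_prod.prod[OF a(1) b(1)] by simp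
    then show ?case using integral_iff[OF ac bc] a b by blast
  qed
  then show ?thesis using F_exhausts ideal.Icarr[OF ideal_power_ideal[OF I(1)]] by blast
qed

text \<open>For large \<open>v\<close> the difference of the two dimensions is a polynomial in the degree shift \<open>u\<close> from a
  bound on that does not depend on \<open>v\<close>. It equals the length for large \<open>u\<close>, so it is constant, and \<open>u\<close>
  may be fixed before \<open>v\<close> tends to infinity.\<close>

lemma length_residue_class_limit:
  assumes kd: "krull_dim R = enat d"
    and I: "hideal I" "I \<noteq> {\<zero>}" and r: "r < v0"
    and gen: "gen (ideal_power R I v0) \<beta>" "gen (sat (ideal_power R I v0)) \<beta>"
    and ver: "\<And>v. sat (ideal_power R I (v * v0)) = ideal_power R (sat (ideal_power R I v0)) v"
    and l: "\<And>n. \<exists>t0. \<forall>t\<ge>t0. real (l n) = real (dm (sat (ideal_power R I n) \<inter> F t)) - real (dm (ideal_power R I n \<inter> F t))"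
  shows "(\<lambda>v. real (l (v * v0 + r)) / real v ^ d) \<longlonglongrightarrow>
    of_int (mixed_multiplicity S (poly_grading R G 0) d d nn
      (degree_part_ideal S (poly_grading R G) (extended_ideal R (sat (ideal_power R I v0))) \<beta>)) / fact d
    - of_int (mixed_multiplicity S (poly_grading R G 0) d d nn
      (degree_part_ideal S (poly_grading R G) (extended_ideal R (ideal_power R I v0)) \<beta>)) / fact d"
    (is "_ \<longlonglongrightarrow> ?L' - ?L")
proof -
  define J where "J = ideal_power R I v0"
  interpret J: filtered_rees R G J \<beta> using gen(1) by unfold_locales (simp add: J_def)
  interpret J': filtered_rees R G "sat J" \<beta> using gen(2) by unfold_locales (simp add: J_def)
  have II: "ideal I R" using I(1) by (simp add: hideal_def)
  have pI: "ideal (ideal_power R I n) R" for n by (rule ideal_power_ideal[OF II])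
  have sI: "ideal (sat (ideal_power R I n)) R" for n
    using sat_hideal[OF hideal_power[OF I(1), of n]] by (simp add: hideal_def)
  have prod: "x \<otimes> y \<in> ideal_power R I (i + j)" if "x \<in> ideal_power R I i" "y \<in> ideal_power R I j" for x y i j
    using ideal_prod.prod[OF that, of R] ideal_power_add[OF II] by simp
  have sprod: "x \<otimes> y \<in> sat (ideal_power R I (i + j))"
    if "x \<in> sat (ideal_power R I i)" "y \<in> sat (ideal_power R I j)" for x y i j
    using sat_mult[OF pI pI that] ideal_power_add[OF II] by simp
  have psat: "x \<in> sat (ideal_power R I n)" if "x \<in> ideal_power R I n" for x n
    using sat_superset[OF pI] that by blast
  have Jp: "ideal_power R J v = ideal_power R I (v * v0)" for v
    unfolding J_def using ideal_power_mult[OF II, of v0 v] by (simp only: mult.commute)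
  have J'p: "ideal_power R (sat J) v = sat (ideal_power R I (v * v0))" for v
    unfolding J_def by (rule ver[symmetric])
  define K where "K = (\<lambda>v. ideal_power R I (v * v0 + r))"
  define K' where "K' = (\<lambda>v. sat (ideal_power R I (v * v0 + r)))"
  \<comment> \<open>Multiplication by \<open>a\<close> leads from the power \<open>v * v0\<close> of
    \<open>I\<close> to the power \<open>v * v0 + r\<close>, and likewise for the
    saturations.\<close>
  obtain a e where a: "a \<in> ideal_power R I r" "a \<in> F e" "a \<noteq> \<zero>"
    using nonzero_in_ideal_power[OF II I(2)] by blast
  \<comment> \<open>Multiplication by \<open>a'\<close> fills the exponent up to the next multiple
    of \<open>v0\<close>, so it leads from \<open>K v\<close> into the power \<open>Suc v\<close> of
    \<open>J\<close>, and from \<open>K' v\<close> into that of \<open>sat J\<close>.\<close>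
  obtain a' e' where a': "a' \<in> ideal_power R I (v0 - r)" "a' \<in> F e'" "a' \<noteq> \<zero>"
    using nonzero_in_ideal_power[OF II I(2)] by blast
  have KI: "ideal (K v) R" "ideal (K' v) R" for v unfolding K_def K'_def by (rule pI, rule sI)
  have idx: "v0 + (v * v0 + r) = Suc v * v0 + r" "r + v * v0 = v * v0 + r"
    "(v0 - r) + (v * v0 + r) = Suc v * v0" for v using r by auto
  have JK: "x \<otimes> y \<in> K (Suc v)" if "x \<in> J" "y \<in> K v" for x y v
    using prod[of x v0 y "v * v0 + r"] that unfolding J_def K_def idx by blast
  have JK': "x \<otimes> y \<in> K' (Suc v)" if "x \<in> sat J" "y \<in> K' v" for x y v
    using sprod[of x v0 y "v * v0 + r"] that unfolding J_def K'_def idx by blast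
  have aK: "a \<otimes> x \<in> K v" if "x \<in> ideal_power R J v" for x v
    using prod[OF a(1), of x "v * v0"] that unfolding Jp K_def idx by blast
  have aK': "a \<otimes> x \<in> K' v" if "x \<in> ideal_power R (sat J) v" for x v
    using sprod[OF psat[OF a(1)], of x "v * v0"] that unfolding J'p K'_def idx by blast
  have a'K: "a' \<otimes> x \<in> ideal_power R J (Suc v)" if "x \<in> K v" for x v
    using prod[OF a'(1), of x "v * v0 + r"] that unfolding Jp K_def idx by blast
  have a'K': "a' \<otimes> x \<in> ideal_power R (sat J) (Suc v)" if "x \<in> K' v" for x v
    using sprod[OF psat[OF a'(1)], of x "v * v0 + r"] that unfolding J'p K'_def idx by blast
  obtain N where N: "\<forall>v\<ge>N. \<exists>P. \<forall>u\<ge>N. real (dm (K v \<inter> F (\<beta> * v + u))) = poly P (real u)"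
    using J.dm_module_poly[of K a' e', OF KI(1) JK a'(2,3) a'K] by blast
  obtain N' where N': "\<forall>v\<ge>N'. \<exists>P. \<forall>u\<ge>N'. real (dm (K' v \<inter> F (\<beta> * v + u))) = poly P (real u)"
    using J'.dm_module_poly[of K' a' e', OF KI(2) JK' a'(2,3) a'K'] by blast
  have const: "real (l (v * v0 + r)) = real (dm (K' v \<inter> F (\<beta> * v + u))) - real (dm (K v \<inter> F (\<beta> * v + u)))"
    if v: "v \<ge> max N N'" and u: "u \<ge> max N N'" for u v
  proof -
    obtain P where P: "\<forall>u\<ge>N. real (dm (K v \<inter> F (\<beta> * v + u))) = poly P (real u)"
      using N v by (meson max.boundedE)
    obtain P' where P': "\<forall>u\<ge>N'. real (dm (K' v \<inter> F (\<beta> * v + u))) = poly P' (real u)"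
      using N' v by (meson max.boundedE)
    obtain t0 where t0: "\<forall>t\<ge>t0. real (l (v * v0 + r)) = real (dm (K' v \<inter> F t)) - real (dm (K v \<inter> F t))"
      using l[of "v * v0 + r"] unfolding K_def K'_def by blast
    \<comment> \<open>The length does not depend on \<open>u\<close>, so \<open>P' - P\<close> is
      constant for large \<open>u\<close> and hence everywhere. The identity thus already holds from
      \<open>max N N'\<close> on, although \<open>t0\<close> depends on \<open>v\<close>.\<close>
    have "poly (P' - P) (real u) = real (l (v * v0 + r))"
    proof (rule poly_eventually_const)
      fix u :: nat assume u: "u \<ge> max t0 (max N N')"
      then show "poly (P' - P) (real u) = real (l (v * v0 + r))"
        using t0[rule_format, of "\<beta> * v + u"] P[rule_format, of u] P'[rule_format, of u] by simp
    qed
    then show ?thesis using P[rule_format, of u] P'[rule_format, of u] u by simp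
  qed
  obtain M where M: "\<forall>u\<ge>M. (\<lambda>v. real (dm (J.B u v)) / real v ^ d) \<longlonglongrightarrow> ?L"
    using J.dm_B_limit[OF kd] unfolding J_def by blast
  obtain M' where M': "\<forall>u\<ge>M'. (\<lambda>v. real (dm (J'.B u v)) / real v ^ d) \<longlonglongrightarrow> ?L'"
    using J'.dm_B_limit[OF kd] unfolding J_def by blast
  \<comment> \<open>One \<open>u\<close> for all \<open>v\<close>, beyond the thresholds of both
    polynomial identities and of both limits; \<open>e\<close> is added because the squeeze uses the
    index \<open>u - e\<close>.\<close>
  define u where "u = max (max N N') (max (M + e) (M' + e))"
  have uM: "u \<ge> M + e" "u \<ge> M' + e" "u \<ge> max N N'" unfolding u_def by simp_all
  have lim: "(\<lambda>v. real (dm (K v \<inter> F (\<beta> * v + u))) / real v ^ d) \<longlonglongrightarrow> ?L"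
    by (rule J.dm_module_limit[of K a e a' e', OF KI(1) a(2,3) aK a'(2,3) a'K M uM(1)])
  have lim': "(\<lambda>v. real (dm (K' v \<inter> F (\<beta> * v + u))) / real v ^ d) \<longlonglongrightarrow> ?L'"
    by (rule J'.dm_module_limit[of K' a e a' e', OF KI(2) a(2,3) aK' a'(2,3) a'K' M' uM(2)])
  have "\<forall>\<^sub>F v in sequentially. real (dm (K' v \<inter> F (\<beta> * v + u))) / real v ^ d - real (dm (K v \<inter> F (\<beta> * v + u))) / real v ^ d
      = real (l (v * v0 + r)) / real v ^ d"
    using eventually_ge_at_top[of "max N N'"]
    by eventually_elim (simp add: const[OF _ uM(3)] diff_divide_distrib)
  then show ?thesis by (rule Lim_transform_eventually[OF tendsto_diff[OF lim' lim]])
qed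

lemma epsilon_seq_limit:
  assumes kd: "krull_dim R = enat d"
    and I: "hideal I" "I \<noteq> {\<zero>}" and v0: "v0 > 0"
    and gen: "gen (ideal_power R I v0) \<beta>" "gen (sat (ideal_power R I v0)) \<beta>"
    and ver: "\<And>v. sat (ideal_power R I (v * v0)) = ideal_power R (sat (ideal_power R I v0)) v"
  shows "epsilon_seq R mm d I \<longlonglongrightarrow> ereal (1 / real v0 ^ d *
    (of_int (mixed_multiplicity S (poly_grading R G 0) d d nn
      (degree_part_ideal S (poly_grading R G) (extended_ideal R (sat (ideal_power R I v0))) \<beta>))
    - of_int (mixed_multiplicity S (poly_grading R G 0) d d nn
      (degree_part_ideal S (poly_grading R G) (extended_ideal R (ideal_power R I v0)) \<beta>))))"
    (is "_ \<longlonglongrightarrow> ereal (_ * (?z' - ?z))")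
proof -
  have "\<forall>n. \<exists>l. module_length R (local_cohomology_0 R mm (quot_module R (ideal_power R I n))) = enat l \<and>
    (\<exists>t0. \<forall>t\<ge>t0. real l = real (dm (sat (ideal_power R I n) \<inter> F t)) - real (dm (ideal_power R I n \<inter> F t)))"
  proof
    fix n
    show "\<exists>l. module_length R (local_cohomology_0 R mm (quot_module R (ideal_power R I n))) = enat l \<and>
      (\<exists>t0. \<forall>t\<ge>t0. real l = real (dm (sat (ideal_power R I n) \<inter> F t)) - real (dm (ideal_power R I n \<inter> F t)))"
      using local_cohomology_length[OF hideal_power[OF I(1), of n]] by blast
  qed
  from choice[OF this] obtain l where
    l: "\<And>n. module_length R (local_cohomology_0 R mm (quot_module R (ideal_power R I n))) = enat (l n)"
    and lt: "\<And>n. \<exists>t0. \<forall>t\<ge>t0. real (l n) = real (dm (sat (ideal_power R I n) \<inter> F t)) - real (dm (ideal_power R I n \<inter> F t))"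
    by blast
  have "(\<lambda>n. real (l n) / real n ^ d) \<longlonglongrightarrow> (?z' / fact d - ?z / fact d) / real v0 ^ d"
  proof (rule LIMSEQ_residue_classes[OF v0])
    fix r assume r: "r < v0"
    show "(\<lambda>v. real (l (v * v0 + r)) / real (v * v0 + r) ^ d) \<longlonglongrightarrow> (?z' / fact d - ?z / fact d) / real v0 ^ d"
      by (rule LIMSEQ_residue_class_power[where f = "\<lambda>n. real (l n)",
            OF v0 length_residue_class_limit[OF kd I r gen ver lt]])
  qed
  then have "(\<lambda>n. real (l n) / real n ^ d * fact d) \<longlonglongrightarrow> (?z' / fact d - ?z / fact d) / real v0 ^ d * fact d"
    by (rule tendsto_mult) (rule tendsto_const)
  also have "(?z' / fact d - ?z / fact d) / real v0 ^ d * fact d = 1 / real v0 ^ d * (?z' - ?z)"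
    by (simp add: diff_divide_distrib[symmetric])
  finally have "(\<lambda>n. ereal (real (l n) / real n ^ d * fact d)) \<longlonglongrightarrow> ereal (1 / real v0 ^ d * (?z' - ?z))"
    by (rule tendsto_ereal)
  moreover have "\<forall>\<^sub>F n in sequentially. ereal (real (l n) / real n ^ d * fact d) = epsilon_seq R mm d I n"
    using eventually_gt_at_top[of 0]
    by eventually_elim (simp add: epsilon_seq_def l)
  ultimately show ?thesis by (rule Lim_transform_eventually)
qed

end

theorem theorem5p7:
  fixes R :: "('a, 'b) ring_scheme"
    and R_gr :: "nat \<Rightarrow> 'a set"
    and \<mm> I :: "'a set"
    and S :: "('a, nat \<Rightarrow> 'a) up_ring"
    and S_gr :: "nat \<Rightarrow> (nat \<Rightarrow> 'a) set"
    and \<nn> :: "(nat \<Rightarrow> 'a) set"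
    and d v\<^sub>0 \<beta> :: nat
  assumes "domain R"
    and "standard_graded R R_gr"
    and "subfield (R_gr 0) R"
    and "\<exists>F. finite F \<and> F \<subseteq> carrier R \<and> generate_ring R (R_gr 0 \<union> F) = carrier R"
    and "krull_dim R = enat d" and "d > 0"
    and "\<mm> = irrelevant R R_gr"
    and "homogeneous_ideal R R_gr I" and "I \<noteq> {\<zero>\<^bsub>R\<^esub>}"
    and "S = UP R"
    and "S_gr = poly_grading R R_gr"
    and "\<nn> = poly_max_ideal R \<mm>"
    and "v\<^sub>0 > 0"
    and "standard_graded
           (veronese v\<^sub>0 (sat_rees R \<mm> I) (sat_rees_grading R \<mm> I))
           (veronese_grading v\<^sub>0 (sat_rees_grading R \<mm> I))"
    and "\<beta> > 0"
    and "generated_in_degrees_le R R_gr (ideal_power R I v\<^sub>0) \<beta>"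
    and "generated_in_degrees_le R R_gr (saturation R \<mm> (ideal_power R I v\<^sub>0)) \<beta>"
  shows "epsilon_seq R \<mm> d I \<longlonglongrightarrow> epsilon_multiplicity R \<mm> d I
    \<and> epsilon_multiplicity R \<mm> d I = ereal (1 / real v\<^sub>0 ^ d *
        (of_int (mixed_multiplicity S (S_gr 0) d d \<nn>
           (degree_part_ideal S S_gr
              (extended_ideal R (saturation R \<mm> (ideal_power R I v\<^sub>0))) \<beta>))
         - of_int (mixed_multiplicity S (S_gr 0) d d \<nn>
           (degree_part_ideal S S_gr
              (extended_ideal R (ideal_power R I v\<^sub>0)) \<beta>))))"
proof -
  interpret std_graded_domain R R_gr
    using assms(1,2,3,4)
    by (intro std_graded_domain.intro std_graded_domain_axioms.intro) (simp_all add: standard_graded_def)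
  note I = homogeneous_ideal_hideal[OF assms(8)]
  have "epsilon_seq R \<mm> d I \<longlonglongrightarrow> ereal (1 / real v\<^sub>0 ^ d *
        (of_int (mixed_multiplicity S (S_gr 0) d d \<nn>
           (degree_part_ideal S S_gr
              (extended_ideal R (saturation R \<mm> (ideal_power R I v\<^sub>0))) \<beta>))
         - of_int (mixed_multiplicity S (S_gr 0) d d \<nn>
           (degree_part_ideal S S_gr
              (extended_ideal R (ideal_power R I v\<^sub>0)) \<beta>))))"
    using epsilon_seq_limit[OF assms(5) I assms(9,13) _ _ standard_veronese_sat_power[OF I assms(13)], of \<beta>]
      assms(14,16,17)
    unfolding gen_def assms(7,10,11,12) by blast
  then show ?thesis
    using lim_imp_Limsup[OF sequentially_bot] unfolding epsilon_multiplicity_def by metis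
qed

end
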